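(* Let $R$ be a commutative ring with unit, let $M$ be an $R$-module, and suppose that the symmetric algebra $\operatorname{Sym}(M)$ is equipped with a Poisson bracket $\{\cdot,\cdot\}$, making it into a (polynomial) Poisson algebra. Let $\operatorname{Sym}(M)\# T(M)$ be the smash product algebra for the $T(M)$-module algebra structure on $\operatorname{Sym}(M)$ given by $$(x_1\otimes x_2\otimes\cdots\otimes x_k)\cdot a:=\{x_1,\{x_2,\dots\{x_k,a\}\dots\}\}\qquad(x_1,\dots,x_k\in M,\ a\in\operatorname{Sym}(M)).$$ Let $\psi_M:\operatorname{Sym}(M)\to\operatorname{Sym}(M)\# T(M)$ be the unique $R$-linear derivation with $\psi_M(x)=1\#x$ for all $x\in M$, i.e. $\psi_M(x_1\cdots x_k)=\sum_{i=1}^k(x_1\cdots\widehat{x_i}\cdots x_k)\#x_i$. Let $J_M$ be the two-sided ideal of $\operatorname{Sym}(M)\# T(M)$ generated by all elements $1\#(x\otimes y-y\otimes x)-\psi_M(\{x,y\})$ with $x,y\in M$, and let $\pi_M:\operatorname{Sym}(M)\# T(M)\to(\operatorname{Sym}(M)\# T(M))/J_M$ be the canonical surjection. Define $$\alpha,\beta:\operatorname{Sym}(M)\to(\operatorname{Sym}(M)\# T(M))/J_M,\qquad\alpha(a):=\pi_M(a\#1),\quad\beta(a):=\pi_M(\psi_M(a)).$$ Then $((\operatorname{Sym}(M)\# T(M))/J_M,\alpha,\beta)$ is a Poisson enveloping algebra of the polynomial Poisson algebra $\operatorname{Sym}(M)$.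
   Context: All rings and associative algebras are unitary and morphisms preserve units; algebras are over $R$ and $\otimes=\otimes_R$. The hat in $\widehat{x_i}$ means that the factor is omitted. A Poisson algebra over $R$ is an $R$-module $\mathcal{A}$ with a commutative (associative, unitary) $R$-algebra structure and an $R$-Lie algebra structure $\{\cdot,\cdot\}$ (the Poisson bracket) such that $\{a_1a_2,a_3\}=a_1\{a_2,a_3\}+a_2\{a_1,a_3\}$ for all $a_1,a_2,a_3$. The tensor algebra $T(M)$ has its standard Hopf algebra structure, with $\Delta(x)=1\otimes x+x\otimes1$ and $\epsilon(x)=0$ for $x\in M$. For a Hopf algebra $H$, an algebra $\mathcal{A}$ which is a left $H$-module is a left $H$-module algebra if $u\cdot(a_1a_2)=\sum_{(u)}(u_{(1)}\cdot a_1)(u_{(2)}\cdot a_2)$ and $u\cdot1=\epsilon(u)1$ (Sweedler notation). The smash product algebra $\mathcal{A}\# H$ is the $R$-module $\mathcal{A}\otimes H$, with elements $a\otimes u$ written $a\#u$, and with associative product $(a_1\# u)\odot(a_2\# v):=\sum_{(u)}a_1(u_{(1)}\cdot a_2)\# u_{(2)}v$ and unit $1\#1$. It is an $\mathcal{A}$-module via $a_1\cdot(a_2\#u)=a_1a_2\#u$; the word derivation for $\psi_M$ refers to this module structure: $\psi_M(ab)=a\,\psi_M(b)+b\,\psi_M(a)$. For an algebra $U$, $U_L$ denotes $U$ viewed as a Lie algebra with the commutator bracket. A Poisson enveloping algebra of a Poisson algebra $\mathcal{A}$ is a triple $(U,\alpha,\beta)$ with $U$ an algebra, $\alpha:\mathcal{A}\to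 U$ an algebra morphism and $\beta:\mathcal{A}\to U_L$ a Lie algebra morphism such that for all $a_1,a_2\in\mathcal{A}$: $\alpha(\{a_1,a_2\})=\alpha(a_1)\beta(a_2)-\beta(a_2)\alpha(a_1)$ and $\beta(a_1a_2)=\alpha(a_1)\beta(a_2)+\alpha(a_2)\beta(a_1)$, and which is universal: for any algebra $U'$, algebra morphism $\alpha':\mathcal{A}\to U'$ and Lie algebra morphism $\beta':\mathcal{A}\to U'_L$ satisfying the same two identities, there is a unique algebra morphism $\gamma:U\to U'$ with $\gamma\circ\alpha=\alpha'$ and $\gamma\circ\beta=\beta'$. *)

theory Defs
  imports "HOL-Algebra.Module" "HOL-Algebra.QuotRing"
begin

section \<open>Associative algebras, Lie algebras, Poisson algebras\<close>

text \<open>The library locale \<open>algebra\<close> is for commutative algebras; this is its noncommutative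
  counterpart.\<close>

locale assoc_algebra = module + ring M +
  assumes smult_mult_left:
      "\<lbrakk>r \<in> carrier R; x \<in> carrier M; y \<in> carrier M\<rbrakk>
        \<Longrightarrow> (r \<odot>\<^bsub>M\<^esub> x) \<otimes>\<^bsub>M\<^esub> y = r \<odot>\<^bsub>M\<^esub> (x \<otimes>\<^bsub>M\<^esub> y)"
    and smult_mult_right:
      "\<lbrakk>r \<in> carrier R; x \<in> carrier M; y \<in> carrier M\<rbrakk>
        \<Longrightarrow> x \<otimes>\<^bsub>M\<^esub> (r \<odot>\<^bsub>M\<^esub> y) = r \<odot>\<^bsub>M\<^esub> (x \<otimes>\<^bsub>M\<^esub> y)"

definition linear_maps ::
    "('r, 'k) ring_scheme \<Rightarrow> ('r, 'a, 'l) module_scheme \<Rightarrow> ('r, 'b, 'n) module_scheme \<Rightarrow> ('a \<Rightarrow> 'b) set"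
  where "linear_maps R M N = {f \<in> carrier M \<rightarrow> carrier N.
    (\<forall>x\<in>carrier M. \<forall>y\<in>carrier M. f (x \<oplus>\<^bsub>M\<^esub> y) = f x \<oplus>\<^bsub>N\<^esub> f y) \<and>
    (\<forall>r\<in>carrier R. \<forall>x\<in>carrier M. f (r \<odot>\<^bsub>M\<^esub> x) = r \<odot>\<^bsub>N\<^esub> f x)}"

definition algebra_hom ::
    "('r, 'k) ring_scheme \<Rightarrow> ('r, 'a, 'l) module_scheme \<Rightarrow> ('r, 'b, 'n) module_scheme \<Rightarrow> ('a \<Rightarrow> 'b) set"
  where "algebra_hom R A B = ring_hom A B \<inter> linear_maps R A B"

locale lie_algebra = module +
  fixes bracket :: "_ \<Rightarrow> _ \<Rightarrow> _"
  assumes bracket_linear_left: "y \<in> carrier M \<Longrightarrow> (\<lambda>x. bracket x y) \<in> linear_maps R M M"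
    and bracket_linear_right: "x \<in> carrier M \<Longrightarrow> bracket x \<in> linear_maps R M M"
    and bracket_self: "x \<in> carrier M \<Longrightarrow> bracket x x = \<zero>\<^bsub>M\<^esub>"
    and jacobi: "\<lbrakk>x \<in> carrier M; y \<in> carrier M; z \<in> carrier M\<rbrakk>
      \<Longrightarrow> bracket x (bracket y z) \<oplus>\<^bsub>M\<^esub> bracket y (bracket z x) \<oplus>\<^bsub>M\<^esub> bracket z (bracket x y) = \<zero>\<^bsub>M\<^esub>"

locale poisson_algebra = algebra + lie_algebra +
  assumes leibniz: "\<lbrakk>a1 \<in> carrier M; a2 \<in> carrier M; a3 \<in> carrier M\<rbrakk>
      \<Longrightarrow> bracket (a1 \<otimes>\<^bsub>M\<^esub> a2) a3 = a1 \<otimes>\<^bsub>M\<^esub> bracket a2 a3 \<oplus>\<^bsub>M\<^esub> a2 \<otimes>\<^bsub>M\<^esub> bracket a1 a3"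


section \<open>Poisson enveloping algebras\<close>

text \<open>The two maps and their identities, without universality.\<close>

definition poisson_triple ::
    "('r, 'k) ring_scheme \<Rightarrow> ('r, 'a, 'l) module_scheme \<Rightarrow> ('a \<Rightarrow> 'a \<Rightarrow> 'a) \<Rightarrow>
     ('r, 'u, 'n) module_scheme \<Rightarrow> ('a \<Rightarrow> 'u) \<Rightarrow> ('a \<Rightarrow> 'u) \<Rightarrow> bool"
  where "poisson_triple R A br U \<alpha> \<beta> \<longleftrightarrow>
    assoc_algebra R U \<and>
    \<alpha> \<in> algebra_hom R A U \<and>
    \<beta> \<in> linear_maps R A U \<and>
    (\<forall>a1\<in>carrier A. \<forall>a2\<in>carrier A.
      \<beta> (br a1 a2) = \<beta> a1 \<otimes>\<^bsub>U\<^esub> \<beta> a2 \<ominus>\<^bsub>U\<^esub> \<beta> a2 \<otimes>\<^bsub>U\<^esub> \<beta> a1 \<and>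
      \<alpha> (br a1 a2) = \<alpha> a1 \<otimes>\<^bsub>U\<^esub> \<beta> a2 \<ominus>\<^bsub>U\<^esub> \<beta> a2 \<otimes>\<^bsub>U\<^esub> \<alpha> a1 \<and>
      \<beta> (a1 \<otimes>\<^bsub>A\<^esub> a2) = \<alpha> a1 \<otimes>\<^bsub>U\<^esub> \<beta> a2 \<oplus>\<^bsub>U\<^esub> \<alpha> a2 \<otimes>\<^bsub>U\<^esub> \<beta> a1)"

text \<open>HOL formulas cannot quantify over types, so the type \<open>'v\<close> carrying the test algebras is a
  parameter. A theorem about \<open>poisson_enveloping_algebra TYPE('v)\<close> for a type variable \<open>'v\<close>
  expresses universality against all algebras. Restricting \<open>\<gamma>\<close> to extensional functions makes
  uniqueness mean uniqueness on the carrier.\<close>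

definition poisson_enveloping_algebra ::
    "'v itself \<Rightarrow> ('r, 'k) ring_scheme \<Rightarrow> ('r, 'a, 'l) module_scheme \<Rightarrow> ('a \<Rightarrow> 'a \<Rightarrow> 'a) \<Rightarrow>
     ('r, 'u, 'n) module_scheme \<Rightarrow> ('a \<Rightarrow> 'u) \<Rightarrow> ('a \<Rightarrow> 'u) \<Rightarrow> bool"
  where "poisson_enveloping_algebra _ R A br U \<alpha> \<beta> \<longleftrightarrow>
    poisson_triple R A br U \<alpha> \<beta> \<and>
    (\<forall>(U' :: ('r, 'v) module) \<alpha>' \<beta>'. poisson_triple R A br U' \<alpha>' \<beta>' \<longrightarrow>
      (\<exists>!\<gamma>. \<gamma> \<in> extensional (carrier U) \<and> \<gamma> \<in> algebra_hom R U U' \<and>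
        (\<forall>a\<in>carrier A. \<gamma> (\<alpha> a) = \<alpha>' a \<and> \<gamma> (\<beta> a) = \<beta>' a)))"


section \<open>Free modules and quotients\<close>

text \<open>The multiplicative fields of the record are irrelevant for a module; they are overwritten
  below whenever a multiplication is introduced.\<close>

definition free_module :: "('r, 'k) ring_scheme \<Rightarrow> 's set \<Rightarrow> ('r, 's \<Rightarrow> 'r) module"
  where "free_module R S =
    \<lparr>carrier = {f. (\<forall>s\<in>S. f s \<in> carrier R) \<and> (\<forall>s. s \<notin> S \<longrightarrow> f s = \<zero>\<^bsub>R\<^esub>) \<and> finite {s. f s \<noteq> \<zero>\<^bsub>R\<^esub>}},
     mult = undefined, one = undefined,
     zero = (\<lambda>s. \<zero>\<^bsub>R\<^esub>), add = (\<lambda>f g s. f s \<oplus>\<^bsub>R\<^esub> g s),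
     smult = (\<lambda>r f s. r \<otimes>\<^bsub>R\<^esub> f s)\<rparr>"

definition basis_elem :: "('r, 'k) ring_scheme \<Rightarrow> 's \<Rightarrow> 's \<Rightarrow> 'r"
  where "basis_elem R s = (\<lambda>t. if t = s then \<one>\<^bsub>R\<^esub> else \<zero>\<^bsub>R\<^esub>)"

definition gen_submodule ::
    "('r, 'k) ring_scheme \<Rightarrow> ('r, 'a, 'l) module_scheme \<Rightarrow> 'a set \<Rightarrow> 'a set"
  where "gen_submodule R M X = \<Inter>{H. submodule H R M \<and> X \<subseteq> H}"

text \<open>The quotient ring \<open>A Quot I\<close> with the induced scalar multiplication. It is also used for the
  quotient of a module by a submodule, where the multiplicative fields carry no meaning.\<close>

definition quot_alg :: "('r, 'a, 'l) module_scheme \<Rightarrow> 'a set \<Rightarrow> ('r, 'a set) module"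
  where "quot_alg A I =
    ring.extend (A Quot I) (module.fields (\<lambda>r X. \<Union>x\<in>X. I +>\<^bsub>A\<^esub> (r \<odot>\<^bsub>A\<^esub> x)))"

text \<open>The linear map into \<open>P\<close>, on a quotient of a free module over \<open>R\<close>, that sends the class of
  each basis element \<open>s\<close> to \<open>\<phi> s\<close>. It is meaningful when \<open>\<phi>\<close> respects the relations, so that the
  value does not depend on the representative.\<close>

definition lin_ext ::
    "('r, 'k) ring_scheme \<Rightarrow> ('r, 'p, 'l) module_scheme \<Rightarrow> ('s \<Rightarrow> 'p) \<Rightarrow> ('s \<Rightarrow> 'r) set \<Rightarrow> 'p"
  where "lin_ext R P \<phi> X =
    (let f = (SOME f. f \<in> X) in \<Oplus>\<^bsub>P\<^esub>s\<in>{s. f s \<noteq> \<zero>\<^bsub>R\<^esub>}. f s \<odot>\<^bsub>P\<^esub> \<phi> s)"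


section \<open>Tensor products\<close>

definition tensor_rels ::
    "('r, 'k) ring_scheme \<Rightarrow> ('r, 'a, 'l) module_scheme \<Rightarrow> ('r, 'b, 'n) module_scheme \<Rightarrow> ('a \<times> 'b \<Rightarrow> 'r) set"
  where "tensor_rels R M N =
    (let F = free_module R (carrier M \<times> carrier N); e = (\<lambda>x y. basis_elem R (x, y)) in
      {e (x \<oplus>\<^bsub>M\<^esub> x') y \<ominus>\<^bsub>F\<^esub> (e x y \<oplus>\<^bsub>F\<^esub> e x' y) | x x' y.
        x \<in> carrier M \<and> x' \<in> carrier M \<and> y \<in> carrier N} \<union>
      {e x (y \<oplus>\<^bsub>N\<^esub> y') \<ominus>\<^bsub>F\<^esub> (e x y \<oplus>\<^bsub>F\<^esub> e x y') | x y y'.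
        x \<in> carrier M \<and> y \<in> carrier N \<and> y' \<in> carrier N} \<union>
      {e (r \<odot>\<^bsub>M\<^esub> x) y \<ominus>\<^bsub>F\<^esub> r \<odot>\<^bsub>F\<^esub> e x y | r x y.
        r \<in> carrier R \<and> x \<in> carrier M \<and> y \<in> carrier N} \<union>
      {e x (r \<odot>\<^bsub>N\<^esub> y) \<ominus>\<^bsub>F\<^esub> r \<odot>\<^bsub>F\<^esub> e x y | r x y.
        r \<in> carrier R \<and> x \<in> carrier M \<and> y \<in> carrier N})"

definition tensor_null ::
    "('r, 'k) ring_scheme \<Rightarrow> ('r, 'a, 'l) module_scheme \<Rightarrow> ('r, 'b, 'n) module_scheme \<Rightarrow> ('a \<times> 'b \<Rightarrow> 'r) set"
  where "tensor_null R M N =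
    gen_submodule R (free_module R (carrier M \<times> carrier N)) (tensor_rels R M N)"

definition tensor ::
    "('r, 'k) ring_scheme \<Rightarrow> ('r, 'a, 'l) module_scheme \<Rightarrow> ('r, 'b, 'n) module_scheme \<Rightarrow>
     ('r, ('a \<times> 'b \<Rightarrow> 'r) set) module"
  where "tensor R M N = quot_alg (free_module R (carrier M \<times> carrier N)) (tensor_null R M N)"

definition pure_tensor ::
    "('r, 'k) ring_scheme \<Rightarrow> ('r, 'a, 'l) module_scheme \<Rightarrow> ('r, 'b, 'n) module_scheme \<Rightarrow>
     'a \<Rightarrow> 'b \<Rightarrow> ('a \<times> 'b \<Rightarrow> 'r) set"
  where "pure_tensor R M N x y =
    tensor_null R M N +>\<^bsub>free_module R (carrier M \<times> carrier N)\<^esub> basis_elem R (x, y)"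

text \<open>The linear map \<open>x \<otimes> y \<mapsto> b x y\<close> on a tensor product, for a bilinear map \<open>b\<close> into \<open>P\<close>.\<close>

definition tensor_lift ::
    "('r, 'k) ring_scheme \<Rightarrow> ('r, 'p, 'l) module_scheme \<Rightarrow> ('a \<Rightarrow> 'b \<Rightarrow> 'p) \<Rightarrow> ('a \<times> 'b \<Rightarrow> 'r) set \<Rightarrow> 'p"
  where "tensor_lift R P b = lin_ext R P (\<lambda>(x, y). b x y)"

definition tensor_alg ::
    "('r, 'k) ring_scheme \<Rightarrow> ('r, 'a, 'l) module_scheme \<Rightarrow> ('r, 'b, 'n) module_scheme \<Rightarrow>
     ('r, ('a \<times> 'b \<Rightarrow> 'r) set) module"
  where "tensor_alg R A B = (tensor R A B)
    \<lparr>mult := (\<lambda>X Y. tensor_lift R (tensor R A B) (\<lambda>a b.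
        tensor_lift R (tensor R A B) (\<lambda>a' b'.
          pure_tensor R A B (a \<otimes>\<^bsub>A\<^esub> a') (b \<otimes>\<^bsub>B\<^esub> b')) Y) X),
     one := pure_tensor R A B \<one>\<^bsub>A\<^esub> \<one>\<^bsub>B\<^esub>\<rparr>"


section \<open>Tensor algebra and symmetric algebra\<close>

text \<open>The free associative algebra on the set \<open>S\<close>: the monoid algebra of the words over \<open>S\<close>.\<close>

definition free_algebra :: "('r, 'k) ring_scheme \<Rightarrow> 's set \<Rightarrow> ('r, 's list \<Rightarrow> 'r) module"
  where "free_algebra R S = (free_module R (lists S))
    \<lparr>mult := (\<lambda>f g w. \<Oplus>\<^bsub>R\<^esub>i\<in>{..length w}. f (take i w) \<otimes>\<^bsub>R\<^esub> g (drop i w)),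
     one := basis_elem R []\<rparr>"

text \<open>\<open>T(M)\<close> is the free algebra on the underlying set of \<open>M\<close> modulo the relations making
  \<open>M \<rightarrow> T(M)\<close> linear. In degree \<open>k\<close> this is the free module on \<open>M\<^sup>k\<close> modulo
  multilinearity, that is, the \<open>k\<close>-fold tensor power of \<open>M\<close>; the word \<open>[x\<^sub>1, \<dots>, x\<^sub>k]\<close>
  represents \<open>x\<^sub>1 \<otimes> \<dots> \<otimes> x\<^sub>k\<close>.\<close>

definition talg_null ::
    "('r, 'k) ring_scheme \<Rightarrow> ('r, 'm, 'l) module_scheme \<Rightarrow> ('m list \<Rightarrow> 'r) set"
  where "talg_null R M =
    (let F = free_algebra R (carrier M); e = (\<lambda>x. basis_elem R [x]) in
      genideal F
       ({e (x \<oplus>\<^bsub>M\<^esub> y) \<ominus>\<^bsub>F\<^esub> (e x \<oplus>\<^bsub>F\<^esub> e y) | x y. x \<in> carrier M \<and> y \<in> carrier M} \<union>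
        {e (r \<odot>\<^bsub>M\<^esub> x) \<ominus>\<^bsub>F\<^esub> r \<odot>\<^bsub>F\<^esub> e x | r x. r \<in> carrier R \<and> x \<in> carrier M}))"

definition talg ::
    "('r, 'k) ring_scheme \<Rightarrow> ('r, 'm, 'l) module_scheme \<Rightarrow> ('r, ('m list \<Rightarrow> 'r) set) module"
  where "talg R M = quot_alg (free_algebra R (carrier M)) (talg_null R M)"

definition talg_incl ::
    "('r, 'k) ring_scheme \<Rightarrow> ('r, 'm, 'l) module_scheme \<Rightarrow> 'm \<Rightarrow> ('m list \<Rightarrow> 'r) set"
  where "talg_incl R M x = talg_null R M +>\<^bsub>free_algebra R (carrier M)\<^esub> basis_elem R [x]"

text \<open>The comultiplication of \<open>T(M)\<close>: the multiplicative extension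
  \<open>x\<^sub>1 \<otimes> \<dots> \<otimes> x\<^sub>k \<mapsto> \<Delta>(x\<^sub>1) \<dots> \<Delta>(x\<^sub>k)\<close> of \<open>\<Delta>(x) = 1 \<otimes> x + x \<otimes> 1\<close>, the product being that of
  \<open>T(M) \<otimes> T(M)\<close>.\<close>

definition talg_comult ::
    "('r, 'k) ring_scheme \<Rightarrow> ('r, 'm, 'l) module_scheme \<Rightarrow> ('m list \<Rightarrow> 'r) set \<Rightarrow>
     (('m list \<Rightarrow> 'r) set \<times> ('m list \<Rightarrow> 'r) set \<Rightarrow> 'r) set"
  where "talg_comult R M =
    (let T = talg R M; TT = tensor_alg R T T;
         \<Delta> = (\<lambda>x. pure_tensor R T T \<one>\<^bsub>T\<^esub> (talg_incl R M x) \<oplus>\<^bsub>TT\<^esub> pure_tensor R T T (talg_incl R M x) \<one>\<^bsub>T\<^esub>)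
     in lin_ext R TT (\<lambda>w. foldr (\<lambda>x z. \<Delta> x \<otimes>\<^bsub>TT\<^esub> z) w \<one>\<^bsub>TT\<^esub>))"

definition sym_null ::
    "('r, 'k) ring_scheme \<Rightarrow> ('r, 'm, 'l) module_scheme \<Rightarrow> ('m list \<Rightarrow> 'r) set set"
  where "sym_null R M =
    (let T = talg R M; i = talg_incl R M in
      genideal T {i x \<otimes>\<^bsub>T\<^esub> i y \<ominus>\<^bsub>T\<^esub> i y \<otimes>\<^bsub>T\<^esub> i x | x y. x \<in> carrier M \<and> y \<in> carrier M})"

definition sym_alg ::
    "('r, 'k) ring_scheme \<Rightarrow> ('r, 'm, 'l) module_scheme \<Rightarrow> ('r, ('m list \<Rightarrow> 'r) set set) module"
  where "sym_alg R M = quot_alg (talg R M) (sym_null R M)"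

definition sym_incl ::
    "('r, 'k) ring_scheme \<Rightarrow> ('r, 'm, 'l) module_scheme \<Rightarrow> 'm \<Rightarrow> ('m list \<Rightarrow> 'r) set set"
  where "sym_incl R M x = sym_null R M +>\<^bsub>talg R M\<^esub> talg_incl R M x"


section \<open>Smash products\<close>

text \<open>The smash product of \<open>A\<close> with \<open>H\<close>, for a comultiplication \<open>\<Delta>\<close> on \<open>H\<close> and an action \<open>act\<close> of
  \<open>H\<close> on \<open>A\<close>; \<open>a # u\<close> is \<open>pure_tensor R A H a u\<close>. A Sweedler sum of \<open>b(u\<^sub>(\<^sub>1\<^sub>), u\<^sub>(\<^sub>2\<^sub>))\<close> is
  \<open>tensor_lift\<close> of \<open>b\<close> applied to \<open>\<Delta>(u)\<close>.\<close>

definition smash ::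
    "('r, 'k) ring_scheme \<Rightarrow> ('r, 'a, 'l) module_scheme \<Rightarrow> ('r, 'h, 'n) module_scheme \<Rightarrow>
     ('h \<Rightarrow> ('h \<times> 'h \<Rightarrow> 'r) set) \<Rightarrow> ('h \<Rightarrow> 'a \<Rightarrow> 'a) \<Rightarrow> ('r, ('a \<times> 'h \<Rightarrow> 'r) set) module"
  where "smash R A H \<Delta> act = (let AH = tensor R A H in
    AH\<lparr>mult := (\<lambda>X Y.
          tensor_lift R AH (\<lambda>a1 u.
            tensor_lift R AH (\<lambda>a2 v.
              tensor_lift R AH (\<lambda>u1 u2. pure_tensor R A H (a1 \<otimes>\<^bsub>A\<^esub> act u1 a2) (u2 \<otimes>\<^bsub>H\<^esub> v)) (\<Delta> u)) Y) X),
       one := pure_tensor R A H \<one>\<^bsub>A\<^esub> \<one>\<^bsub>H\<^esub>\<rparr>)"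

text \<open>The \<open>A\<close>-module structure \<open>a1 \<cdot> (a2 # u) = a1 a2 # u\<close>.\<close>

definition smash_act ::
    "('r, 'k) ring_scheme \<Rightarrow> ('r, 'a, 'l) module_scheme \<Rightarrow> ('r, 'h, 'n) module_scheme \<Rightarrow>
     'a \<Rightarrow> ('a \<times> 'h \<Rightarrow> 'r) set \<Rightarrow> ('a \<times> 'h \<Rightarrow> 'r) set"
  where "smash_act R A H a1 =
    tensor_lift R (tensor R A H) (\<lambda>a2 u. pure_tensor R A H (a1 \<otimes>\<^bsub>A\<^esub> a2) u)"


section \<open>The smash product of \<open>Sym(M)\<close> with \<open>T(M)\<close> attached to a Poisson bracket\<close>

text \<open>\<open>(x\<^sub>1 \<otimes> \<dots> \<otimes> x\<^sub>k) \<cdot> a = {x\<^sub>1, {x\<^sub>2, \<dots> {x\<^sub>k, a} \<dots>}}\<close>, extended linearly.\<close>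

definition poisson_act ::
    "('r, 'k) ring_scheme \<Rightarrow> ('r, 'm, 'l) module_scheme \<Rightarrow>
     (('m list \<Rightarrow> 'r) set set \<Rightarrow> ('m list \<Rightarrow> 'r) set set \<Rightarrow> ('m list \<Rightarrow> 'r) set set) \<Rightarrow>
     ('m list \<Rightarrow> 'r) set \<Rightarrow> ('m list \<Rightarrow> 'r) set set \<Rightarrow> ('m list \<Rightarrow> 'r) set set"
  where "poisson_act R M br u a =
    lin_ext R (sym_alg R M) (\<lambda>w. foldr (\<lambda>x b. br (sym_incl R M x) b) w a) u"

definition sym_smash ::
    "('r, 'k) ring_scheme \<Rightarrow> ('r, 'm, 'l) module_scheme \<Rightarrow>
     (('m list \<Rightarrow> 'r) set set \<Rightarrow> ('m list \<Rightarrow> 'r) set set \<Rightarrow> ('m list \<Rightarrow> 'r) set set) \<Rightarrow>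
     ('r, (('m list \<Rightarrow> 'r) set set \<times> ('m list \<Rightarrow> 'r) set \<Rightarrow> 'r) set) module"
  where "sym_smash R M br =
    smash R (sym_alg R M) (talg R M) (talg_comult R M) (poisson_act R M br)"

abbreviation sharp ::
    "('r, 'k) ring_scheme \<Rightarrow> ('r, 'm, 'l) module_scheme \<Rightarrow>
     ('m list \<Rightarrow> 'r) set set \<Rightarrow> ('m list \<Rightarrow> 'r) set \<Rightarrow>
     (('m list \<Rightarrow> 'r) set set \<times> ('m list \<Rightarrow> 'r) set \<Rightarrow> 'r) set"
  where "sharp R M \<equiv> pure_tensor R (sym_alg R M) (talg R M)"

definition is_psi ::
    "('r, 'k) ring_scheme \<Rightarrow> ('r, 'm, 'l) module_scheme \<Rightarrow>
     (('m list \<Rightarrow> 'r) set set \<Rightarrow> ('m list \<Rightarrow> 'r) set set \<Rightarrow> ('m list \<Rightarrow> 'r) set set) \<Rightarrow>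
     (('m list \<Rightarrow> 'r) set set \<Rightarrow> (('m list \<Rightarrow> 'r) set set \<times> ('m list \<Rightarrow> 'r) set \<Rightarrow> 'r) set) \<Rightarrow> bool"
  where "is_psi R M br \<psi> \<longleftrightarrow>
    (let A = sym_alg R M; B = sym_smash R M br; act = smash_act R A (talg R M) in
      \<psi> \<in> linear_maps R A B \<and>
      (\<forall>a\<in>carrier A. \<forall>b\<in>carrier A. \<psi> (a \<otimes>\<^bsub>A\<^esub> b) = act a (\<psi> b) \<oplus>\<^bsub>B\<^esub> act b (\<psi> a)) \<and>
      (\<forall>x\<in>carrier M. \<psi> (sym_incl R M x) = sharp R M \<one>\<^bsub>A\<^esub> (talg_incl R M x)))"

definition psi ::
    "('r, 'k) ring_scheme \<Rightarrow> ('r, 'm, 'l) module_scheme \<Rightarrow>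
     (('m list \<Rightarrow> 'r) set set \<Rightarrow> ('m list \<Rightarrow> 'r) set set \<Rightarrow> ('m list \<Rightarrow> 'r) set set) \<Rightarrow>
     ('m list \<Rightarrow> 'r) set set \<Rightarrow> (('m list \<Rightarrow> 'r) set set \<times> ('m list \<Rightarrow> 'r) set \<Rightarrow> 'r) set"
  where "psi R M br = (THE \<psi>. \<psi> \<in> extensional (carrier (sym_alg R M)) \<and> is_psi R M br \<psi>)"

definition J_ideal ::
    "('r, 'k) ring_scheme \<Rightarrow> ('r, 'm, 'l) module_scheme \<Rightarrow>
     (('m list \<Rightarrow> 'r) set set \<Rightarrow> ('m list \<Rightarrow> 'r) set set \<Rightarrow> ('m list \<Rightarrow> 'r) set set) \<Rightarrow>
     (('m list \<Rightarrow> 'r) set set \<times> ('m list \<Rightarrow> 'r) set \<Rightarrow> 'r) set set"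
  where "J_ideal R M br =
    (let A = sym_alg R M; T = talg R M; B = sym_smash R M br; i = talg_incl R M; j = sym_incl R M in
      genideal B
       {sharp R M \<one>\<^bsub>A\<^esub> (i x \<otimes>\<^bsub>T\<^esub> i y \<ominus>\<^bsub>T\<^esub> i y \<otimes>\<^bsub>T\<^esub> i x) \<ominus>\<^bsub>B\<^esub> psi R M br (br (j x) (j y)) | x y.
          x \<in> carrier M \<and> y \<in> carrier M})"

definition J_proj ::
    "('r, 'k) ring_scheme \<Rightarrow> ('r, 'm, 'l) module_scheme \<Rightarrow>
     (('m list \<Rightarrow> 'r) set set \<Rightarrow> ('m list \<Rightarrow> 'r) set set \<Rightarrow> ('m list \<Rightarrow> 'r) set set) \<Rightarrow>
     (('m list \<Rightarrow> 'r) set set \<times> ('m list \<Rightarrow> 'r) set \<Rightarrow> 'r) set \<Rightarrow>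
     (('m list \<Rightarrow> 'r) set set \<times> ('m list \<Rightarrow> 'r) set \<Rightarrow> 'r) set set"
  where "J_proj R M br s = J_ideal R M br +>\<^bsub>sym_smash R M br\<^esub> s"

end

theory Submission
  imports Defs
begin

text \<open>
  Whenever \<open>\<alpha>\<close> and \<open>\<beta>\<close> map to an algebra as in the theorem, \<open>\<beta>\<close> is a derivation along \<open>\<alpha>\<close>. The
  algebra generated by their images is then generated by all \<open>\<alpha>(a)\<close> and by \<open>\<beta>(x)\<close> with \<open>x\<close> in \<open>M\<close>, subject to
  \<open>\<beta>(x)\<alpha>(a) = \<alpha>({x, a}) + \<alpha>(a)\<beta>(x)\<close> and \<open>\<beta>(x)\<beta>(y) - \<beta>(y)\<beta>(x) = \<beta>({x, y})\<close>. The first relation is the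
  product of \<open>(1 # x)\<close> and \<open>(a # 1)\<close> in the smash product, and the second one is imposed by \<open>J\<close>, with
  \<open>\<psi>\<close> expressing \<open>\<beta>\<close> on all of \<open>Sym(M)\<close> through its values on \<open>M\<close>.

  The operators on \<open>Sym(M) \<otimes> T(M)\<close> given by \<open>b # v \<mapsto> {x, b} # v + b # xv\<close>
  depend linearly on \<open>x\<close>, hence extend to an action of \<open>T(M)\<close> (\<open>talg_rec\<close>). By recursion on \<open>u\<close> the
  Sweedler sum defining \<open>(a # u)Y\<close> is the result of letting first \<open>u\<close> and then \<open>a\<close> act on \<open>Y\<close>
  (\<open>smash_sweedler\<close>, \<open>B_mult\<close>). Right multiplications commute with these operators because \<open>{x, -}\<close> is
  a derivation (\<open>gen_act_sm\<close>), which is associativity. The derivation \<open>\<psi>\<close> comes from the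
  square-zero extension of \<open>Sym(M)\<close> by the smash product (\<open>sym_derivation\<close>).

  For a derivation \<open>\<beta>\<close> along \<open>\<alpha>\<close>, the two sides of each bracket identity obey the
  same product rule in each argument of \<open>\<beta>\<close>. So they hold if they hold when \<open>\<beta>\<close> is applied to
  elements of \<open>M\<close> (\<open>enveloping_on_generators\<close>), where they are the two relations above (\<open>quotient_triple\<close>).

  Test maps \<open>\<alpha>\<close>, \<open>\<beta>\<close> into \<open>V\<close> give the linear map \<open>a # x\<^sub>1 \<otimes> \<dots> \<otimes> x\<^sub>k \<mapsto>
  \<alpha>(a)\<beta>(x\<^sub>1) \<dots> \<beta>(x\<^sub>k)\<close>. It turns the operators above into left multiplications in \<open>V\<close>, hence is
  multiplicative (\<open>smash_lift_hom\<close>). It maps \<open>\<psi>(a)\<close> to \<open>\<beta>(a)\<close> (\<open>smash_lift_psi\<close>) and so kills \<open>J\<close>.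
  Uniqueness holds because the elements \<open>a # 1\<close> and \<open>1 # x\<close> generate the smash product.
\<close>

section \<open>Linear and bilinear maps\<close>

lemma (in abelian_group) minus_eq_zero_iff:
  assumes "x \<in> carrier G" "y \<in> carrier G"
  shows "x \<ominus> y = \<zero> \<longleftrightarrow> x = y"
  using assms by (metis a_minus_def a_inv_closed minus_equality minus_minus r_neg)

lemma linear_mapsI:
  assumes "\<And>x. x \<in> carrier M \<Longrightarrow> f x \<in> carrier N"
    and "\<And>x y. x \<in> carrier M \<Longrightarrow> y \<in> carrier M \<Longrightarrow> f (x \<oplus>\<^bsub>M\<^esub> y) = f x \<oplus>\<^bsub>N\<^esub> f y"
    and "\<And>r x. r \<in> carrier R \<Longrightarrow> x \<in> carrier M \<Longrightarrow> f (r \<odot>\<^bsub>M\<^esub> x) = r \<odot>\<^bsub>N\<^esub> f x"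
  shows "f \<in> linear_maps R M N"
  using assms unfolding linear_maps_def by auto

lemma linear_mapsD:
  assumes "f \<in> linear_maps R M N"
  shows "x \<in> carrier M \<Longrightarrow> f x \<in> carrier N"
    and "x \<in> carrier M \<Longrightarrow> y \<in> carrier M \<Longrightarrow> f (x \<oplus>\<^bsub>M\<^esub> y) = f x \<oplus>\<^bsub>N\<^esub> f y"
    and "r \<in> carrier R \<Longrightarrow> x \<in> carrier M \<Longrightarrow> f (r \<odot>\<^bsub>M\<^esub> x) = r \<odot>\<^bsub>N\<^esub> f x"
  using assms unfolding linear_maps_def by auto

lemma linear_maps_zero:
  assumes f: "f \<in> linear_maps R M N" and M: "module R M" and N: "module R N"
  shows "f \<zero>\<^bsub>M\<^esub> = \<zero>\<^bsub>N\<^esub>"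
proof -
  interpret M: module R M by fact
  interpret N: module R N by fact
  have "f (\<zero>\<^bsub>R\<^esub> \<odot>\<^bsub>M\<^esub> \<zero>\<^bsub>M\<^esub>) = \<zero>\<^bsub>R\<^esub> \<odot>\<^bsub>N\<^esub> f \<zero>\<^bsub>M\<^esub>"
    by (rule linear_mapsD(3)[OF f]) auto
  then show ?thesis using linear_mapsD(1)[OF f, of "\<zero>\<^bsub>M\<^esub>"] by simp
qed

lemma linear_maps_minus:
  assumes f: "f \<in> linear_maps R M N" and M: "module R M" and N: "module R N"
    and x: "x \<in> carrier M" "y \<in> carrier M"
  shows "f (x \<ominus>\<^bsub>M\<^esub> y) = f x \<ominus>\<^bsub>N\<^esub> f y"
proof -
  interpret M: module R M by fact
  interpret N: module R N by fact
  have "f (\<ominus>\<^bsub>M\<^esub> y) = f ((\<ominus>\<^bsub>R\<^esub> \<one>\<^bsub>R\<^esub>) \<odot>\<^bsub>M\<^esub> y)" using x by (simp add: M.smult_l_minus)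
  also have "\<dots> = (\<ominus>\<^bsub>R\<^esub> \<one>\<^bsub>R\<^esub>) \<odot>\<^bsub>N\<^esub> f y" by (rule linear_mapsD(3)[OF f]) (use x in auto)
  also have "\<dots> = \<ominus>\<^bsub>N\<^esub> f y" using x linear_mapsD(1)[OF f] by (simp add: N.smult_l_minus)
  finally show ?thesis
    using x linear_mapsD(2)[OF f, of x "\<ominus>\<^bsub>M\<^esub> y"] by (simp add: a_minus_def)
qed

lemma linear_maps_cong:
  assumes f: "f \<in> linear_maps R M N" and M: "module R M"
    and eq: "\<And>x. x \<in> carrier M \<Longrightarrow> g x = f x"
  shows "g \<in> linear_maps R M N"
proof -
  interpret M: module R M by fact
  show ?thesis by (rule linear_mapsI) (simp_all add: eq linear_mapsD[OF f])
qed

lemma linear_maps_compose: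
  assumes "f \<in> linear_maps R M N" "g \<in> linear_maps R N P"
  shows "(\<lambda>x. g (f x)) \<in> linear_maps R M P"
  using assms by (auto intro!: linear_mapsI simp: linear_mapsD)

lemma linear_maps_add:
  assumes "f \<in> linear_maps R M P" "g \<in> linear_maps R M P" and P: "module R P"
  shows "(\<lambda>x. f x \<oplus>\<^bsub>P\<^esub> g x) \<in> linear_maps R M P"
proof -
  interpret P: module R P by fact
  show ?thesis
    using assms by (auto intro!: linear_mapsI simp: linear_mapsD P.a_ac P.smult_r_distr)
qed

lemma linear_maps_smult:
  assumes "f \<in> linear_maps R M P" and P: "module R P" and r: "r \<in> carrier R"
  shows "(\<lambda>x. r \<odot>\<^bsub>P\<^esub> f x) \<in> linear_maps R M P"
proof -
  interpret P: module R P by fact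
  have "r \<odot>\<^bsub>P\<^esub> (s \<odot>\<^bsub>P\<^esub> y) = s \<odot>\<^bsub>P\<^esub> (r \<odot>\<^bsub>P\<^esub> y)" if "s \<in> carrier R" "y \<in> carrier P" for s y
    using that r by (metis P.smult_assoc1 P.R.m_comm)
  then show ?thesis
    using assms by (auto intro!: linear_mapsI simp: linear_mapsD P.smult_r_distr)
qed

definition bilinear_map ::
    "('r, 'k) ring_scheme \<Rightarrow> ('r, 'a, 'l) module_scheme \<Rightarrow> ('r, 'b, 'n) module_scheme \<Rightarrow>
     ('r, 'p, 'q) module_scheme \<Rightarrow> ('a \<Rightarrow> 'b \<Rightarrow> 'p) \<Rightarrow> bool"
  where "bilinear_map R M N P b \<longleftrightarrow>
    (\<forall>x\<in>carrier M. b x \<in> linear_maps R N P) \<and>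
    (\<forall>y\<in>carrier N. (\<lambda>x. b x y) \<in> linear_maps R M P)"

lemma bilinear_mapI:
  assumes "\<And>x. x \<in> carrier M \<Longrightarrow> b x \<in> linear_maps R N P"
    and "\<And>y. y \<in> carrier N \<Longrightarrow> (\<lambda>x. b x y) \<in> linear_maps R M P"
  shows "bilinear_map R M N P b"
  using assms unfolding bilinear_map_def by auto

lemma bilinear_mapD:
  assumes "bilinear_map R M N P b"
  shows "x \<in> carrier M \<Longrightarrow> b x \<in> linear_maps R N P"
    and "y \<in> carrier N \<Longrightarrow> (\<lambda>x. b x y) \<in> linear_maps R M P"
    and "x \<in> carrier M \<Longrightarrow> y \<in> carrier N \<Longrightarrow> b x y \<in> carrier P"
  using assms unfolding bilinear_map_def by (auto dest: linear_mapsD(1))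

lemma (in assoc_algebra) bilinear_mult: "bilinear_map R M M M (\<lambda>x y. x \<otimes>\<^bsub>M\<^esub> y)"
  by (auto intro!: bilinear_mapI linear_mapsI simp: r_distr l_distr smult_mult_left smult_mult_right)

lemma algebra_homD:
  assumes "f \<in> algebra_hom R A B"
  shows "f \<in> linear_maps R A B"
    and "x \<in> carrier A \<Longrightarrow> y \<in> carrier A \<Longrightarrow> f (x \<otimes>\<^bsub>A\<^esub> y) = f x \<otimes>\<^bsub>B\<^esub> f y"
    and "f \<one>\<^bsub>A\<^esub> = \<one>\<^bsub>B\<^esub>"
  using assms unfolding algebra_hom_def ring_hom_def by auto

lemma algebra_homI:
  assumes "f \<in> linear_maps R A B"
    and "\<And>x y. x \<in> carrier A \<Longrightarrow> y \<in> carrier A \<Longrightarrow> f (x \<otimes>\<^bsub>A\<^esub> y) = f x \<otimes>\<^bsub>B\<^esub> f y"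
    and "f \<one>\<^bsub>A\<^esub> = \<one>\<^bsub>B\<^esub>"
  shows "f \<in> algebra_hom R A B"
  using assms unfolding algebra_hom_def by (auto intro!: ring_hom_memI simp: linear_mapsD)

section \<open>Quotients\<close>

lemma quot_alg_simps:
  "carrier (quot_alg A I) = (\<lambda>x. I +>\<^bsub>A\<^esub> x) ` carrier A"
  "\<zero>\<^bsub>quot_alg A I\<^esub> = I"
  "\<one>\<^bsub>quot_alg A I\<^esub> = I +>\<^bsub>A\<^esub> \<one>\<^bsub>A\<^esub>"
  unfolding quot_alg_def ring.extend_def module.fields_def FactRing_def A_RCOSETS_def'
  by (auto)

text \<open>The construction \<open>quot_alg\<close> serves for modules and for algebras. Its linear part is treated for
  a submodule; for a two-sided ideal the product is added afterwards.\<close>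

locale submodule_quotient = A: module R A for R (structure) and A (structure) +
  fixes I
  assumes submodule: "submodule I R A"
begin

sublocale sub: abelian_subgroup I A
  using submodule A.abelian_group_axioms
  by (intro abelian_subgroupI3 additive_subgroupI) (auto simp: submodule_def)

lemma sub_smult: "r \<in> carrier R \<Longrightarrow> x \<in> I \<Longrightarrow> r \<odot>\<^bsub>A\<^esub> x \<in> I"
  using submodule by (simp add: submodule.smult_closed)

lemma proj_cong:
  assumes "x \<in> carrier A" "y \<in> carrier A" "x \<ominus>\<^bsub>A\<^esub> y \<in> I"
  shows "I +>\<^bsub>A\<^esub> x = I +>\<^bsub>A\<^esub> y"
proof -
  have "x = (x \<ominus>\<^bsub>A\<^esub> y) \<oplus>\<^bsub>A\<^esub> y"
    using assms by (simp add: A.M.minus_eq A.a_assoc A.l_neg)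
  then have "x \<in> I +>\<^bsub>A\<^esub> y" using assms(3) unfolding a_r_coset_def' by blast
  then show ?thesis using A.a_repr_independence[of x I y] assms(2) sub.a_subgroup by simp
qed

lemma proj_mem:
  assumes "x \<in> carrier A" "z \<in> I +>\<^bsub>A\<^esub> x"
  shows "z \<in> carrier A" "z \<ominus>\<^bsub>A\<^esub> x \<in> I"
proof -
  obtain h where h: "h \<in> I" "z = h \<oplus>\<^bsub>A\<^esub> x" using assms(2) unfolding a_r_coset_def' by blast
  then have "h \<in> carrier A" using sub.a_subset by auto
  with h assms(1) show "z \<in> carrier A" "z \<ominus>\<^bsub>A\<^esub> x \<in> I"
    by (simp_all add: A.M.minus_eq A.a_assoc A.r_neg)
qed

lemma quot_add:
  assumes "x \<in> carrier A" "y \<in> carrier A"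
  shows "(I +>\<^bsub>A\<^esub> x) \<oplus>\<^bsub>quot_alg A I\<^esub> (I +>\<^bsub>A\<^esub> y) = I +>\<^bsub>A\<^esub> (x \<oplus>\<^bsub>A\<^esub> y)"
  using sub.a_rcos_sum[OF assms]
  by (simp add: quot_alg_def ring.extend_def module.fields_def FactRing_def)

lemma quot_smult:
  assumes r: "r \<in> carrier R" and x: "x \<in> carrier A"
  shows "r \<odot>\<^bsub>quot_alg A I\<^esub> (I +>\<^bsub>A\<^esub> x) = I +>\<^bsub>A\<^esub> (r \<odot>\<^bsub>A\<^esub> x)"
proof -
  have eq: "I +>\<^bsub>A\<^esub> (r \<odot>\<^bsub>A\<^esub> z) = I +>\<^bsub>A\<^esub> (r \<odot>\<^bsub>A\<^esub> x)" if "z \<in> I +>\<^bsub>A\<^esub> x" for z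
  proof (rule proj_cong)
    have z: "z \<in> carrier A" "z \<ominus>\<^bsub>A\<^esub> x \<in> I" using proj_mem[OF x that] by auto
    have "r \<odot>\<^bsub>A\<^esub> z \<ominus>\<^bsub>A\<^esub> r \<odot>\<^bsub>A\<^esub> x = r \<odot>\<^bsub>A\<^esub> (z \<ominus>\<^bsub>A\<^esub> x)"
      using z r x by (simp add: A.M.minus_eq A.smult_r_distr A.smult_r_minus)
    then show "r \<odot>\<^bsub>A\<^esub> z \<ominus>\<^bsub>A\<^esub> r \<odot>\<^bsub>A\<^esub> x \<in> I" using sub_smult[OF r z(2)] by simp
    show "r \<odot>\<^bsub>A\<^esub> z \<in> carrier A" "r \<odot>\<^bsub>A\<^esub> x \<in> carrier A" using z r x by auto
  qed
  have "x \<in> I +>\<^bsub>A\<^esub> x" using sub.a_rcos_self[OF x] .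
  then have "(\<Union>z\<in>I +>\<^bsub>A\<^esub> x. I +>\<^bsub>A\<^esub> (r \<odot>\<^bsub>A\<^esub> z)) = I +>\<^bsub>A\<^esub> (r \<odot>\<^bsub>A\<^esub> x)"
    using eq by blast
  then show ?thesis by (simp add: quot_alg_def ring.extend_def module.fields_def)
qed

lemma proj_null: "x \<in> I \<Longrightarrow> I +>\<^bsub>A\<^esub> x = \<zero>\<^bsub>quot_alg A I\<^esub>"
  by (simp add: quot_alg_simps sub.a_rcos_const)

lemma proj_closed: "x \<in> carrier A \<Longrightarrow> I +>\<^bsub>A\<^esub> x \<in> carrier (quot_alg A I)"
  by (simp add: quot_alg_simps)

lemma proj_linear: "(\<lambda>x. I +>\<^bsub>A\<^esub> x) \<in> linear_maps R A (quot_alg A I)"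
  by (rule linear_mapsI) (simp_all add: proj_closed quot_add quot_smult)

lemma quot_module: "module R (quot_alg A I)"
proof (rule moduleI)
  show "cring R" by (rule A.R.is_cring)
  have zero: "\<zero>\<^bsub>quot_alg A I\<^esub> = I +>\<^bsub>A\<^esub> \<zero>\<^bsub>A\<^esub>"
    using proj_null[of "\<zero>\<^bsub>A\<^esub>"] by simp
  have inv: "\<exists>y\<in>carrier A. y \<oplus>\<^bsub>A\<^esub> x = \<zero>\<^bsub>A\<^esub>" if "x \<in> carrier A" for x
    using that A.M.l_neg A.M.a_inv_closed by blast
  show "abelian_group (quot_alg A I)"
  proof (rule abelian_groupI)
    show "\<exists>Y\<in>carrier (quot_alg A I). Y \<oplus>\<^bsub>quot_alg A I\<^esub> X = \<zero>\<^bsub>quot_alg A I\<^esub>"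
      if X: "X \<in> carrier (quot_alg A I)" for X
    proof -
      obtain x where x: "x \<in> carrier A" "X = I +>\<^bsub>A\<^esub> x" using X by (auto simp: quot_alg_simps(1))
      then obtain y where "y \<in> carrier A" "y \<oplus>\<^bsub>A\<^esub> x = \<zero>\<^bsub>A\<^esub>" using inv by blast
      then show ?thesis
        using x by (intro bexI[of _ "I +>\<^bsub>A\<^esub> y"]) (simp_all add: zero quot_add proj_closed)
    qed
  qed (auto simp: quot_alg_simps(1) zero quot_add A.M.a_ac)
qed (auto simp: quot_alg_simps(1) quot_add quot_smult A.smult_l_distr A.smult_r_distr A.smult_assoc1)

lemma quot_factor:
  assumes f: "f \<in> linear_maps R A P" and P: "module R P" and null: "\<And>x. x \<in> I \<Longrightarrow> f x = \<zero>\<^bsub>P\<^esub>"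
    and x: "x \<in> carrier A" and z: "z \<in> I +>\<^bsub>A\<^esub> x"
  shows "f z = f x"
proof -
  interpret P: module R P by fact
  have z': "z \<in> carrier A" "z \<ominus>\<^bsub>A\<^esub> x \<in> I" using proj_mem[OF x z] by auto
  have "f z \<ominus>\<^bsub>P\<^esub> f x = \<zero>\<^bsub>P\<^esub>"
    using null[OF z'(2)] linear_maps_minus[OF f A.module_axioms P z'(1) x] by simp
  then show ?thesis using linear_mapsD(1)[OF f z'(1)] linear_mapsD(1)[OF f x] P.M.minus_eq_zero_iff by blast
qed

text \<open>A linear map that kills \<open>I\<close> is constant on cosets, so choosing a representative of the coset
  gives the induced map.\<close>

lemma quot_lift:
  assumes f: "f \<in> linear_maps R A P" and P: "module R P" and null: "\<And>x. x \<in> I \<Longrightarrow> f x = \<zero>\<^bsub>P\<^esub>"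
  shows "(\<lambda>X. f (SOME x. x \<in> X)) \<in> linear_maps R (quot_alg A I) P"
    and "x \<in> carrier A \<Longrightarrow> f (SOME z. z \<in> I +>\<^bsub>A\<^esub> x) = f x"
proof -
  have *: "f (SOME z. z \<in> I +>\<^bsub>A\<^esub> x) = f x" if x: "x \<in> carrier A" for x
    using quot_factor[OF f P null x] sub.a_rcos_self[OF x] by (metis someI)
  then show "x \<in> carrier A \<Longrightarrow> f (SOME z. z \<in> I +>\<^bsub>A\<^esub> x) = f x" .
  show "(\<lambda>X. f (SOME x. x \<in> X)) \<in> linear_maps R (quot_alg A I) P"
    using * linear_mapsD[OF f]
    by (auto intro!: linear_mapsI simp: quot_alg_simps(1) quot_add quot_smult)
qed

end

locale ideal_quotient = A: assoc_algebra R A for R (structure) and A (structure) +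
  fixes I
  assumes ideal: "ideal I A"
begin

sublocale idl: ideal I A by (rule ideal)

sublocale submodule_quotient R A I
proof (intro submodule_quotient.intro submodule_quotient_axioms.intro A.module_axioms)
  have "r \<odot>\<^bsub>A\<^esub> x \<in> I" if "r \<in> carrier R" "x \<in> I" for r x
  proof -
    have x: "x \<in> carrier A" using that idl.a_subset by auto
    \<comment> \<open>A two-sided ideal of a unitary algebra is closed under scalars because they act through \<open>r1\<close>.\<close>
    have "r \<odot>\<^bsub>A\<^esub> x = (r \<odot>\<^bsub>A\<^esub> \<one>\<^bsub>A\<^esub>) \<otimes>\<^bsub>A\<^esub> x"
      using that x by (simp add: A.smult_mult_left)
    then show ?thesis using idl.I_l_closed[OF that(2)] that(1) by simp
  qed
  then show "submodule I R A"
    using idl.a_subgroup by (simp add: submodule_def submodule_axioms_def)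
qed

lemma quot_mult:
  assumes "x \<in> carrier A" "y \<in> carrier A"
  shows "(I +>\<^bsub>A\<^esub> x) \<otimes>\<^bsub>quot_alg A I\<^esub> (I +>\<^bsub>A\<^esub> y) = I +>\<^bsub>A\<^esub> (x \<otimes>\<^bsub>A\<^esub> y)"
  using idl.rcoset_mult_add[OF assms]
  by (simp add: quot_alg_def ring.extend_def module.fields_def FactRing_def)

lemma quot_assoc_algebra: "assoc_algebra R (quot_alg A I)"
proof -
  interpret Q: module R "quot_alg A I" by (rule quot_module)
  have "ring (quot_alg A I)"
  proof (rule ringI)
    show "monoid (quot_alg A I)"
      by (rule monoidI) (auto simp: quot_alg_simps quot_mult A.m_assoc)
  qed (auto simp: quot_alg_simps quot_mult quot_add A.l_distr A.r_distr intro: Q.abelian_group_axioms)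
  then show ?thesis
    unfolding assoc_algebra_def assoc_algebra_axioms_def
    using quot_module
    by (auto simp: quot_alg_simps quot_mult quot_smult A.smult_mult_left A.smult_mult_right)
qed

lemma proj_algebra_hom: "(\<lambda>x. I +>\<^bsub>A\<^esub> x) \<in> algebra_hom R A (quot_alg A I)"
  by (rule algebra_homI[OF proj_linear]) (simp_all add: quot_mult quot_alg_simps)

end

lemma genideal_superset: "X \<subseteq> genideal A X"
  unfolding genideal_def by auto

lemma genideal_minimal: "ideal I A \<Longrightarrow> X \<subseteq> I \<Longrightarrow> genideal A X \<subseteq> I"
  unfolding genideal_def by auto

lemma gen_submodule_minimal: "submodule H R M \<Longrightarrow> X \<subseteq> H \<Longrightarrow> gen_submodule R M X \<subseteq> H"
  unfolding gen_submodule_def by auto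

lemma gen_submodule_superset: "X \<subseteq> gen_submodule R M X"
  unfolding gen_submodule_def by auto

lemma (in module) gen_submodule_is_submodule:
  assumes "X \<subseteq> carrier M"
  shows "submodule (gen_submodule R M X) R M"
proof (rule submoduleI)
  note c = carrier_is_submodule
  show "gen_submodule R M X \<subseteq> carrier M"
    using gen_submodule_minimal[OF c assms] .
  show "\<zero>\<^bsub>M\<^esub> \<in> gen_submodule R M X"
    unfolding gen_submodule_def using submodule.axioms(1) subgroup.one_closed by fastforce
qed (auto simp: gen_submodule_def dest: submoduleE)

lemma linear_kernel_submodule:
  assumes f: "f \<in> linear_maps R M P" and M: "module R M" and P: "module R P"
  shows "submodule {x \<in> carrier M. f x = \<zero>\<^bsub>P\<^esub>} R M"
proof -
  interpret M: module R M by fact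
  interpret P: module R P by fact
  have neg: "f (\<ominus>\<^bsub>M\<^esub> x) = \<ominus>\<^bsub>P\<^esub> f x" if "x \<in> carrier M" for x
    using linear_maps_minus[OF f M P M.M.zero_closed that] linear_maps_zero[OF f M P]
      linear_mapsD(1)[OF f that] that by (simp add: a_minus_def)
  show ?thesis
    by (rule M.submoduleI) (auto simp: linear_mapsD[OF f] neg linear_maps_zero[OF f M P])
qed

section \<open>Free modules\<close>

text \<open>The module \<open>free_module R S\<close> and the algebra \<open>free_algebra R S\<close> differ only in their
  multiplicative fields. This locale describes the linear structure that they share.\<close>

locale free_on = R: cring R for R :: "('r, 'k) ring_scheme" (structure) +
  fixes S :: "'s set" and F :: "('r, 's \<Rightarrow> 'r) module"
  assumes carrier_F: "carrier F = carrier (free_module R S)"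
    and zero_F: "\<zero>\<^bsub>F\<^esub> = (\<lambda>s. \<zero>)"
    and add_F: "f \<oplus>\<^bsub>F\<^esub> g = (\<lambda>s. f s \<oplus> g s)"
    and smult_F: "r \<odot>\<^bsub>F\<^esub> f = (\<lambda>s. r \<otimes> f s)"

lemma free_on_free_module: "cring R \<Longrightarrow> free_on R S (free_module R S)"
  by (simp add: free_on_def free_on_axioms_def free_module_def)

text \<open>The value of \<open>lin_ext\<close> at a coset is the value of this map at some representative, so questions
  about \<open>lin_ext\<close> become questions about a linear map on a free module.\<close>

definition free_lift ::
    "('r, 'k) ring_scheme \<Rightarrow> ('r, 'p, 'l) module_scheme \<Rightarrow> ('s \<Rightarrow> 'p) \<Rightarrow> ('s \<Rightarrow> 'r) \<Rightarrow> 'p"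
  where "free_lift R P \<phi> f = (\<Oplus>\<^bsub>P\<^esub>s\<in>{s. f s \<noteq> \<zero>\<^bsub>R\<^esub>}. f s \<odot>\<^bsub>P\<^esub> \<phi> s)"

lemma lin_ext_free_lift: "lin_ext R P \<phi> X = free_lift R P \<phi> (SOME f. f \<in> X)"
  by (simp add: lin_ext_def free_lift_def Let_def)

context free_on
begin

lemma mem_F: "f \<in> carrier F \<longleftrightarrow>
    (\<forall>s. f s \<in> carrier R) \<and> (\<forall>s. s \<notin> S \<longrightarrow> f s = \<zero>) \<and> finite {s. f s \<noteq> \<zero>}"
  unfolding carrier_F using R.zero_closed by (auto simp: free_module_def)

lemma supp_subset: "f \<in> carrier F \<Longrightarrow> {s. f s \<noteq> \<zero>} \<subseteq> S"
  using mem_F by auto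

lemma F_module: "module R F"
proof (rule moduleI)
  show "cring R" by (rule R.is_cring)
  have add: "(\<lambda>s. f s \<oplus> g s) \<in> carrier F" if "f \<in> carrier F" "g \<in> carrier F" for f g
  proof -
    have "finite ({s. f s \<noteq> \<zero>} \<union> {s. g s \<noteq> \<zero>})" using that mem_F by auto
    moreover have "{s. f s \<oplus> g s \<noteq> \<zero>} \<subseteq> {s. f s \<noteq> \<zero>} \<union> {s. g s \<noteq> \<zero>}" by auto
    ultimately have "finite {s. f s \<oplus> g s \<noteq> \<zero>}" by (rule rev_finite_subset)
    then show ?thesis using that mem_F by auto
  qed
  have smult: "(\<lambda>s. r \<otimes> f s) \<in> carrier F" if "r \<in> carrier R" "f \<in> carrier F" for r f
  proof -
    have "{s. r \<otimes> f s \<noteq> \<zero>} \<subseteq> {s. f s \<noteq> \<zero>}" using that by auto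
    then have "finite {s. r \<otimes> f s \<noteq> \<zero>}" using that mem_F finite_subset by blast
    then show ?thesis using that mem_F by auto
  qed
  show "abelian_group F"
  proof (rule abelian_groupI)
    show "\<exists>g\<in>carrier F. g \<oplus>\<^bsub>F\<^esub> f = \<zero>\<^bsub>F\<^esub>" if f: "f \<in> carrier F" for f
    proof (rule bexI)
      show "(\<lambda>s. (\<ominus> \<one>) \<otimes> f s) \<in> carrier F" using smult[OF _ f] by simp
      show "(\<lambda>s. (\<ominus> \<one>) \<otimes> f s) \<oplus>\<^bsub>F\<^esub> f = \<zero>\<^bsub>F\<^esub>"
        using f by (auto simp: mem_F add_F zero_F R.l_minus R.l_neg)
    qed
  qed (auto simp: add_F zero_F add R.a_ac mem_F[THEN iffD1] mem_F[of "\<lambda>s. \<zero>"])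
  show "r \<odot>\<^bsub>F\<^esub> x \<in> carrier F" if "r \<in> carrier R" "x \<in> carrier F" for r x
    using smult that by (simp add: smult_F)
qed (auto simp: smult_F add_F mem_F R.l_distr R.r_distr R.m_assoc)

sublocale F: module R F by (rule F_module)

lemma basis_closed: "s \<in> S \<Longrightarrow> basis_elem R s \<in> carrier F"
  by (auto simp: mem_F basis_elem_def)

lemma free_lift_superset:
  assumes P: "module R P" and \<phi>: "\<phi> \<in> S \<rightarrow> carrier P" and f: "f \<in> carrier F"
    and T: "finite T" "{s. f s \<noteq> \<zero>} \<subseteq> T" "T \<subseteq> S"
  shows "free_lift R P \<phi> f = (\<Oplus>\<^bsub>P\<^esub>s\<in>T. f s \<odot>\<^bsub>P\<^esub> \<phi> s)"
proof -
  interpret P: module R P by fact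
  have c: "\<phi> s \<in> carrier P" "f s \<in> carrier R" if "s \<in> S" for s using that \<phi> f mem_F by auto
  show ?thesis unfolding free_lift_def
    by (rule P.M.add.finprod_mono_neutral_cong_left) (use T c in \<open>auto simp: subset_iff\<close>)
qed

lemma free_lift_linear:
  assumes P: "module R P" and \<phi>: "\<phi> \<in> S \<rightarrow> carrier P"
  shows "free_lift R P \<phi> \<in> linear_maps R F P"
proof (rule linear_mapsI)
  interpret P: module R P by fact
  have c: "\<phi> s \<in> carrier P" if "s \<in> S" for s using that \<phi> by auto
  show "free_lift R P \<phi> f \<in> carrier P" if f: "f \<in> carrier F" for f
    unfolding free_lift_def using c f mem_F supp_subset[OF f] by (intro P.M.finsum_closed) blast
  show "free_lift R P \<phi> (f \<oplus>\<^bsub>F\<^esub> g) = free_lift R P \<phi> f \<oplus>\<^bsub>P\<^esub> free_lift R P \<phi> g"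
    if f: "f \<in> carrier F" and g: "g \<in> carrier F" for f g
  proof -
    let ?T = "{s. f s \<noteq> \<zero>} \<union> {s. g s \<noteq> \<zero>}"
    have fg: "f \<oplus>\<^bsub>F\<^esub> g \<in> carrier F" using f g by simp
    have T: "finite ?T" "?T \<subseteq> S" using f g mem_F by auto
    have fc: "f s \<in> carrier R" "g s \<in> carrier R" for s using f g mem_F by auto
    have "free_lift R P \<phi> (f \<oplus>\<^bsub>F\<^esub> g) = (\<Oplus>\<^bsub>P\<^esub>s\<in>?T. (f \<oplus>\<^bsub>F\<^esub> g) s \<odot>\<^bsub>P\<^esub> \<phi> s)"
      by (rule free_lift_superset[OF P \<phi> fg T(1) _ T(2)]) (auto simp: add_F)
    also have "\<dots> = (\<Oplus>\<^bsub>P\<^esub>s\<in>?T. f s \<odot>\<^bsub>P\<^esub> \<phi> s \<oplus>\<^bsub>P\<^esub> g s \<odot>\<^bsub>P\<^esub> \<phi> s)"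
      using T c fc by (intro P.M.finsum_cong') (auto simp: add_F P.smult_l_distr subset_iff)
    also have "\<dots> = (\<Oplus>\<^bsub>P\<^esub>s\<in>?T. f s \<odot>\<^bsub>P\<^esub> \<phi> s) \<oplus>\<^bsub>P\<^esub> (\<Oplus>\<^bsub>P\<^esub>s\<in>?T. g s \<odot>\<^bsub>P\<^esub> \<phi> s)"
      using T c fc by (intro P.M.finsum_addf) auto
    also have "(\<Oplus>\<^bsub>P\<^esub>s\<in>?T. f s \<odot>\<^bsub>P\<^esub> \<phi> s) = free_lift R P \<phi> f"
      by (rule free_lift_superset[OF P \<phi> f T(1) _ T(2), symmetric]) auto
    also have "(\<Oplus>\<^bsub>P\<^esub>s\<in>?T. g s \<odot>\<^bsub>P\<^esub> \<phi> s) = free_lift R P \<phi> g"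
      by (rule free_lift_superset[OF P \<phi> g T(1) _ T(2), symmetric]) auto
    finally show ?thesis .
  qed
  show "free_lift R P \<phi> (r \<odot>\<^bsub>F\<^esub> f) = r \<odot>\<^bsub>P\<^esub> free_lift R P \<phi> f"
    if r: "r \<in> carrier R" and f: "f \<in> carrier F" for r f
  proof -
    let ?T = "{s. f s \<noteq> \<zero>}"
    have rf: "r \<odot>\<^bsub>F\<^esub> f \<in> carrier F" using f r by simp
    have T: "finite ?T" "?T \<subseteq> S" using f mem_F by auto
    have fc: "f s \<in> carrier R" for s using f mem_F by auto
    have "free_lift R P \<phi> (r \<odot>\<^bsub>F\<^esub> f) = (\<Oplus>\<^bsub>P\<^esub>s\<in>?T. (r \<odot>\<^bsub>F\<^esub> f) s \<odot>\<^bsub>P\<^esub> \<phi> s)"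
      by (rule free_lift_superset[OF P \<phi> rf T(1) _ T(2)]) (auto simp: smult_F r)
    also have "\<dots> = (\<Oplus>\<^bsub>P\<^esub>s\<in>?T. r \<odot>\<^bsub>P\<^esub> (f s \<odot>\<^bsub>P\<^esub> \<phi> s))"
      using T c fc r by (intro P.M.finsum_cong') (auto simp: smult_F P.smult_assoc1 subset_iff)
    also have "\<dots> = r \<odot>\<^bsub>P\<^esub> free_lift R P \<phi> f"
      unfolding free_lift_def using T c fc r by (intro P.finsum_smult_ldistr[symmetric]) auto
    finally show ?thesis .
  qed
qed

lemma free_lift_basis:
  assumes P: "module R P" and \<phi>: "\<phi> \<in> S \<rightarrow> carrier P" and s: "s \<in> S"
  shows "free_lift R P \<phi> (basis_elem R s) = \<phi> s"
proof -
  interpret P: module R P by fact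
  have "free_lift R P \<phi> (basis_elem R s) = (\<Oplus>\<^bsub>P\<^esub>t\<in>{s}. basis_elem R s t \<odot>\<^bsub>P\<^esub> \<phi> t)"
    by (rule free_lift_superset[OF P \<phi> basis_closed[OF s]]) (use s in \<open>auto simp: basis_elem_def\<close>)
  also have "\<dots> = \<phi> s" using \<phi> s by (simp add: basis_elem_def Pi_def)
  finally show ?thesis .
qed

lemma free_induct [consumes 1, case_names zero basis add]:
  assumes f: "f \<in> carrier F"
    and zero: "Q \<zero>\<^bsub>F\<^esub>"
    and basis: "\<And>r s. r \<in> carrier R \<Longrightarrow> s \<in> S \<Longrightarrow> Q (r \<odot>\<^bsub>F\<^esub> basis_elem R s)"
    and add: "\<And>f g. f \<in> carrier F \<Longrightarrow> g \<in> carrier F \<Longrightarrow> Q f \<Longrightarrow> Q g \<Longrightarrow> Q (f \<oplus>\<^bsub>F\<^esub> g)"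
  shows "Q f"
proof -
  have "\<forall>f\<in>carrier F. {s. f s \<noteq> \<zero>} \<subseteq> T \<longrightarrow> Q f" if "finite T" for T
    using that
  proof (induction T rule: finite_induct)
    case empty
    have "f = \<zero>\<^bsub>F\<^esub>" if "{s. f s \<noteq> \<zero>} \<subseteq> {}" for f using that by (auto simp: zero_F)
    then show ?case using zero by blast
  next
    case (insert t T)
    show ?case
    proof (intro ballI impI)
      fix f assume f: "f \<in> carrier F" and supp: "{s. f s \<noteq> \<zero>} \<subseteq> insert t T"
      have fin: "finite {s. f s \<noteq> \<zero>}" using f mem_F by auto
      have "finite {s. (f(t := \<zero>)) s \<noteq> \<zero>}" by (rule finite_subset[OF _ fin]) auto
      then have f': "f(t := \<zero>) \<in> carrier F" using f mem_F by auto
      show "Q f"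
      proof (cases "t \<in> S")
        case True
        have "f = f(t := \<zero>) \<oplus>\<^bsub>F\<^esub> f t \<odot>\<^bsub>F\<^esub> basis_elem R t"
          using f mem_F by (auto simp: add_F smult_F basis_elem_def fun_eq_iff)
        moreover have "{s. (f(t := \<zero>)) s \<noteq> \<zero>} \<subseteq> T" using supp by auto
        then have "Q (f(t := \<zero>))" using insert.IH f' by blast
        moreover have "Q (f t \<odot>\<^bsub>F\<^esub> basis_elem R t)" using basis True f mem_F by auto
        moreover have "f t \<odot>\<^bsub>F\<^esub> basis_elem R t \<in> carrier F"
          using f mem_F by (intro F.smult_closed basis_closed True) blast
        ultimately show ?thesis using add[OF f'] by metis
      next
        case False
        then have "f t = \<zero>" using f mem_F by auto
        then have "{s. f s \<noteq> \<zero>} \<subseteq> T" using supp by auto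
        then show ?thesis using insert.IH f by blast
      qed
    qed
  qed
  then show ?thesis using f mem_F by blast
qed

lemma linear_eq_on_basis:
  assumes f: "f \<in> linear_maps R F P" and g: "g \<in> linear_maps R F P" and P: "module R P"
    and eq: "\<And>s. s \<in> S \<Longrightarrow> f (basis_elem R s) = g (basis_elem R s)" and x: "x \<in> carrier F"
  shows "f x = g x"
  using x
proof (induction x rule: free_induct)
  case zero
  show ?case by (simp add: linear_maps_zero[OF f F_module P] linear_maps_zero[OF g F_module P])
qed (simp_all add: linear_mapsD[OF f] linear_mapsD[OF g] basis_closed eq)

text \<open>Factoring through a quotient only needs the linear extension to kill the relations, since the
  value of \<^const>\<open>lin_ext\<close> then does not depend on the chosen representative.\<close>

lemma lin_ext_quot:
  assumes P: "module R P" and \<phi>: "\<phi> \<in> S \<rightarrow> carrier P" and N: "submodule N R F"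
    and null: "\<And>f. f \<in> N \<Longrightarrow> free_lift R P \<phi> f = \<zero>\<^bsub>P\<^esub>"
  shows "lin_ext R P \<phi> \<in> linear_maps R (quot_alg F N) P"
    and "f \<in> carrier F \<Longrightarrow> lin_ext R P \<phi> (N +>\<^bsub>F\<^esub> f) = free_lift R P \<phi> f"
proof -
  interpret submodule_quotient R F N by (intro submodule_quotient.intro submodule_quotient_axioms.intro F_module N)
  have eq: "lin_ext R P \<phi> = (\<lambda>X. free_lift R P \<phi> (SOME f. f \<in> X))"
    by (simp add: fun_eq_iff lin_ext_free_lift)
  note * = quot_lift[OF free_lift_linear[OF P \<phi>] P null]
  show "lin_ext R P \<phi> \<in> linear_maps R (quot_alg F N) P" unfolding eq by (rule *(1))
  show "f \<in> carrier F \<Longrightarrow> lin_ext R P \<phi> (N +>\<^bsub>F\<^esub> f) = free_lift R P \<phi> f" unfolding eq by (rule *(2))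
qed

end

section \<open>Tensor products\<close>

text \<open>The universal property of the tensor product: two linear maps agree if they agree on pure
  tensors, and a bilinear map \<open>b\<close> factors through \<open>tensor_lift R P b\<close>, because its linear extension
  kills \<open>tensor_rels\<close>.\<close>

locale tensor_product = M: module R M + N: module R N
  for R :: "('r, 'k) ring_scheme" (structure) and M :: "('r, 'a, 'l) module_scheme"
    and N :: "('r, 'b, 'n) module_scheme"
begin

sublocale F: free_on R "carrier M \<times> carrier N" "free_module R (carrier M \<times> carrier N)"
  by (rule free_on_free_module) (rule M.R.is_cring)

lemma tensor_rels_closed: "tensor_rels R M N \<subseteq> carrier (free_module R (carrier M \<times> carrier N))"
proof -
  note [simp] = F.basis_closed F.F.M.minus_closed
  show ?thesis unfolding tensor_rels_def Let_def by auto
qed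

sublocale quo: submodule_quotient R "free_module R (carrier M \<times> carrier N)" "tensor_null R M N"
  unfolding tensor_null_def
  by (intro submodule_quotient.intro submodule_quotient_axioms.intro F.F_module
      F.F.gen_submodule_is_submodule tensor_rels_closed)

lemma tensor_module: "module R (tensor R M N)"
  unfolding tensor_def by (rule quo.quot_module)

sublocale T: module R "tensor R M N" by (rule tensor_module)

lemma pure_tensor_bilinear: "bilinear_map R M N (tensor R M N) (pure_tensor R M N)"
proof -
  let ?F = "free_module R (carrier M \<times> carrier N)"
  note [simp] = F.basis_closed
  note defs = pure_tensor_def tensor_def
  have rel: "tensor_null R M N +>\<^bsub>?F\<^esub> f = tensor_null R M N +>\<^bsub>?F\<^esub> g"
    if "f \<in> carrier ?F" "g \<in> carrier ?F" "f \<ominus>\<^bsub>?F\<^esub> g \<in> tensor_rels R M N" for f g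
    using that gen_submodule_superset[of "tensor_rels R M N" R ?F]
    by (intro quo.proj_cong) (auto simp: tensor_null_def)
  have 1: "pure_tensor R M N (x \<oplus>\<^bsub>M\<^esub> x') y = pure_tensor R M N x y \<oplus>\<^bsub>tensor R M N\<^esub> pure_tensor R M N x' y"
    if "x \<in> carrier M" "x' \<in> carrier M" "y \<in> carrier N" for x x' y
    unfolding defs
    by (insert that, subst quo.quot_add; (rule rel)?; (auto simp: tensor_rels_def Let_def)[])
  have 2: "pure_tensor R M N x (y \<oplus>\<^bsub>N\<^esub> y') = pure_tensor R M N x y \<oplus>\<^bsub>tensor R M N\<^esub> pure_tensor R M N x y'"
    if "x \<in> carrier M" "y \<in> carrier N" "y' \<in> carrier N" for x y y'
    unfolding defs
    by (insert that, subst quo.quot_add; (rule rel)?; (auto simp: tensor_rels_def Let_def)[])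
  have 3: "pure_tensor R M N (r \<odot>\<^bsub>M\<^esub> x) y = r \<odot>\<^bsub>tensor R M N\<^esub> pure_tensor R M N x y"
    if "r \<in> carrier R" "x \<in> carrier M" "y \<in> carrier N" for r x y
    unfolding defs
    by (insert that, subst quo.quot_smult; (rule rel)?; (auto simp: tensor_rels_def Let_def)[])
  have 4: "pure_tensor R M N x (r \<odot>\<^bsub>N\<^esub> y) = r \<odot>\<^bsub>tensor R M N\<^esub> pure_tensor R M N x y"
    if "r \<in> carrier R" "x \<in> carrier M" "y \<in> carrier N" for r x y
    unfolding defs
    by (insert that, subst quo.quot_smult; (rule rel)?; (auto simp: tensor_rels_def Let_def)[])
  have 5: "pure_tensor R M N x y \<in> carrier (tensor R M N)"
    if "x \<in> carrier M" "y \<in> carrier N" for x y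
    unfolding defs using that by (simp add: quo.proj_closed)
  show ?thesis by (intro bilinear_mapI linear_mapsI 1 2 3 4 5)
qed

lemmas pure_closed = bilinear_mapD(3)[OF pure_tensor_bilinear]
lemmas pure_add_left = linear_mapsD(2)[OF bilinear_mapD(2)[OF pure_tensor_bilinear]]
lemmas pure_add_right = linear_mapsD(2)[OF bilinear_mapD(1)[OF pure_tensor_bilinear]]
lemmas pure_smult_left = linear_mapsD(3)[OF bilinear_mapD(2)[OF pure_tensor_bilinear]]
lemmas pure_smult_right = linear_mapsD(3)[OF bilinear_mapD(1)[OF pure_tensor_bilinear]]

lemma tensor_induct [consumes 1, case_names pure add]:
  assumes X: "X \<in> carrier (tensor R M N)"
    and pure: "\<And>x y. x \<in> carrier M \<Longrightarrow> y \<in> carrier N \<Longrightarrow> Q (pure_tensor R M N x y)"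
    and add: "\<And>X Y. X \<in> carrier (tensor R M N) \<Longrightarrow> Y \<in> carrier (tensor R M N) \<Longrightarrow> Q X \<Longrightarrow> Q Y
      \<Longrightarrow> Q (X \<oplus>\<^bsub>tensor R M N\<^esub> Y)"
  shows "Q X"
proof -
  let ?F = "free_module R (carrier M \<times> carrier N)"
  let ?p = "\<lambda>f. tensor_null R M N +>\<^bsub>?F\<^esub> f"
  have "Q (?p f)" if "f \<in> carrier ?F" for f using that
  proof (induction f rule: F.free_induct)
    case zero
    \<comment> \<open>The zero tensor is the pure tensor \<open>0 \<otimes> 0\<close>, so it falls under the case of pure tensors.\<close>
    have "?p \<zero>\<^bsub>?F\<^esub> = \<zero>\<^bsub>tensor R M N\<^esub>"
      using quo.proj_null[of "\<zero>\<^bsub>?F\<^esub>"] by (simp add: tensor_def)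
    also have "\<dots> = \<zero> \<odot>\<^bsub>tensor R M N\<^esub> pure_tensor R M N \<zero>\<^bsub>M\<^esub> \<zero>\<^bsub>N\<^esub>"
      by (simp add: pure_closed)
    also have "\<dots> = pure_tensor R M N (\<zero> \<odot>\<^bsub>M\<^esub> \<zero>\<^bsub>M\<^esub>) \<zero>\<^bsub>N\<^esub>"
      by (rule pure_smult_left[symmetric]) auto
    finally show ?case using pure[of "\<zero> \<odot>\<^bsub>M\<^esub> \<zero>\<^bsub>M\<^esub>" "\<zero>\<^bsub>N\<^esub>"] by simp
  next
    case (basis r s)
    then obtain x y where s: "s = (x, y)" "x \<in> carrier M" "y \<in> carrier N" by auto
    have "?p (r \<odot>\<^bsub>?F\<^esub> basis_elem R s) = pure_tensor R M N (r \<odot>\<^bsub>M\<^esub> x) y"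
      using s basis
      by (simp add: pure_smult_left) (simp add: pure_tensor_def tensor_def quo.quot_smult F.basis_closed)
    then show ?case using pure[of "r \<odot>\<^bsub>M\<^esub> x" y] s basis by simp
  next
    case (add f g)
    then show ?case using assms(3)[of "?p f" "?p g"]
      by (simp add: tensor_def quo.quot_add quo.proj_closed)
  qed
  moreover obtain f where "f \<in> carrier ?F" "X = ?p f"
    using X by (auto simp: tensor_def quot_alg_simps(1))
  ultimately show ?thesis by blast
qed

lemma tensor_linear_eq:
  assumes f: "f \<in> linear_maps R (tensor R M N) P" and g: "g \<in> linear_maps R (tensor R M N) P"
    and eq: "\<And>x y. x \<in> carrier M \<Longrightarrow> y \<in> carrier N
      \<Longrightarrow> f (pure_tensor R M N x y) = g (pure_tensor R M N x y)"
    and X: "X \<in> carrier (tensor R M N)"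
  shows "f X = g X"
  using X by (induction X rule: tensor_induct) (simp_all add: eq linear_mapsD[OF f] linear_mapsD[OF g])

lemma tensor_lift:
  assumes P: "module R P" and b: "bilinear_map R M N P b"
  shows "tensor_lift R P b \<in> linear_maps R (tensor R M N) P"
    and "x \<in> carrier M \<Longrightarrow> y \<in> carrier N \<Longrightarrow> tensor_lift R P b (pure_tensor R M N x y) = b x y"
proof -
  interpret P: module R P by fact
  let ?F = "free_module R (carrier M \<times> carrier N)"
  let ?\<phi> = "\<lambda>(x, y). b x y"
  have \<phi>: "?\<phi> \<in> carrier M \<times> carrier N \<rightarrow> carrier P" using bilinear_mapD(3)[OF b] by auto
  note lin = F.free_lift_linear[OF P \<phi>]
  note basis = F.free_lift_basis[OF P \<phi>]
  note bl = linear_mapsD[OF bilinear_mapD(2)[OF b]] linear_mapsD[OF bilinear_mapD(1)[OF b]]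
  let ?K = "{f \<in> carrier ?F. free_lift R P ?\<phi> f = \<zero>\<^bsub>P\<^esub>}"
  have K: "f \<ominus>\<^bsub>?F\<^esub> g \<in> ?K"
    if "f \<in> carrier ?F" "g \<in> carrier ?F" "free_lift R P ?\<phi> f = free_lift R P ?\<phi> g" for f g
    using that linear_mapsD(1)[OF lin]
    by (simp add: linear_maps_minus[OF lin F.F_module P] P.M.minus_eq_zero_iff F.F.M.minus_closed)
  have "tensor_rels R M N \<subseteq> ?K"
    unfolding tensor_rels_def Let_def
    by (intro Un_least subsetI; elim CollectE exE conjE; hypsubst; rule K) (simp_all add: F.basis_closed basis linear_mapsD[OF lin] bl)
  then have "tensor_null R M N \<subseteq> ?K"
    unfolding tensor_null_def
    by (rule gen_submodule_minimal[OF linear_kernel_submodule[OF lin F.F_module P]])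
  then have null: "free_lift R P ?\<phi> f = \<zero>\<^bsub>P\<^esub>" if "f \<in> tensor_null R M N" for f using that by auto
  note * = F.lin_ext_quot[OF P \<phi> quo.submodule null]
  show "tensor_lift R P b \<in> linear_maps R (tensor R M N) P"
    unfolding tensor_lift_def tensor_def by (rule *(1))
  show "tensor_lift R P b (pure_tensor R M N x y) = b x y" if "x \<in> carrier M" "y \<in> carrier N"
    unfolding tensor_lift_def pure_tensor_def using that by (simp add: *(2) F.basis_closed basis)
qed

text \<open>Nested lifts, such as the products of algebra tensor products and of smash products, are
  multilinear because a lift depends linearly on the bilinear map that is lifted.\<close>

lemma tensor_lift_linear_param:
  assumes P: "module R P" and K: "module R K"
    and b: "\<And>k. k \<in> carrier K \<Longrightarrow> bilinear_map R M N P (b k)"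
    and lin: "\<And>x y. x \<in> carrier M \<Longrightarrow> y \<in> carrier N \<Longrightarrow> (\<lambda>k. b k x y) \<in> linear_maps R K P"
    and X: "X \<in> carrier (tensor R M N)"
  shows "(\<lambda>k. tensor_lift R P (b k) X) \<in> linear_maps R K P"
proof -
  interpret P: module R P by fact
  interpret K: module R K by fact
  note tl = tensor_lift[OF P b]
  show ?thesis
  proof (rule linear_mapsI)
    show "tensor_lift R P (b k) X \<in> carrier P" if "k \<in> carrier K" for k
      using linear_mapsD(1)[OF tl(1)[OF that] X] .
    show "tensor_lift R P (b (k \<oplus>\<^bsub>K\<^esub> l)) X = tensor_lift R P (b k) X \<oplus>\<^bsub>P\<^esub> tensor_lift R P (b l) X"
      if "k \<in> carrier K" "l \<in> carrier K" for k l
      by (rule tensor_linear_eq[OF _ _ _ X, where P = P])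
        (use that in \<open>simp_all add: tl linear_mapsD[OF lin] linear_maps_add[OF _ _ P]\<close>)
    show "tensor_lift R P (b (r \<odot>\<^bsub>K\<^esub> k)) X = r \<odot>\<^bsub>P\<^esub> tensor_lift R P (b k) X"
      if "r \<in> carrier R" "k \<in> carrier K" for r k
      by (rule tensor_linear_eq[OF _ _ _ X, where P = P])
        (use that in \<open>simp_all add: tl linear_mapsD[OF lin] linear_maps_smult[OF _ P]\<close>)
  qed
qed

end

section \<open>The free algebra and the tensor algebra\<close>

locale free_alg = R: cring R for R :: "('r, 'k) ring_scheme" (structure) +
  fixes S :: "'s set"
begin

abbreviation "FA \<equiv> free_algebra R S"

sublocale F: free_on R "lists S" FA
  by (simp add: free_on_def free_on_axioms_def free_algebra_def free_module_def R.is_cring)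

lemma mult_FA: "(f \<otimes>\<^bsub>FA\<^esub> g) w = (\<Oplus>i\<in>{..length w}. f (take i w) \<otimes> g (drop i w))"
  by (simp add: free_algebra_def)

lemma one_FA: "\<one>\<^bsub>FA\<^esub> = basis_elem R []"
  by (simp add: free_algebra_def)

lemma coeff_closed: "f \<in> carrier FA \<Longrightarrow> f w \<in> carrier R"
  using F.mem_F by auto

lemma mult_closed:
  assumes f: "f \<in> carrier FA" and g: "g \<in> carrier FA"
  shows "f \<otimes>\<^bsub>FA\<^esub> g \<in> carrier FA"
proof -
  let ?A = "(\<lambda>(u, v). u @ v) ` ({u. f u \<noteq> \<zero>} \<times> {v. g v \<noteq> \<zero>})"
  note [simp] = coeff_closed[OF f] coeff_closed[OF g]
  have "\<exists>i. f (take i w) \<noteq> \<zero> \<and> g (drop i w) \<noteq> \<zero>" if "(f \<otimes>\<^bsub>FA\<^esub> g) w \<noteq> \<zero>" for w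
  proof (rule ccontr)
    assume "\<not> ?thesis"
    then have "f (take i w) \<otimes> g (drop i w) = \<zero>" for i by (cases "f (take i w) = \<zero>") auto
    then have "(f \<otimes>\<^bsub>FA\<^esub> g) w = \<zero>" by (simp add: mult_FA)
    with that show False by simp
  qed
  then have "{w. (f \<otimes>\<^bsub>FA\<^esub> g) w \<noteq> \<zero>} \<subseteq> ?A"
    by (auto simp: image_iff split: prod.splits) (metis append_take_drop_id)
  moreover have "finite ?A" using f g F.mem_F by auto
  moreover have "?A \<subseteq> lists S"
  proof (rule subsetI)
    fix w assume "w \<in> ?A"
    then obtain u v where uv: "w = u @ v" "f u \<noteq> \<zero>" "g v \<noteq> \<zero>" by auto
    then have "u \<in> lists S" "v \<in> lists S" using F.supp_subset[OF f] F.supp_subset[OF g] by blast+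
    then show "w \<in> lists S" using uv(1) by simp
  qed
  ultimately have fin: "finite {w. (f \<otimes>\<^bsub>FA\<^esub> g) w \<noteq> \<zero>}" and sub: "{w. (f \<otimes>\<^bsub>FA\<^esub> g) w \<noteq> \<zero>} \<subseteq> lists S"
    by (auto intro: finite_subset)
  have "(f \<otimes>\<^bsub>FA\<^esub> g) w \<in> carrier R" for w
    unfolding mult_FA by (rule R.finsum_closed) simp
  then show ?thesis unfolding F.mem_F using fin sub by blast
qed

lemma mult_bilinear: "bilinear_map R FA FA FA (\<lambda>f g. f \<otimes>\<^bsub>FA\<^esub> g)"
proof (intro bilinear_mapI linear_mapsI mult_closed)
  note [simp] = coeff_closed
  show "(f \<otimes>\<^bsub>FA\<^esub> (g \<oplus>\<^bsub>FA\<^esub> h)) = f \<otimes>\<^bsub>FA\<^esub> g \<oplus>\<^bsub>FA\<^esub> f \<otimes>\<^bsub>FA\<^esub> h"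
    if "f \<in> carrier FA" "g \<in> carrier FA" "h \<in> carrier FA" for f g h
    using that by (auto simp: fun_eq_iff mult_FA F.add_F R.r_distr R.finsum_addf)
  show "((g \<oplus>\<^bsub>FA\<^esub> h) \<otimes>\<^bsub>FA\<^esub> f) = g \<otimes>\<^bsub>FA\<^esub> f \<oplus>\<^bsub>FA\<^esub> h \<otimes>\<^bsub>FA\<^esub> f"
    if "f \<in> carrier FA" "g \<in> carrier FA" "h \<in> carrier FA" for f g h
    using that by (auto simp: fun_eq_iff mult_FA F.add_F R.l_distr R.finsum_addf)
  show "f \<otimes>\<^bsub>FA\<^esub> (r \<odot>\<^bsub>FA\<^esub> g) = r \<odot>\<^bsub>FA\<^esub> (f \<otimes>\<^bsub>FA\<^esub> g)"
    if "f \<in> carrier FA" "g \<in> carrier FA" "r \<in> carrier R" for f g r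
    using that by (auto simp: fun_eq_iff mult_FA F.smult_F R.m_lcomm R.finsum_rdistr Pi_def)
  show "(r \<odot>\<^bsub>FA\<^esub> f) \<otimes>\<^bsub>FA\<^esub> g = r \<odot>\<^bsub>FA\<^esub> (f \<otimes>\<^bsub>FA\<^esub> g)"
    if "f \<in> carrier FA" "g \<in> carrier FA" "r \<in> carrier R" for f g r
    using that by (auto simp: fun_eq_iff mult_FA F.smult_F R.m_assoc R.finsum_rdistr Pi_def)
qed

lemmas mult_linear_left = bilinear_mapD(2)[OF mult_bilinear]
lemmas mult_linear_right = bilinear_mapD(1)[OF mult_bilinear]

text \<open>In the convolution of two basis elements only the split after the first \<open>length u\<close> letters
  can contribute.\<close>

lemma basis_mult: "basis_elem R u \<otimes>\<^bsub>FA\<^esub> basis_elem R v = basis_elem R (u @ v)"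
proof (rule ext)
  fix w
  have "(basis_elem R u \<otimes>\<^bsub>FA\<^esub> basis_elem R v) w
      = (\<Oplus>i\<in>{..length w}. if length u = i then (if w = u @ v then \<one> else \<zero>) else \<zero>)"
    unfolding mult_FA
  proof (rule R.finsum_cong')
    fix j assume j: "j \<in> {..length w}"
    show "basis_elem R u (take j w) \<otimes> basis_elem R v (drop j w)
        = (if length u = j then (if w = u @ v then \<one> else \<zero>) else \<zero>)"
    proof (cases "length u = j")
      case True
      then have "w = u @ v \<longleftrightarrow> take j w = u \<and> drop j w = v"
        by (metis append_eq_conv_conj)
      then show ?thesis using True by (simp add: basis_elem_def)
    next
      case False
      then have "take j w \<noteq> u" using j by auto
      then show ?thesis using False by (simp add: basis_elem_def)
    qed
  qed auto
  also have "\<dots> = basis_elem R (u @ v) w"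
  proof (cases "length u \<le> length w")
    case True
    then show ?thesis
      using R.finsum_singleton[of "length u" "{..length w}" "\<lambda>_. if w = u @ v then \<one> else \<zero>"]
      by (auto simp: basis_elem_def)
  next
    case False
    then have "w \<noteq> u @ v" by auto
    then show ?thesis by (simp add: basis_elem_def)
  qed
  finally show "(basis_elem R u \<otimes>\<^bsub>FA\<^esub> basis_elem R v) w = basis_elem R (u @ v) w" .
qed

text \<open>Associativity and the unit laws are identities between multilinear maps, hence need only be
  checked on words.\<close>

lemma FA_assoc_algebra: "assoc_algebra R FA"
proof -
  note mod = F.F_module
  note [simp] = mult_closed F.basis_closed
  note L = mult_linear_left and Rr = mult_linear_right
  have one: "\<one>\<^bsub>FA\<^esub> \<in> carrier FA" by (simp add: one_FA)
  have id: "(\<lambda>f. f) \<in> linear_maps R FA FA" by (simp add: linear_maps_def)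
  have assoc: "(f \<otimes>\<^bsub>FA\<^esub> g) \<otimes>\<^bsub>FA\<^esub> h = f \<otimes>\<^bsub>FA\<^esub> (g \<otimes>\<^bsub>FA\<^esub> h)"
    if f: "f \<in> carrier FA" and g: "g \<in> carrier FA" and h: "h \<in> carrier FA" for f g h
  proof (rule F.linear_eq_on_basis[OF linear_maps_compose[OF L[OF g] L[OF h]] L[OF mult_closed[OF g h]] mod _ f])
    fix u assume u: "u \<in> lists S"
    then have ub: "basis_elem R u \<in> carrier FA" by simp
    show "(basis_elem R u \<otimes>\<^bsub>FA\<^esub> g) \<otimes>\<^bsub>FA\<^esub> h = basis_elem R u \<otimes>\<^bsub>FA\<^esub> (g \<otimes>\<^bsub>FA\<^esub> h)"
    proof (rule F.linear_eq_on_basis[OF linear_maps_compose[OF Rr[OF ub] L[OF h]]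
          linear_maps_compose[OF L[OF h] Rr[OF ub]] mod _ g])
      fix v assume v: "v \<in> lists S"
      then have vb: "basis_elem R v \<in> carrier FA" by simp
      show "(basis_elem R u \<otimes>\<^bsub>FA\<^esub> basis_elem R v) \<otimes>\<^bsub>FA\<^esub> h
          = basis_elem R u \<otimes>\<^bsub>FA\<^esub> (basis_elem R v \<otimes>\<^bsub>FA\<^esub> h)"
        by (rule F.linear_eq_on_basis[OF Rr[OF mult_closed[OF ub vb]]
              linear_maps_compose[OF Rr[OF vb] Rr[OF ub]] mod _ h]) (simp add: basis_mult)
    qed
  qed
  have l_one: "\<one>\<^bsub>FA\<^esub> \<otimes>\<^bsub>FA\<^esub> f = f" if f: "f \<in> carrier FA" for f
    by (rule F.linear_eq_on_basis[OF Rr[OF one] id mod _ f]) (simp add: one_FA basis_mult)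
  have r_one: "f \<otimes>\<^bsub>FA\<^esub> \<one>\<^bsub>FA\<^esub> = f" if f: "f \<in> carrier FA" for f
    by (rule F.linear_eq_on_basis[OF L[OF one] id mod _ f]) (simp add: one_FA basis_mult)
  have "ring FA"
    by (rule ringI[OF F.F.abelian_group_axioms])
      (auto intro!: monoidI simp: assoc l_one r_one one linear_mapsD[OF L] linear_mapsD[OF Rr])
  then show ?thesis
    by (simp add: assoc_algebra_def assoc_algebra_axioms_def mod linear_mapsD[OF L] linear_mapsD[OF Rr])
qed

end

locale tensor_algebra = M: module R M
  for R :: "('r, 'k) ring_scheme" (structure) and M :: "('r, 'm, 'l) module_scheme"
begin

abbreviation "T \<equiv> talg R M"
abbreviation "i \<equiv> talg_incl R M"

sublocale W: free_alg R "carrier M" by (intro free_alg.intro M.R.is_cring)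

abbreviation "FA \<equiv> free_algebra R (carrier M)"

sublocale FA: assoc_algebra R FA by (rule W.FA_assoc_algebra)

definition "talg_rels =
       {basis_elem R [x \<oplus>\<^bsub>M\<^esub> y] \<ominus>\<^bsub>FA\<^esub> (basis_elem R [x] \<oplus>\<^bsub>FA\<^esub> basis_elem R [y]) | x y. x \<in> carrier M \<and> y \<in> carrier M} \<union>
        {basis_elem R [r \<odot>\<^bsub>M\<^esub> x] \<ominus>\<^bsub>FA\<^esub> r \<odot>\<^bsub>FA\<^esub> basis_elem R [x] | r x. r \<in> carrier R \<and> x \<in> carrier M}"

lemma talg_null_eq: "talg_null R M = genideal FA talg_rels"
  by (simp add: talg_null_def talg_rels_def Let_def)

lemma word_closed: "x \<in> carrier M \<Longrightarrow> basis_elem R [x] \<in> carrier FA"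
  by (simp add: W.F.basis_closed)

lemma talg_rels_closed: "talg_rels \<subseteq> carrier FA"
  unfolding talg_rels_def by (auto intro!: W.F.F.M.minus_closed simp: word_closed)

sublocale q: ideal_quotient R FA "talg_null R M"
  unfolding talg_null_eq
  by (intro ideal_quotient.intro ideal_quotient_axioms.intro FA.assoc_algebra_axioms
      FA.genideal_ideal talg_rels_closed)

sublocale T: assoc_algebra R T
  unfolding talg_def by (rule q.quot_assoc_algebra)

lemma incl_linear: "i \<in> linear_maps R M T"
proof -
  have rel: "talg_null R M +>\<^bsub>FA\<^esub> f = talg_null R M +>\<^bsub>FA\<^esub> g"
    if "f \<in> carrier FA" "g \<in> carrier FA" "f \<ominus>\<^bsub>FA\<^esub> g \<in> talg_rels" for f g
    using that genideal_superset[of talg_rels FA]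
    by (intro q.proj_cong) (auto simp: talg_null_eq)
  show ?thesis
    unfolding talg_def talg_incl_def
  proof (rule linear_mapsI)
    show "talg_null R M +>\<^bsub>FA\<^esub> basis_elem R [x \<oplus>\<^bsub>M\<^esub> y] =
       (talg_null R M +>\<^bsub>FA\<^esub> basis_elem R [x]) \<oplus>\<^bsub>quot_alg FA (talg_null R M)\<^esub> (talg_null R M +>\<^bsub>FA\<^esub> basis_elem R [y])"
      if "x \<in> carrier M" "y \<in> carrier M" for x y
      by (insert that, subst q.quot_add; (rule rel)?) (auto simp: word_closed talg_rels_def)
    show "talg_null R M +>\<^bsub>FA\<^esub> basis_elem R [r \<odot>\<^bsub>M\<^esub> x] =
       r \<odot>\<^bsub>quot_alg FA (talg_null R M)\<^esub> (talg_null R M +>\<^bsub>FA\<^esub> basis_elem R [x])"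
      if "r \<in> carrier R" "x \<in> carrier M" for r x
      by (insert that, subst q.quot_smult; (rule rel)?) (auto simp: word_closed talg_rels_def)
  qed (simp add: q.proj_closed word_closed)
qed

lemmas incl_closed [simp] = linear_mapsD(1)[OF incl_linear]

text \<open>As an algebra \<open>T(M)\<close> is generated by \<open>M\<close>, and as a module by words; building words from the left
  by single letters is the form of induction that matches \<open>talg_rec\<close>.\<close>

lemma talg_induct [consumes 1, case_names one mult add smult]:
  assumes t: "t \<in> carrier T"
    and one: "Q \<one>\<^bsub>T\<^esub>"
    and mult: "\<And>x t. x \<in> carrier M \<Longrightarrow> t \<in> carrier T \<Longrightarrow> Q t \<Longrightarrow> Q (i x \<otimes>\<^bsub>T\<^esub> t)"
    and add: "\<And>t u. t \<in> carrier T \<Longrightarrow> u \<in> carrier T \<Longrightarrow> Q t \<Longrightarrow> Q u \<Longrightarrow> Q (t \<oplus>\<^bsub>T\<^esub> u)"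
    and smult: "\<And>r t. r \<in> carrier R \<Longrightarrow> t \<in> carrier T \<Longrightarrow> Q t \<Longrightarrow> Q (r \<odot>\<^bsub>T\<^esub> t)"
  shows "Q t"
proof -
  let ?p = "\<lambda>f. talg_null R M +>\<^bsub>FA\<^esub> f"
  have word: "?p (basis_elem R w) \<in> carrier T \<and> Q (?p (basis_elem R w))" if "w \<in> lists (carrier M)" for w
    using that
  proof (induction w)
    case Nil
    have "?p (basis_elem R []) = \<one>\<^bsub>T\<^esub>"
      unfolding talg_def by (simp add: quot_alg_simps W.one_FA)
    then show ?case using one by simp
  next
    case (Cons x w)
    have "?p (basis_elem R (x # w)) = i x \<otimes>\<^bsub>T\<^esub> ?p (basis_elem R w)"
      using Cons.hyps W.basis_mult[of "[x]" w]
      unfolding talg_def talg_incl_def by (simp add: q.quot_mult W.F.basis_closed)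
    then show ?case using Cons mult[of x "?p (basis_elem R w)"] by simp
  qed
  have "Q (?p f)" if "f \<in> carrier FA" for f using that
  proof (induction f rule: W.F.free_induct)
    case zero
    have "?p \<zero>\<^bsub>FA\<^esub> = \<zero> \<odot>\<^bsub>T\<^esub> \<one>\<^bsub>T\<^esub>"
      using q.proj_null[of "\<zero>\<^bsub>FA\<^esub>"] by (simp add: talg_def[symmetric])
    then show ?case using smult[OF _ _ one, of \<zero>] by simp
  next
    case (basis r w)
    then show ?case
      using smult[OF basis(1), of "?p (basis_elem R w)"] word[OF basis(2)] q.quot_smult[OF basis(1) W.F.basis_closed[OF basis(2)]]
      by (simp add: talg_def)
  next
    case (add f g)
    then show ?case using assms(4)[of "?p f" "?p g"]
      by (simp add: talg_def q.quot_add q.proj_closed)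
  qed
  moreover obtain f where "f \<in> carrier FA" "t = ?p f"
    using t by (auto simp: talg_def quot_alg_simps(1))
  ultimately show ?thesis by blast
qed

lemma talg_linear_eq:
  assumes f: "f \<in> linear_maps R T P" and g: "g \<in> linear_maps R T P"
    and one: "f \<one>\<^bsub>T\<^esub> = g \<one>\<^bsub>T\<^esub>"
    and mult: "\<And>x t. x \<in> carrier M \<Longrightarrow> t \<in> carrier T \<Longrightarrow> f t = g t \<Longrightarrow> f (i x \<otimes>\<^bsub>T\<^esub> t) = g (i x \<otimes>\<^bsub>T\<^esub> t)"
    and t: "t \<in> carrier T"
  shows "f t = g t"
  using t by (induction t rule: talg_induct) (simp_all add: one mult linear_mapsD[OF f] linear_mapsD[OF g])

end

section \<open>Recursion on the tensor algebra\<close>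

text \<open>The linear extension of \<open>x\<^sub>1 \<otimes> \<dots> \<otimes> x\<^sub>k \<mapsto> \<rho> x\<^sub>1 (\<dots> (\<rho> x\<^sub>k z))\<close>. The comultiplication of \<open>T(M)\<close>,
  the Poisson action on \<open>Sym(M)\<close>, left multiplication in the smash product and the morphisms from
  \<open>T(M)\<close> to other algebras all have this form.\<close>

definition talg_rec ::
    "('r, 'k) ring_scheme \<Rightarrow> ('r, 'p, 'l) module_scheme \<Rightarrow> ('m \<Rightarrow> 'p \<Rightarrow> 'p) \<Rightarrow> 'p \<Rightarrow> ('m list \<Rightarrow> 'r) set \<Rightarrow> 'p"
  where "talg_rec R P \<rho> z = lin_ext R P (\<lambda>w. foldr \<rho> w z)"

text \<open>The universal property of \<open>T(M)\<close>, phrased for operators instead of algebras: a linear family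
  \<open>\<rho>\<close> of endomorphisms of a module \<open>P\<close> makes \<open>P\<close> a \<open>T(M)\<close>-module. No product on \<open>P\<close> is
  involved, so such actions can be used to construct and analyse products on \<open>P\<close>.\<close>

locale talg_action = tensor_algebra R M + P: module R P
  for R :: "('r, 'k) ring_scheme" (structure) and M :: "('r, 'm, 'l) module_scheme"
    and P :: "('r, 'p, 'n) module_scheme" +
  fixes \<rho> :: "'m \<Rightarrow> 'p \<Rightarrow> 'p"
  assumes bil: "bilinear_map R M P P \<rho>"
begin

lemma foldr_linear: "w \<in> lists (carrier M) \<Longrightarrow> foldr \<rho> w \<in> linear_maps R P P"
proof (induction w)
  case Nil
  show ?case by (simp add: linear_maps_def)
next
  case (Cons x w)
  then show ?case
    using linear_maps_compose[OF Cons.IH bilinear_mapD(1)[OF bil, of x]] by (simp add: comp_def)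
qed

abbreviation "L z \<equiv> free_lift R P (\<lambda>w. foldr \<rho> w z)"

lemma foldr_closed: "z \<in> carrier P \<Longrightarrow> (\<lambda>w. foldr \<rho> w z) \<in> lists (carrier M) \<rightarrow> carrier P"
  by (rule Pi_I) (rule linear_mapsD(1)[OF foldr_linear])

lemma L_linear: "z \<in> carrier P \<Longrightarrow> L z \<in> linear_maps R FA P"
  by (rule W.F.free_lift_linear[OF P.module_axioms foldr_closed])

lemma L_basis: "z \<in> carrier P \<Longrightarrow> w \<in> lists (carrier M) \<Longrightarrow> L z (basis_elem R w) = foldr \<rho> w z"
  by (rule W.F.free_lift_basis[OF P.module_axioms foldr_closed])

lemma L_mult:
  assumes z: "z \<in> carrier P" and f: "f \<in> carrier FA" and g: "g \<in> carrier FA"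
  shows "L z (f \<otimes>\<^bsub>FA\<^esub> g) = L (L z g) f"
proof (rule W.F.linear_eq_on_basis[OF linear_maps_compose[OF W.mult_linear_left[OF g] L_linear[OF z]]
      L_linear P.module_axioms _ f])
  show Lz: "L z g \<in> carrier P" using linear_mapsD(1)[OF L_linear[OF z] g] .
  fix u assume u: "u \<in> lists (carrier M)"
  have "L z (basis_elem R u \<otimes>\<^bsub>FA\<^esub> g) = foldr \<rho> u (L z g)"
    by (rule W.F.linear_eq_on_basis[OF linear_maps_compose[OF W.mult_linear_right[OF W.F.basis_closed[OF u]] L_linear[OF z]]
          linear_maps_compose[OF L_linear[OF z] foldr_linear[OF u]] P.module_axioms _ g])
      (use u z in \<open>simp add: W.basis_mult L_basis\<close>)
  then show "L z (basis_elem R u \<otimes>\<^bsub>FA\<^esub> g) = L (L z g) (basis_elem R u)"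
    using L_basis[OF Lz u] by simp
qed

text \<open>The elements of the free algebra that annihilate all of \<open>P\<close> form a two-sided ideal by
  \<open>L_mult\<close>, and linearity of \<open>\<rho>\<close> in its first argument puts the relations of \<open>T(M)\<close> into it. Only the
  annihilator of all starting values at once is closed under multiplication from the right.\<close>

lemma L_null:
  assumes z: "z \<in> carrier P" and f: "f \<in> talg_null R M"
  shows "L z f = \<zero>\<^bsub>P\<^esub>"
proof -
  let ?K = "{f \<in> carrier FA. \<forall>z\<in>carrier P. L z f = \<zero>\<^bsub>P\<^esub>}"
  note lin = linear_mapsD[OF L_linear]
  note z0 = linear_maps_zero[OF L_linear W.F.F_module P.module_axioms]
  have minus: "L z (f \<ominus>\<^bsub>FA\<^esub> g) = L z f \<ominus>\<^bsub>P\<^esub> L z g"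
    if "z \<in> carrier P" "f \<in> carrier FA" "g \<in> carrier FA" for f g z
    by (rule linear_maps_minus[OF L_linear W.F.F_module P.module_axioms]) (use that in auto)
  have L0: "L \<zero>\<^bsub>P\<^esub> g = \<zero>\<^bsub>P\<^esub>" if g: "g \<in> carrier FA" for g
    using L_mult[OF P.M.zero_closed g, of "\<zero>\<^bsub>FA\<^esub>"] g by (simp add: z0)
  have neg: "L z (\<ominus>\<^bsub>FA\<^esub> g) = \<zero>\<^bsub>P\<^esub>" if "z \<in> carrier P" "g \<in> carrier FA" "L z g = \<zero>\<^bsub>P\<^esub>" for z g
    using minus[OF that(1) W.F.F.M.zero_closed that(2)] that by (simp add: z0 a_minus_def)
  have K: "f \<ominus>\<^bsub>FA\<^esub> g \<in> ?K"
    if "f \<in> carrier FA" "g \<in> carrier FA" "\<And>z. z \<in> carrier P \<Longrightarrow> L z f = L z g" for f g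
    using that by (simp add: minus P.M.minus_eq_zero_iff lin W.F.F.M.minus_closed)
  have "ideal ?K FA"
  proof (rule idealI)
    show "ring FA" by (rule FA.ring_axioms)
    show "subgroup ?K (add_monoid FA)"
    proof (rule W.F.F.M.add.subgroupI)
      show "?K \<noteq> {}" using W.F.F.M.zero_closed z0 by blast
    qed (auto simp: lin neg)
    show "g \<otimes>\<^bsub>FA\<^esub> f \<in> ?K" "f \<otimes>\<^bsub>FA\<^esub> g \<in> ?K" if "f \<in> ?K" "g \<in> carrier FA" for f g
      using that by (simp_all add: L_mult L0 lin W.mult_closed)
  qed
  moreover have "talg_rels \<subseteq> ?K"
    unfolding talg_rels_def
    by (intro Un_least subsetI; elim CollectE exE conjE; hypsubst; rule K)
      (simp_all add: word_closed lin L_basis linear_mapsD[OF bilinear_mapD(2)[OF bil]])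
  ultimately have "talg_null R M \<subseteq> ?K"
    unfolding talg_null_eq by (rule genideal_minimal)
  then show ?thesis using z f by auto
qed

lemma rec_linear: "z \<in> carrier P \<Longrightarrow> talg_rec R P \<rho> z \<in> linear_maps R T P"
  unfolding talg_rec_def talg_def
  by (rule W.F.lin_ext_quot(1)[OF P.module_axioms foldr_closed q.submodule L_null])

lemma rec_proj: "z \<in> carrier P \<Longrightarrow> f \<in> carrier FA \<Longrightarrow> talg_rec R P \<rho> z (talg_null R M +>\<^bsub>FA\<^esub> f) = L z f"
  unfolding talg_rec_def talg_def
  by (rule W.F.lin_ext_quot(2)[OF P.module_axioms foldr_closed q.submodule L_null])

lemma rec_one: "z \<in> carrier P \<Longrightarrow> talg_rec R P \<rho> z \<one>\<^bsub>T\<^esub> = z"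
  using rec_proj[of z "\<one>\<^bsub>FA\<^esub>"] L_basis[of z "[]"]
  by (simp add: talg_def quot_alg_simps W.one_FA W.F.basis_closed)

lemma rec_mult:
  assumes z: "z \<in> carrier P" and x: "x \<in> carrier M" and t: "t \<in> carrier T"
  shows "talg_rec R P \<rho> z (i x \<otimes>\<^bsub>T\<^esub> t) = \<rho> x (talg_rec R P \<rho> z t)"
proof -
  obtain f where f: "f \<in> carrier FA" "t = talg_null R M +>\<^bsub>FA\<^esub> f"
    using t by (auto simp: talg_def quot_alg_simps(1))
  have "i x \<otimes>\<^bsub>T\<^esub> t = talg_null R M +>\<^bsub>FA\<^esub> (basis_elem R [x] \<otimes>\<^bsub>FA\<^esub> f)"
    unfolding talg_incl_def talg_def f(2) using x f by (simp add: q.quot_mult word_closed)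
  then show ?thesis
    using z x f linear_mapsD(1)[OF L_linear[OF z] f(1)] L_basis[of "L z f" "[x]"]
    by (simp add: rec_proj L_mult word_closed)
qed

lemma rec_closed: "z \<in> carrier P \<Longrightarrow> t \<in> carrier T \<Longrightarrow> talg_rec R P \<rho> z t \<in> carrier P"
  using linear_mapsD(1)[OF rec_linear] .

lemma rec_param_linear:
  assumes t: "t \<in> carrier T"
  shows "(\<lambda>z. talg_rec R P \<rho> z t) \<in> linear_maps R P P"
  using t
proof (induction t rule: talg_induct)
  case one
  show ?case by (rule linear_mapsI) (simp_all add: rec_one)
next
  case (mult x t)
  show ?case
    by (rule linear_maps_cong[OF linear_maps_compose[OF mult(3) bilinear_mapD(1)[OF bil mult(1)]] P.module_axioms])
      (simp add: rec_mult mult(1,2))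
next
  case (add t u)
  show ?case
    by (rule linear_maps_cong[OF linear_maps_add[OF add(3,4) P.module_axioms] P.module_axioms])
      (simp add: add(1,2) linear_mapsD(2)[OF rec_linear])
next
  case (smult r t)
  show ?case
    by (rule linear_maps_cong[OF linear_maps_smult[OF smult(3) P.module_axioms smult(1)] P.module_axioms])
      (simp add: smult(1,2) linear_mapsD(3)[OF rec_linear])
qed

text \<open>The recursion extends the operators \<open>\<rho> x\<close> to an action of the algebra \<open>T(M)\<close>, with \<open>t\<close> sending
  \<open>z\<close> to \<open>talg_rec R P \<rho> z t\<close>. What follows is the associativity of this action.\<close>

lemma rec_comp:
  assumes z: "z \<in> carrier P" and t: "t \<in> carrier T" and u: "u \<in> carrier T"
  shows "talg_rec R P \<rho> z (t \<otimes>\<^bsub>T\<^esub> u) = talg_rec R P \<rho> (talg_rec R P \<rho> z u) t"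
  using t
proof (induction t rule: talg_induct)
  case (mult x t)
  then show ?case using z u by (simp add: T.m_assoc rec_mult rec_closed)
qed (use z u in \<open>simp_all add: rec_one rec_closed T.l_distr T.smult_mult_left linear_mapsD[OF rec_linear]\<close>)

end

section \<open>The symmetric algebra and its derivations\<close>

context tensor_algebra
begin

abbreviation "S \<equiv> sym_alg R M"
abbreviation "j \<equiv> sym_incl R M"

definition "sym_rels = {i x \<otimes>\<^bsub>T\<^esub> i y \<ominus>\<^bsub>T\<^esub> i y \<otimes>\<^bsub>T\<^esub> i x | x y. x \<in> carrier M \<and> y \<in> carrier M}"

lemma sym_null_eq: "sym_null R M = genideal T sym_rels"
  by (simp add: sym_null_def sym_rels_def Let_def)

lemma sym_rels_closed: "sym_rels \<subseteq> carrier T"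
  unfolding sym_rels_def by (auto intro!: T.M.minus_closed)

sublocale s: ideal_quotient R T "sym_null R M"
  unfolding sym_null_eq
  by (intro ideal_quotient.intro ideal_quotient_axioms.intro T.assoc_algebra_axioms
      T.genideal_ideal sym_rels_closed)

sublocale S: assoc_algebra R S
  unfolding sym_alg_def by (rule s.quot_assoc_algebra)

definition sym_proj where "sym_proj t = sym_null R M +>\<^bsub>T\<^esub> t"

lemma sym_proj_hom: "sym_proj \<in> algebra_hom R T S"
  unfolding sym_alg_def sym_proj_def[abs_def] by (rule s.proj_algebra_hom)

lemmas sym_proj_linear = algebra_homD(1)[OF sym_proj_hom]
lemmas sym_proj_mult = algebra_homD(2)[OF sym_proj_hom]
lemmas sym_proj_one = algebra_homD(3)[OF sym_proj_hom]

lemma sym_proj_incl: "sym_proj (i x) = j x"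
  by (simp add: sym_proj_def sym_incl_def)

lemma sym_incl_linear: "j \<in> linear_maps R M S"
  using linear_maps_compose[OF incl_linear sym_proj_linear] by (simp add: sym_proj_incl)

lemmas sym_incl_closed [simp] = linear_mapsD(1)[OF sym_incl_linear]

lemma sym_proj_surj: "a \<in> carrier S \<Longrightarrow> \<exists>t\<in>carrier T. a = sym_proj t"
  by (auto simp: sym_alg_def quot_alg_simps(1) sym_proj_def)

lemma sym_induct [consumes 1, case_names one mult add smult]:
  assumes a: "a \<in> carrier S"
    and one: "Q \<one>\<^bsub>S\<^esub>"
    and mult: "\<And>x a. x \<in> carrier M \<Longrightarrow> a \<in> carrier S \<Longrightarrow> Q a \<Longrightarrow> Q (j x \<otimes>\<^bsub>S\<^esub> a)"
    and add: "\<And>a b. a \<in> carrier S \<Longrightarrow> b \<in> carrier S \<Longrightarrow> Q a \<Longrightarrow> Q b \<Longrightarrow> Q (a \<oplus>\<^bsub>S\<^esub> b)"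
    and smult: "\<And>r a. r \<in> carrier R \<Longrightarrow> a \<in> carrier S \<Longrightarrow> Q a \<Longrightarrow> Q (r \<odot>\<^bsub>S\<^esub> a)"
  shows "Q a"
proof -
  note lin = linear_mapsD[OF sym_proj_linear]
  have "Q (sym_proj t)" if "t \<in> carrier T" for t using that
  proof (induction t rule: talg_induct)
    case one
    then show ?case using assms(2) by (simp add: sym_proj_one)
  next
    case (mult x t)
    then show ?case using assms(3)[of x "sym_proj t"] by (simp add: lin sym_proj_mult sym_proj_incl)
  next
    case (add t u)
    then show ?case using assms(4)[of "sym_proj t" "sym_proj u"] by (simp add: lin)
  next
    case (smult r t)
    then show ?case using assms(5)[of r "sym_proj t"] by (simp add: lin)
  qed
  then show ?thesis using sym_proj_surj[OF a] by blast
qed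

end

text \<open>The descent of \<open>talg_rec\<close> from \<open>T(M)\<close> to its quotient \<open>Sym(M)\<close>, for operators that commute with
  each other.\<close>

definition sym_rec ::
    "('r, 'k) ring_scheme \<Rightarrow> ('r, 'p, 'l) module_scheme \<Rightarrow> ('m \<Rightarrow> 'p \<Rightarrow> 'p) \<Rightarrow> 'p \<Rightarrow> ('m list \<Rightarrow> 'r) set set \<Rightarrow> 'p"
  where "sym_rec R P \<rho> z X = talg_rec R P \<rho> z (SOME t. t \<in> X)"

locale commuting_action = talg_action +
  assumes comm: "\<lbrakk>x \<in> carrier M; y \<in> carrier M; z \<in> carrier P\<rbrakk> \<Longrightarrow> \<rho> x (\<rho> y z) = \<rho> y (\<rho> x z)"
begin

text \<open>As for the relations of \<open>T(M)\<close>, the annihilator of \<open>P\<close> is a two-sided ideal; it contains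
  \<open>xy - yx\<close> because \<open>\<rho> x\<close> and \<open>\<rho> y\<close> commute.\<close>

lemma rec_sym_null:
  assumes z: "z \<in> carrier P" and t: "t \<in> sym_null R M"
  shows "talg_rec R P \<rho> z t = \<zero>\<^bsub>P\<^esub>"
proof -
  let ?E = "talg_rec R P \<rho>"
  let ?K = "{t \<in> carrier T. \<forall>z\<in>carrier P. ?E z t = \<zero>\<^bsub>P\<^esub>}"
  note lin = linear_mapsD[OF rec_linear]
  note Tmod = T.module_axioms and Pmod = P.module_axioms
  have minus: "?E z (t \<ominus>\<^bsub>T\<^esub> u) = ?E z t \<ominus>\<^bsub>P\<^esub> ?E z u"
    if "z \<in> carrier P" "t \<in> carrier T" "u \<in> carrier T" for z t u
    using linear_maps_minus[OF rec_linear Tmod Pmod] that .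
  have z0: "?E z \<zero>\<^bsub>T\<^esub> = \<zero>\<^bsub>P\<^esub>" if "z \<in> carrier P" for z
    using linear_maps_zero[OF rec_linear Tmod Pmod] that .
  have E0: "?E \<zero>\<^bsub>P\<^esub> t = \<zero>\<^bsub>P\<^esub>" if "t \<in> carrier T" for t
    using linear_maps_zero[OF rec_param_linear Pmod Pmod] that .
  have neg: "?E z (\<ominus>\<^bsub>T\<^esub> t) = \<zero>\<^bsub>P\<^esub>" if "z \<in> carrier P" "t \<in> carrier T" "?E z t = \<zero>\<^bsub>P\<^esub>" for z t
    using minus[OF that(1) T.M.zero_closed that(2)] that by (simp add: z0 a_minus_def)
  have "ideal ?K T"
  proof (rule idealI)
    show "ring T" by (rule T.ring_axioms)
    show "subgroup ?K (add_monoid T)"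
    proof (rule T.M.add.subgroupI)
      show "?K \<noteq> {}" using T.M.zero_closed z0 by blast
    qed (auto simp: lin neg)
    show "u \<otimes>\<^bsub>T\<^esub> t \<in> ?K" "t \<otimes>\<^bsub>T\<^esub> u \<in> ?K" if "t \<in> ?K" "u \<in> carrier T" for t u
      using that by (simp_all add: rec_comp E0 rec_closed)
  qed
  moreover have "sym_rels \<subseteq> ?K"
  proof
    fix t assume "t \<in> sym_rels"
    then obtain x y where t: "t = i x \<otimes>\<^bsub>T\<^esub> i y \<ominus>\<^bsub>T\<^esub> i y \<otimes>\<^bsub>T\<^esub> i x" and xy: "x \<in> carrier M" "y \<in> carrier M"
      unfolding sym_rels_def by blast
    have inc: "?E z (i x) = \<rho> x z" if "z \<in> carrier P" "x \<in> carrier M" for z x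
      using rec_mult[OF that T.one_closed] that by (simp add: rec_one)
    show "t \<in> ?K" using xy bilinear_mapD(3)[OF bil]
      by (simp add: t minus rec_mult inc comm P.M.minus_eq_zero_iff T.M.minus_closed)
  qed
  ultimately have "sym_null R M \<subseteq> ?K"
    unfolding sym_null_eq by (rule genideal_minimal)
  then show ?thesis using z t by auto
qed

lemma sym_rec_linear: "z \<in> carrier P \<Longrightarrow> sym_rec R P \<rho> z \<in> linear_maps R S P"
  unfolding sym_rec_def[abs_def] sym_alg_def
  by (rule s.quot_lift(1)[OF rec_linear P.module_axioms rec_sym_null])

lemma sym_rec_proj: "z \<in> carrier P \<Longrightarrow> t \<in> carrier T \<Longrightarrow> sym_rec R P \<rho> z (sym_proj t) = talg_rec R P \<rho> z t"
  unfolding sym_rec_def sym_proj_def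
  by (rule s.quot_lift(2)[OF rec_linear P.module_axioms rec_sym_null])

lemma sym_rec_one: "z \<in> carrier P \<Longrightarrow> sym_rec R P \<rho> z \<one>\<^bsub>S\<^esub> = z"
  using sym_rec_proj[of z "\<one>\<^bsub>T\<^esub>"] by (simp add: sym_proj_one rec_one)

lemma sym_rec_mult:
  assumes "z \<in> carrier P" "x \<in> carrier M" "a \<in> carrier S"
  shows "sym_rec R P \<rho> z (j x \<otimes>\<^bsub>S\<^esub> a) = \<rho> x (sym_rec R P \<rho> z a)"
proof -
  obtain t where t: "t \<in> carrier T" "a = sym_proj t" using sym_proj_surj[OF assms(3)] by blast
  have "j x \<otimes>\<^bsub>S\<^esub> a = sym_proj (i x \<otimes>\<^bsub>T\<^esub> t)"
    using t assms by (simp add: sym_proj_mult sym_proj_incl)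
  then show ?thesis using t assms by (simp add: sym_rec_proj rec_mult)
qed

end

definition direct_sum ::
    "('r, 'a, 'l) module_scheme \<Rightarrow> ('r, 'b, 'n) module_scheme \<Rightarrow> ('r, 'a \<times> 'b) module"
  where "direct_sum A B =
    \<lparr>carrier = carrier A \<times> carrier B, mult = undefined, one = undefined,
     zero = (\<zero>\<^bsub>A\<^esub>, \<zero>\<^bsub>B\<^esub>), add = (\<lambda>(a, b) (a', b'). (a \<oplus>\<^bsub>A\<^esub> a', b \<oplus>\<^bsub>B\<^esub> b')),
     smult = (\<lambda>r (a, b). (r \<odot>\<^bsub>A\<^esub> a, r \<odot>\<^bsub>B\<^esub> b))\<rparr>"

lemma direct_sum_simps [simp]:
  "carrier (direct_sum A B) = carrier A \<times> carrier B"
  "\<zero>\<^bsub>direct_sum A B\<^esub> = (\<zero>\<^bsub>A\<^esub>, \<zero>\<^bsub>B\<^esub>)"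
  "(a, b) \<oplus>\<^bsub>direct_sum A B\<^esub> (a', b') = (a \<oplus>\<^bsub>A\<^esub> a', b \<oplus>\<^bsub>B\<^esub> b')"
  "r \<odot>\<^bsub>direct_sum A B\<^esub> (a, b) = (r \<odot>\<^bsub>A\<^esub> a, r \<odot>\<^bsub>B\<^esub> b)"
  by (simp_all add: direct_sum_def)

lemma direct_sum_module:
  assumes A: "module R A" and B: "module R B"
  shows "module R (direct_sum A B)"
proof -
  interpret A: module R A by fact
  interpret B: module R B by fact
  show ?thesis
  proof (rule moduleI)
    show "cring R" by (rule A.R.is_cring)
    show "abelian_group (direct_sum A B)"
    proof (rule abelian_groupI)
      show "\<exists>q\<in>carrier (direct_sum A B). q \<oplus>\<^bsub>direct_sum A B\<^esub> p = \<zero>\<^bsub>direct_sum A B\<^esub>"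
        if "p \<in> carrier (direct_sum A B)" for p
      proof (rule bexI[of _ "(\<ominus>\<^bsub>A\<^esub> fst p, \<ominus>\<^bsub>B\<^esub> snd p)"])
        show "(\<ominus>\<^bsub>A\<^esub> fst p, \<ominus>\<^bsub>B\<^esub> snd p) \<oplus>\<^bsub>direct_sum A B\<^esub> p = \<zero>\<^bsub>direct_sum A B\<^esub>"
          using that by (cases p) (simp add: A.M.l_neg B.M.l_neg)
        show "(\<ominus>\<^bsub>A\<^esub> fst p, \<ominus>\<^bsub>B\<^esub> snd p) \<in> carrier (direct_sum A B)" using that by auto
      qed
    qed (auto simp: A.M.a_ac B.M.a_ac)
  qed (auto simp: A.smult_l_distr B.smult_l_distr A.smult_r_distr B.smult_r_distr A.smult_assoc1 B.smult_assoc1)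
qed

text \<open>A derivation \<open>Sym(M) \<rightarrow> N\<close> is the same as an algebra morphism into the square-zero extension
  \<open>Sym(M) \<oplus> N\<close> that is the identity in the first component. On \<open>Sym(M) \<oplus> N\<close> the element \<open>x\<close> of
  \<open>M\<close> acts by multiplication with \<open>(x, d x)\<close>; these operators commute, and the derivation is the
  second component of the resulting recursion, started at \<open>(1, 0)\<close>.\<close>

locale sym_derivation = tensor_algebra R M + N: module R N
  for R :: "('r, 'k) ring_scheme" (structure) and M :: "('r, 'm, 'l) module_scheme"
    and N :: "('r, 'n, 'q) module_scheme" +
  fixes act :: "('m list \<Rightarrow> 'r) set set \<Rightarrow> 'n \<Rightarrow> 'n" and d :: "'m \<Rightarrow> 'n"
  assumes sym_comm: "\<lbrakk>a \<in> carrier S; b \<in> carrier S\<rbrakk> \<Longrightarrow> a \<otimes>\<^bsub>S\<^esub> b = b \<otimes>\<^bsub>S\<^esub> a"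
    and act_bilinear: "bilinear_map R S N N act"
    and act_one: "n \<in> carrier N \<Longrightarrow> act \<one>\<^bsub>S\<^esub> n = n"
    and act_mult: "\<lbrakk>a \<in> carrier S; b \<in> carrier S; n \<in> carrier N\<rbrakk> \<Longrightarrow> act (a \<otimes>\<^bsub>S\<^esub> b) n = act a (act b n)"
    and d_linear: "d \<in> linear_maps R M N"
begin

lemmas act_closed = bilinear_mapD(3)[OF act_bilinear]
lemmas act_lin = linear_mapsD(2,3)[OF bilinear_mapD(1)[OF act_bilinear]]
  linear_mapsD(2,3)[OF bilinear_mapD(2)[OF act_bilinear]]
lemmas d_closed = linear_mapsD(1)[OF d_linear]

lemma act_commute:
  "\<lbrakk>a \<in> carrier S; b \<in> carrier S; n \<in> carrier N\<rbrakk> \<Longrightarrow> act a (act b n) = act b (act a n)"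
  using sym_comm act_mult by metis

definition step where "step x p = (j x \<otimes>\<^bsub>S\<^esub> fst p, act (j x) (snd p) \<oplus>\<^bsub>N\<^esub> act (fst p) (d x))"

sublocale D: commuting_action R M "direct_sum S N" step
proof (intro commuting_action.intro talg_action.intro talg_action_axioms.intro commuting_action_axioms.intro
    tensor_algebra_axioms direct_sum_module S.module_axioms N.module_axioms)
  note [simp] = act_closed act_lin d_closed linear_mapsD(2,3)[OF sym_incl_linear] linear_mapsD(2,3)[OF d_linear]
  have sm: "r \<odot>\<^bsub>N\<^esub> n \<oplus>\<^bsub>N\<^esub> r \<odot>\<^bsub>N\<^esub> n' = r \<odot>\<^bsub>N\<^esub> (n \<oplus>\<^bsub>N\<^esub> n')"
    if "r \<in> carrier R" "n \<in> carrier N" "n' \<in> carrier N" for r n n'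
    using that by (simp add: N.smult_r_distr)
  show "bilinear_map R M (direct_sum S N) (direct_sum S N) step"
    by (intro bilinear_mapI linear_mapsI)
      (auto simp: step_def S.l_distr S.r_distr S.smult_mult_left S.smult_mult_right N.M.a_ac sm)
  show "step x (step y p) = step y (step x p)"
    if "x \<in> carrier M" "y \<in> carrier M" "p \<in> carrier (direct_sum S N)" for x y p
  proof -
    have "j x \<otimes>\<^bsub>S\<^esub> (j y \<otimes>\<^bsub>S\<^esub> fst p) = j y \<otimes>\<^bsub>S\<^esub> (j x \<otimes>\<^bsub>S\<^esub> fst p)"
      using that by (metis S.m_assoc sym_comm sym_incl_closed mem_Times_iff direct_sum_simps(1))
    moreover have "act (j x) (act (j y) (snd p)) = act (j y) (act (j x) (snd p))"
      using that by (intro act_commute) auto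
    ultimately show ?thesis
      using that by (auto simp: step_def act_mult N.M.a_ac)
  qed
qed

definition derivation where
  "derivation a = snd (sym_rec R (direct_sum S N) step (\<one>\<^bsub>S\<^esub>, \<zero>\<^bsub>N\<^esub>) a)"

lemma start_closed: "(\<one>\<^bsub>S\<^esub>, \<zero>\<^bsub>N\<^esub>) \<in> carrier (direct_sum S N)" by simp

lemma rec_pair:
  assumes "a \<in> carrier S"
  shows "sym_rec R (direct_sum S N) step (\<one>\<^bsub>S\<^esub>, \<zero>\<^bsub>N\<^esub>) a = (a, derivation a)"
proof -
  note lin = linear_mapsD[OF D.sym_rec_linear[OF start_closed]]
  have "fst (sym_rec R (direct_sum S N) step (\<one>\<^bsub>S\<^esub>, \<zero>\<^bsub>N\<^esub>) a) = a"
    using assms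
  proof (induction a rule: sym_induct)
    case one
    show ?case by (simp add: D.sym_rec_one)
  next
    case (mult x a)
    then show ?case using D.sym_rec_mult[OF start_closed mult(1,2)] by (simp add: step_def[of x])
  next
    case (add a b)
    then show ?case using lin(2)[OF add(1,2)] by (metis direct_sum_simps(3) fst_conv prod.collapse)
  next
    case (smult r a)
    then show ?case using lin(3)[OF smult(1,2)] by (metis direct_sum_simps(4) fst_conv prod.collapse)
  qed
  then show ?thesis by (simp add: derivation_def prod_eq_iff)
qed

lemma derivation_linear: "derivation \<in> linear_maps R S N"
proof -
  note lin = linear_mapsD[OF D.sym_rec_linear[OF start_closed]]
  show ?thesis
  proof (rule linear_mapsI)
    show c: "derivation a \<in> carrier N" if "a \<in> carrier S" for a
      using lin(1)[OF that] by (simp add: rec_pair[OF that])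
    show "derivation (a \<oplus>\<^bsub>S\<^esub> b) = derivation a \<oplus>\<^bsub>N\<^esub> derivation b" if "a \<in> carrier S" "b \<in> carrier S" for a b
      using lin(2)[OF that] that by (simp add: rec_pair)
    show "derivation (r \<odot>\<^bsub>S\<^esub> a) = r \<odot>\<^bsub>N\<^esub> derivation a" if "r \<in> carrier R" "a \<in> carrier S" for r a
      using lin(3)[OF that] that by (simp add: rec_pair)
  qed
qed

lemmas derivation_closed = linear_mapsD(1)[OF derivation_linear]

lemma derivation_one: "derivation \<one>\<^bsub>S\<^esub> = \<zero>\<^bsub>N\<^esub>"
  by (simp add: derivation_def D.sym_rec_one)

lemma derivation_step:
  assumes "x \<in> carrier M" "a \<in> carrier S"
  shows "derivation (j x \<otimes>\<^bsub>S\<^esub> a) = act (j x) (derivation a) \<oplus>\<^bsub>N\<^esub> act a (d x)"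
  using D.sym_rec_mult[OF start_closed assms] assms by (simp add: rec_pair step_def)

lemma derivation_incl:
  assumes x: "x \<in> carrier M"
  shows "derivation (j x) = d x"
  using derivation_step[OF x S.one_closed] x
  by (simp add: derivation_one act_one d_closed linear_maps_zero[OF bilinear_mapD(1)[OF act_bilinear] N.module_axioms N.module_axioms])

lemma derivation_leibniz:
  assumes "a \<in> carrier S" and b: "b \<in> carrier S"
  shows "derivation (a \<otimes>\<^bsub>S\<^esub> b) = act a (derivation b) \<oplus>\<^bsub>N\<^esub> act b (derivation a)"
  using assms(1)
proof (induction a rule: sym_induct)
  note [simp] = derivation_closed act_closed d_closed b
  note act_zero = linear_maps_zero[OF bilinear_mapD(1)[OF act_bilinear] N.module_axioms N.module_axioms]
  {
    case one
    show ?case by (simp add: derivation_one act_one act_zero)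
  next
    case (mult x a)
    have "act (a \<otimes>\<^bsub>S\<^esub> b) (d x) = act b (act a (d x))"
      using mult by (simp add: act_mult act_commute)
    then show ?case
      using mult by (simp add: S.m_assoc derivation_step act_mult act_lin N.M.a_ac act_commute[of b "j x"])
  next
    case (add a c)
    then show ?case
      by (simp add: S.l_distr linear_mapsD(2)[OF derivation_linear] act_lin N.M.a_ac)
  next
    case (smult r a)
    then show ?case
      by (simp add: S.smult_mult_left linear_mapsD(3)[OF derivation_linear] act_lin N.smult_r_distr)
  }
qed

end

section \<open>The comultiplication of the tensor algebra\<close>

text \<open>The algebras \<open>T(M) \<otimes> T(M)\<close> and \<open>Sym(M) # T(M)\<close> are records obtained from a tensor product of
  modules by overwriting the product and the unit, which do not enter into the linear structure.\<close>

lemma linear_maps_upd [simp]: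
  "linear_maps R (A\<lparr>mult := m, one := e\<rparr>) B = linear_maps R A B"
  "linear_maps R A (B\<lparr>mult := m', one := e'\<rparr>) = linear_maps R A B"
  by (simp_all add: linear_maps_def)

lemma module_upd [simp]: "module R (A\<lparr>mult := m, one := e\<rparr>) \<longleftrightarrow> module R A"
  by (simp add: module_def module_axioms_def abelian_group_def abelian_monoid_def abelian_group_axioms_def)

context tensor_product
begin

lemma bilinear_map_cong:
  assumes b: "bilinear_map R M N P b"
    and eq: "\<And>x y. x \<in> carrier M \<Longrightarrow> y \<in> carrier N \<Longrightarrow> b' x y = b x y"
  shows "bilinear_map R M N P b'"
proof (rule bilinear_mapI)
  show "b' x \<in> linear_maps R N P" if "x \<in> carrier M" for x
    by (rule linear_maps_cong[OF bilinear_mapD(1)[OF b that] N.module_axioms]) (simp add: eq that)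
  show "(\<lambda>x. b' x y) \<in> linear_maps R M P" if "y \<in> carrier N" for y
    by (rule linear_maps_cong[OF bilinear_mapD(2)[OF b that] M.module_axioms]) (simp add: eq that)
qed

lemma tensor_lift_bilinear_param:
  assumes P: "module R P" and K: "module R K"
    and b: "\<And>k. k \<in> carrier K \<Longrightarrow> bilinear_map R M N P (b k)"
    and lin: "\<And>x y. x \<in> carrier M \<Longrightarrow> y \<in> carrier N \<Longrightarrow> (\<lambda>k. b k x y) \<in> linear_maps R K P"
  shows "bilinear_map R K (tensor R M N) P (\<lambda>k. tensor_lift R P (b k))"
  by (rule bilinear_mapI[OF tensor_lift(1)[OF P b] tensor_lift_linear_param[OF P K b lin]])

end

context tensor_algebra
begin

abbreviation "TT \<equiv> tensor_alg R T T"

sublocale TT: tensor_product R T T ..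

lemma carrier_TT: "carrier TT = carrier (tensor R T T)" and add_TT: "x \<oplus>\<^bsub>TT\<^esub> y = x \<oplus>\<^bsub>tensor R T T\<^esub> y"
  by (simp_all add: tensor_alg_def)

lemma TT_module: "module R TT"
  by (simp add: tensor_alg_def TT.tensor_module)

lemma TT_mult:
  shows "bilinear_map R TT TT TT (\<lambda>X Y. X \<otimes>\<^bsub>TT\<^esub> Y)"
    and "\<lbrakk>a \<in> carrier T; b \<in> carrier T; a' \<in> carrier T; b' \<in> carrier T\<rbrakk> \<Longrightarrow>
      pure_tensor R T T a b \<otimes>\<^bsub>TT\<^esub> pure_tensor R T T a' b'
        = pure_tensor R T T (a \<otimes>\<^bsub>T\<^esub> a') (b \<otimes>\<^bsub>T\<^esub> b')"
proof -
  let ?P = "tensor R T T"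
  let ?c = "\<lambda>a b a' b'. pure_tensor R T T (a \<otimes>\<^bsub>T\<^esub> a') (b \<otimes>\<^bsub>T\<^esub> b')"
  note pl = TT.pure_closed TT.pure_add_left TT.pure_add_right TT.pure_smult_left TT.pure_smult_right
  have c1: "bilinear_map R T T ?P (?c a b)" if "a \<in> carrier T" "b \<in> carrier T" for a b
    using that by (intro bilinear_mapI linear_mapsI) (simp_all add: pl T.r_distr T.smult_mult_right)
  have c2: "(\<lambda>a. ?c a b a' b') \<in> linear_maps R T ?P" "(\<lambda>b. ?c a b a' b') \<in> linear_maps R T ?P"
    if "a \<in> carrier T" "b \<in> carrier T" "a' \<in> carrier T" "b' \<in> carrier T" for a b a' b'
    using that by (auto intro!: linear_mapsI simp: pl T.l_distr T.smult_mult_left)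
  note mod = TT.tensor_module T.module_axioms
  have c3: "bilinear_map R T T ?P (\<lambda>a b. tensor_lift R ?P (?c a b) Y)" if "Y \<in> carrier ?P" for Y
    by (intro bilinear_mapI TT.tensor_lift_linear_param mod c1 c2 that)
  have mult: "X \<otimes>\<^bsub>TT\<^esub> Y = tensor_lift R ?P (\<lambda>a b. tensor_lift R ?P (?c a b) Y) X" for X Y
    by (simp add: tensor_alg_def)
  have "bilinear_map R ?P ?P ?P (\<lambda>Y X. tensor_lift R ?P (\<lambda>a b. tensor_lift R ?P (?c a b) Y) X)"
    by (rule TT.tensor_lift_bilinear_param[OF mod(1) mod(1) c3 TT.tensor_lift(1)[OF mod(1) c1]])
  then show "bilinear_map R TT TT TT (\<lambda>X Y. X \<otimes>\<^bsub>TT\<^esub> Y)"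
    unfolding mult by (simp add: bilinear_map_def) (simp add: tensor_alg_def)
  show "pure_tensor R T T a b \<otimes>\<^bsub>TT\<^esub> pure_tensor R T T a' b' = ?c a b a' b'"
    if "a \<in> carrier T" "b \<in> carrier T" "a' \<in> carrier T" "b' \<in> carrier T"
    using that unfolding mult
    by (simp add: TT.tensor_lift(2)[OF mod(1) c3] TT.tensor_lift(2)[OF mod(1) c1] TT.pure_closed)
qed

text \<open>The element \<open>\<Delta>(x) = 1 \<otimes> x + x \<otimes> 1\<close>. Multiplication by it from the left is a linear family of
  operators on \<open>T(M) \<otimes> T(M)\<close>, so \<open>\<Delta>\<close> is an instance of the recursion on \<open>T(M)\<close>.\<close>

definition "primitive x = pure_tensor R T T \<one>\<^bsub>T\<^esub> (i x) \<oplus>\<^bsub>TT\<^esub> pure_tensor R T T (i x) \<one>\<^bsub>T\<^esub>"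

sublocale comult: talg_action R M TT "\<lambda>x z. primitive x \<otimes>\<^bsub>TT\<^esub> z"
proof (intro talg_action.intro talg_action_axioms.intro tensor_algebra_axioms TT_module)
  interpret TTm: module R TT by (rule TT_module)
  have p: "primitive \<in> linear_maps R M TT"
    unfolding primitive_def[abs_def]
  proof (intro linear_maps_add TT_module)
    have "(\<lambda>x. pure_tensor R T T \<one>\<^bsub>T\<^esub> (i x)) \<in> linear_maps R M (tensor R T T)"
      by (rule linear_maps_compose[OF incl_linear bilinear_mapD(1)[OF TT.pure_tensor_bilinear]]) simp
    then show "(\<lambda>x. pure_tensor R T T \<one>\<^bsub>T\<^esub> (i x)) \<in> linear_maps R M TT" by (simp add: tensor_alg_def)
    have "(\<lambda>x. pure_tensor R T T (i x) \<one>\<^bsub>T\<^esub>) \<in> linear_maps R M (tensor R T T)"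
      by (rule linear_maps_compose[OF incl_linear bilinear_mapD(2)[OF TT.pure_tensor_bilinear]]) simp
    then show "(\<lambda>x. pure_tensor R T T (i x) \<one>\<^bsub>T\<^esub>) \<in> linear_maps R M TT" by (simp add: tensor_alg_def)
  qed
  show "bilinear_map R M TT TT (\<lambda>x z. primitive x \<otimes>\<^bsub>TT\<^esub> z)"
    using linear_maps_compose[OF p bilinear_mapD(2)[OF TT_mult(1)]]
      bilinear_mapD(1)[OF TT_mult(1) linear_mapsD(1)[OF p]]
    by (rule_tac bilinear_mapI) auto
qed

lemma talg_comult_eq:
  "talg_comult R M = talg_rec R TT (\<lambda>x z. primitive x \<otimes>\<^bsub>TT\<^esub> z) \<one>\<^bsub>TT\<^esub>"
  by (simp add: talg_comult_def talg_rec_def[abs_def] primitive_def Let_def)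

lemma one_TT: "\<one>\<^bsub>TT\<^esub> = pure_tensor R T T \<one>\<^bsub>T\<^esub> \<one>\<^bsub>T\<^esub>" "\<one>\<^bsub>TT\<^esub> \<in> carrier TT"
  by (simp_all add: tensor_alg_def TT.pure_closed)

lemma primitive_mult:
  assumes "x \<in> carrier M" "u \<in> carrier T" "v \<in> carrier T"
  shows "primitive x \<otimes>\<^bsub>TT\<^esub> pure_tensor R T T u v
    = pure_tensor R T T u (i x \<otimes>\<^bsub>T\<^esub> v) \<oplus>\<^bsub>TT\<^esub> pure_tensor R T T (i x \<otimes>\<^bsub>T\<^esub> u) v"
  using assms unfolding primitive_def
  by (simp add: linear_mapsD(2)[OF bilinear_mapD(2)[OF TT_mult(1)]] carrier_TT TT.pure_closed TT_mult(2))

lemmas comult_linear = comult.rec_linear[OF one_TT(2), folded talg_comult_eq]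
lemmas comult_one = comult.rec_one[OF one_TT(2), folded talg_comult_eq]
lemmas comult_mult = comult.rec_mult[OF one_TT(2), folded talg_comult_eq]

end

section \<open>The smash product of the symmetric with the tensor algebra\<close>

locale poisson_sym = tensor_algebra R M + P: poisson_algebra R "sym_alg R M" br
  for R :: "('r, 'k) ring_scheme" (structure) and M :: "('r, 'm, 'l) module_scheme"
    and br :: "('m list \<Rightarrow> 'r) set set \<Rightarrow> ('m list \<Rightarrow> 'r) set set \<Rightarrow> ('m list \<Rightarrow> 'r) set set"
begin

lemma br_bilinear: "bilinear_map R S S S br"
  by (rule bilinear_mapI[OF P.bracket_linear_right P.bracket_linear_left])

lemmas br_closed [simp] = bilinear_mapD(3)[OF br_bilinear]
lemmas br_add_left = linear_mapsD(2)[OF bilinear_mapD(2)[OF br_bilinear]]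
lemmas br_add_right = linear_mapsD(2)[OF bilinear_mapD(1)[OF br_bilinear]]
lemmas br_smult_left = linear_mapsD(3)[OF bilinear_mapD(2)[OF br_bilinear]]
lemmas br_smult_right = linear_mapsD(3)[OF bilinear_mapD(1)[OF br_bilinear]]

lemma br_anti:
  assumes "a \<in> carrier S" "b \<in> carrier S"
  shows "br a b = \<ominus>\<^bsub>S\<^esub> br b a"
proof -
  have "\<zero>\<^bsub>S\<^esub> = br (a \<oplus>\<^bsub>S\<^esub> b) (a \<oplus>\<^bsub>S\<^esub> b)" using assms P.bracket_self by simp
  also have "\<dots> = br a a \<oplus>\<^bsub>S\<^esub> br b a \<oplus>\<^bsub>S\<^esub> (br a b \<oplus>\<^bsub>S\<^esub> br b b)"
    using assms by (simp add: br_add_left br_add_right)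
  also have "\<dots> = br a b \<oplus>\<^bsub>S\<^esub> br b a" using assms by (simp add: P.bracket_self S.M.a_comm)
  finally have "br a b \<oplus>\<^bsub>S\<^esub> br b a = \<zero>\<^bsub>S\<^esub>" by simp
  then show ?thesis using assms by (simp add: S.M.minus_equality)
qed

lemma sym_comm: "\<lbrakk>a \<in> carrier S; b \<in> carrier S\<rbrakk> \<Longrightarrow> a \<otimes>\<^bsub>S\<^esub> b = b \<otimes>\<^bsub>S\<^esub> a"
  using cring.cring_simprules(14)[OF P.M_cring] .

lemma br_mult_right:
  assumes "a \<in> carrier S" "b \<in> carrier S" "c \<in> carrier S"
  shows "br a (b \<otimes>\<^bsub>S\<^esub> c) = b \<otimes>\<^bsub>S\<^esub> br a c \<oplus>\<^bsub>S\<^esub> br a b \<otimes>\<^bsub>S\<^esub> c"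
proof -
  have "br a (b \<otimes>\<^bsub>S\<^esub> c) = \<ominus>\<^bsub>S\<^esub> br (b \<otimes>\<^bsub>S\<^esub> c) a" using assms by (intro br_anti) auto
  also have "\<dots> = \<ominus>\<^bsub>S\<^esub> (b \<otimes>\<^bsub>S\<^esub> br c a \<oplus>\<^bsub>S\<^esub> c \<otimes>\<^bsub>S\<^esub> br b a)" using assms by (simp add: P.leibniz)
  also have "\<dots> = b \<otimes>\<^bsub>S\<^esub> (\<ominus>\<^bsub>S\<^esub> br c a) \<oplus>\<^bsub>S\<^esub> (\<ominus>\<^bsub>S\<^esub> br b a) \<otimes>\<^bsub>S\<^esub> c"
    using assms by (simp add: S.minus_add S.r_minus S.l_minus sym_comm[of c])
  also have "\<dots> = b \<otimes>\<^bsub>S\<^esub> br a c \<oplus>\<^bsub>S\<^esub> br a b \<otimes>\<^bsub>S\<^esub> c" using assms br_anti[of a] by simp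
  finally show ?thesis .
qed

lemma br_one_right:
  assumes a: "a \<in> carrier S"
  shows "br a \<one>\<^bsub>S\<^esub> = \<zero>\<^bsub>S\<^esub>"
proof -
  have "br a \<one>\<^bsub>S\<^esub> \<oplus>\<^bsub>S\<^esub> br a \<one>\<^bsub>S\<^esub> = br a \<one>\<^bsub>S\<^esub>"
    using br_mult_right[OF a S.one_closed S.one_closed] a by simp
  then show ?thesis using a by (simp add: S.M.add.r_cancel_one)
qed

sublocale A: talg_action R M S "\<lambda>x b. br (j x) b"
proof (intro talg_action.intro talg_action_axioms.intro tensor_algebra_axioms S.module_axioms)
  show "bilinear_map R M S S (\<lambda>x b. br (j x) b)"
    using linear_maps_compose[OF sym_incl_linear bilinear_mapD(2)[OF br_bilinear]]
      bilinear_mapD(1)[OF br_bilinear linear_mapsD(1)[OF sym_incl_linear]]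
    by (rule_tac bilinear_mapI) auto
qed

lemma poisson_act_eq: "poisson_act R M br u a = talg_rec R S (\<lambda>x b. br (j x) b) a u"
  by (simp add: poisson_act_def talg_rec_def)

abbreviation "AH \<equiv> tensor R S T"

sublocale AH: tensor_product R S T ..

abbreviation "sm \<equiv> smash_act R S T"

lemma sm_bilinear: "bilinear_map R S AH AH sm"
  and sm_pure: "\<lbrakk>a \<in> carrier S; b \<in> carrier S; u \<in> carrier T\<rbrakk>
    \<Longrightarrow> sm a (sharp R M b u) = sharp R M (a \<otimes>\<^bsub>S\<^esub> b) u"
proof -
  note pl = AH.pure_closed AH.pure_add_left AH.pure_add_right AH.pure_smult_left AH.pure_smult_right
  have b: "bilinear_map R S T AH (\<lambda>b u. sharp R M (a \<otimes>\<^bsub>S\<^esub> b) u)" if "a \<in> carrier S" for a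
    using that by (intro bilinear_mapI linear_mapsI) (simp_all add: pl S.r_distr S.smult_mult_right)
  have eq: "smash_act R S T = (\<lambda>a. tensor_lift R AH (\<lambda>b u. sharp R M (a \<otimes>\<^bsub>S\<^esub> b) u))"
    by (simp add: fun_eq_iff smash_act_def)
  show "bilinear_map R S AH AH sm" unfolding eq
    by (rule AH.tensor_lift_bilinear_param[OF AH.tensor_module S.module_axioms b], assumption)
      (intro linear_mapsI; simp add: pl S.l_distr S.smult_mult_left)
  show "\<lbrakk>a \<in> carrier S; b \<in> carrier S; u \<in> carrier T\<rbrakk>
    \<Longrightarrow> sm a (sharp R M b u) = sharp R M (a \<otimes>\<^bsub>S\<^esub> b) u"
    unfolding eq by (simp add: AH.tensor_lift(2)[OF AH.tensor_module b])
qed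

lemmas sm_closed [simp] = bilinear_mapD(3)[OF sm_bilinear]
lemmas sm_lin = bilinear_mapD(1)[OF sm_bilinear]
lemmas sm_add_right = linear_mapsD(2)[OF bilinear_mapD(1)[OF sm_bilinear]]

lemma sm_one: "s \<in> carrier AH \<Longrightarrow> sm \<one>\<^bsub>S\<^esub> s = s"
  by (rule AH.tensor_linear_eq[OF sm_lin, where g = "\<lambda>s. s"]) (simp_all add: sm_pure linear_maps_def)

lemma sm_mult:
  assumes "a \<in> carrier S" "b \<in> carrier S" "s \<in> carrier AH"
  shows "sm (a \<otimes>\<^bsub>S\<^esub> b) s = sm a (sm b s)"
  by (rule AH.tensor_linear_eq[OF sm_lin linear_maps_compose[OF sm_lin sm_lin] _ assms(3)])
    (use assms in \<open>simp_all add: sm_pure S.m_assoc\<close>)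

text \<open>Left multiplication by \<open>1 # x\<close> in the smash product. It is introduced as an operator of its own
  because the product of the smash product is analysed in terms of it.\<close>

definition gen_act where
  "gen_act x = tensor_lift R AH (\<lambda>b v. sharp R M (br (j x) b) v \<oplus>\<^bsub>AH\<^esub> sharp R M b (i x \<otimes>\<^bsub>T\<^esub> v))"

lemma gen_act_bilinear: "bilinear_map R M AH AH gen_act"
  and gen_act_pure: "\<lbrakk>x \<in> carrier M; b \<in> carrier S; v \<in> carrier T\<rbrakk> \<Longrightarrow>
    gen_act x (sharp R M b v) = sharp R M (br (j x) b) v \<oplus>\<^bsub>AH\<^esub> sharp R M b (i x \<otimes>\<^bsub>T\<^esub> v)"
proof -
  note pl = AH.pure_closed AH.pure_add_left AH.pure_add_right AH.pure_smult_left AH.pure_smult_right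
  note il = linear_mapsD(2,3)[OF sym_incl_linear] linear_mapsD(2,3)[OF incl_linear]
  let ?b = "\<lambda>x b v. sharp R M (br (j x) b) v \<oplus>\<^bsub>AH\<^esub> sharp R M b (i x \<otimes>\<^bsub>T\<^esub> v)"
  have b: "bilinear_map R S T AH (?b x)" if x: "x \<in> carrier M" for x
    using x by (intro bilinear_mapI linear_maps_add AH.tensor_module linear_mapsI)
      (simp_all add: pl br_add_right br_smult_right T.r_distr T.smult_mult_right)
  have x: "(\<lambda>x. ?b x b v) \<in> linear_maps R M AH" if "b \<in> carrier S" "v \<in> carrier T" for b v
    using that by (intro linear_maps_add AH.tensor_module linear_mapsI)
      (simp_all add: pl br_add_left br_smult_left T.l_distr T.smult_mult_left il)
  have eq: "gen_act = (\<lambda>x. tensor_lift R AH (?b x))" by (simp add: fun_eq_iff gen_act_def)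
  show "bilinear_map R M AH AH gen_act" unfolding eq
    by (rule AH.tensor_lift_bilinear_param[OF AH.tensor_module M.module_axioms b x])
  show "\<lbrakk>x \<in> carrier M; b \<in> carrier S; v \<in> carrier T\<rbrakk> \<Longrightarrow> gen_act x (sharp R M b v) = ?b x b v"
    unfolding eq by (simp add: AH.tensor_lift(2)[OF AH.tensor_module b])
qed

sublocale E: talg_action R M AH gen_act
  by (intro talg_action.intro talg_action_axioms.intro tensor_algebra_axioms AH.tensor_module gen_act_bilinear)

lemmas gen_act_lin = bilinear_mapD(1)[OF gen_act_bilinear]
lemmas gen_act_closed [simp] = bilinear_mapD(3)[OF gen_act_bilinear]

text \<open>The resulting action of \<open>T(M)\<close>, which is left multiplication by \<open>1 # u\<close>.\<close>

definition talg_act where "talg_act u s = talg_rec R AH gen_act s u"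

lemma talg_act_bilinear: "bilinear_map R T AH AH talg_act"
  unfolding talg_act_def[abs_def] by (rule bilinear_mapI[OF E.rec_param_linear E.rec_linear])

lemmas talg_act_lin = bilinear_mapD(1)[OF talg_act_bilinear]
lemmas talg_act_closed [simp] = bilinear_mapD(3)[OF talg_act_bilinear]

lemma talg_act_one: "s \<in> carrier AH \<Longrightarrow> talg_act \<one>\<^bsub>T\<^esub> s = s"
  by (simp add: talg_act_def E.rec_one)

lemma talg_act_mult: "\<lbrakk>x \<in> carrier M; u \<in> carrier T; s \<in> carrier AH\<rbrakk> \<Longrightarrow> talg_act (i x \<otimes>\<^bsub>T\<^esub> u) s = gen_act x (talg_act u s)"
  by (simp add: talg_act_def E.rec_mult)

text \<open>The Sweedler sum \<open>a\<^sub>1(u\<^sub>(\<^sub>1\<^sub>) \<cdot> a\<^sub>2) # u\<^sub>(\<^sub>2\<^sub>)v\<close> is an iterated left multiplication. Indeed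
  \<open>\<Delta>(xu) = (1 \<otimes> x + x \<otimes> 1) \<Delta>(u)\<close>, and replacing \<open>Z\<close> by \<open>(1 \<otimes> x + x \<otimes> 1) Z\<close> in such a sum over \<open>Z\<close>
  amounts to applying \<open>gen_act x\<close> to it (for \<open>a\<^sub>1 = 1\<close>); so both sides obey the same recursion in \<open>u\<close>.\<close>

lemma smash_sweedler:
  assumes a1: "a1 \<in> carrier S" and u: "u \<in> carrier T" and a2: "a2 \<in> carrier S" and v: "v \<in> carrier T"
  shows "tensor_lift R AH (\<lambda>u1 u2. sharp R M (a1 \<otimes>\<^bsub>S\<^esub> poisson_act R M br u1 a2) (u2 \<otimes>\<^bsub>T\<^esub> v)) (talg_comult R M u)
    = sm a1 (talg_act u (sharp R M a2 v))"
proof -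
  note pl = AH.pure_closed AH.pure_add_left AH.pure_add_right AH.pure_smult_left AH.pure_smult_right
  let ?b = "\<lambda>u1 u2. sharp R M (poisson_act R M br u1 a2) (u2 \<otimes>\<^bsub>T\<^esub> v)"
  let ?c = "\<lambda>u1 u2. sharp R M (a1 \<otimes>\<^bsub>S\<^esub> poisson_act R M br u1 a2) (u2 \<otimes>\<^bsub>T\<^esub> v)"
  let ?\<Delta> = "talg_comult R M"
  note al = linear_mapsD[OF A.rec_linear[OF a2]]
  note AHm = AH.tensor_module
  have pc: "poisson_act R M br u a2 \<in> carrier S" if "u \<in> carrier T" for u
    using al(1)[OF that] by (simp add: poisson_act_eq)
  have pc1: "poisson_act R M br \<one>\<^bsub>T\<^esub> a2 = a2"
    using A.rec_one[OF a2] by (simp add: poisson_act_eq)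
  have b: "bilinear_map R T T AH ?b"
    using v by (intro bilinear_mapI linear_mapsI) (simp_all add: poisson_act_eq al pl T.l_distr T.smult_mult_left)
  have c: "bilinear_map R T T AH ?c"
    using v a1 by (intro bilinear_mapI linear_mapsI)
      (simp_all add: poisson_act_eq al pl T.l_distr T.smult_mult_left S.r_distr S.smult_mult_right)
  note bl = TT.tensor_lift[OF AHm b] and cl = TT.tensor_lift[OF AHm c]
  have \<Delta>: "?\<Delta> \<in> linear_maps R T (tensor R T T)" using comult_linear by (simp add: tensor_alg_def)
  note \<Delta>c = linear_mapsD(1)[OF \<Delta>]
  have "tensor_lift R AH ?c X = sm a1 (tensor_lift R AH ?b X)" if "X \<in> carrier (tensor R T T)" for X
    by (rule TT.tensor_linear_eq[OF cl(1) linear_maps_compose[OF bl(1) sm_lin[OF a1]] _ that])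
      (use a1 v in \<open>simp add: bl(2) cl(2) sm_pure pc\<close>)
  then have "tensor_lift R AH ?c (?\<Delta> u) = sm a1 (tensor_lift R AH ?b (?\<Delta> u))" using \<Delta>c[OF u] by simp
  also have "tensor_lift R AH ?b (?\<Delta> u) = talg_act u (sharp R M a2 v)"
  proof (rule talg_linear_eq[OF linear_maps_compose[OF \<Delta> bl(1)] bilinear_mapD(2)[OF talg_act_bilinear] _ _ u])
    show av: "sharp R M a2 v \<in> carrier AH" using a2 v by (simp add: pl)
    show "tensor_lift R AH ?b (?\<Delta> \<one>\<^bsub>T\<^esub>) = talg_act \<one>\<^bsub>T\<^esub> (sharp R M a2 v)"
      using a2 v av by (simp add: comult_one one_TT(1) bl(2) pc1 talg_act_one)
    fix x t assume x: "x \<in> carrier M" and t: "t \<in> carrier T"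
      and IH: "tensor_lift R AH ?b (?\<Delta> t) = talg_act t (sharp R M a2 v)"
    have step: "tensor_lift R AH ?b (primitive x \<otimes>\<^bsub>TT\<^esub> Z) = gen_act x (tensor_lift R AH ?b Z)"
      if Z: "Z \<in> carrier (tensor R T T)" for Z
    proof (rule TT.tensor_linear_eq[OF linear_maps_compose[OF _ bl(1)] linear_maps_compose[OF bl(1) gen_act_lin[OF x]] _ Z])
      show "(\<lambda>z. primitive x \<otimes>\<^bsub>TT\<^esub> z) \<in> linear_maps R (tensor R T T) (tensor R T T)"
        using bilinear_mapD(1)[OF comult.bil x] by (simp add: tensor_alg_def)
      fix u1 u2 assume u12: "u1 \<in> carrier T" "u2 \<in> carrier T"
      then have "tensor_lift R AH ?b (primitive x \<otimes>\<^bsub>TT\<^esub> pure_tensor R T T u1 u2)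
          = ?b u1 (i x \<otimes>\<^bsub>T\<^esub> u2) \<oplus>\<^bsub>AH\<^esub> ?b (i x \<otimes>\<^bsub>T\<^esub> u1) u2"
        using x by (simp add: primitive_mult add_TT linear_mapsD(2)[OF bl(1)] TT.pure_closed bl(2))
      also have "\<dots> = gen_act x (?b u1 u2)"
        using x u12 v a2
        by (simp add: gen_act_pure poisson_act_eq al(1) A.rec_mult T.m_assoc pl AH.T.M.a_comm)
      finally show "tensor_lift R AH ?b (primitive x \<otimes>\<^bsub>TT\<^esub> pure_tensor R T T u1 u2)
          = gen_act x (tensor_lift R AH ?b (pure_tensor R T T u1 u2))" using u12 by (simp add: bl(2))
    qed
    show "tensor_lift R AH ?b (?\<Delta> (i x \<otimes>\<^bsub>T\<^esub> t)) = talg_act (i x \<otimes>\<^bsub>T\<^esub> t) (sharp R M a2 v)"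
      using x t av by (simp add: comult_mult step \<Delta>c IH talg_act_mult)
  qed
  finally show ?thesis .
qed

abbreviation "B \<equiv> sym_smash R M br"

lemma B_simps [simp]:
  "carrier B = carrier AH" "\<zero>\<^bsub>B\<^esub> = \<zero>\<^bsub>AH\<^esub>" "x \<oplus>\<^bsub>B\<^esub> y = x \<oplus>\<^bsub>AH\<^esub> y" "r \<odot>\<^bsub>B\<^esub> x = r \<odot>\<^bsub>AH\<^esub> x"
  "\<one>\<^bsub>B\<^esub> = sharp R M \<one>\<^bsub>S\<^esub> \<one>\<^bsub>T\<^esub>"
  by (simp_all add: sym_smash_def smash_def Let_def)

lemma B_linear [simp]: "linear_maps R X B = linear_maps R X AH" "linear_maps R B X = linear_maps R AH X"
  by (simp_all add: sym_smash_def smash_def Let_def)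

lemma B_module: "module R B"
  by (simp add: sym_smash_def smash_def Let_def AH.tensor_module)

lemma smash_mult_bilinear:
  "Y \<in> carrier AH \<Longrightarrow> bilinear_map R S T AH (\<lambda>a u. sm a (talg_act u Y))"
  by (intro bilinear_mapI linear_maps_compose[OF bilinear_mapD(2)[OF talg_act_bilinear] sm_lin]
      bilinear_mapD(2)[OF sm_bilinear]) simp_all

text \<open>The product of the smash product in closed form: \<open>a # x\<^sub>1 \<otimes> \<dots> \<otimes> x\<^sub>k\<close> acts from the left by
  \<open>gen_act x\<^sub>k\<close>, \<open>\<dots>\<close>, \<open>gen_act x\<^sub>1\<close> and then by \<open>a\<close>. This replaces the nested lifts and the
  comultiplication in everything that follows.\<close>

lemma B_mult:
  assumes Y: "Y \<in> carrier AH"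
  shows "(\<lambda>X. X \<otimes>\<^bsub>B\<^esub> Y) \<in> linear_maps R AH AH"
    and "\<lbrakk>a \<in> carrier S; u \<in> carrier T\<rbrakk> \<Longrightarrow> sharp R M a u \<otimes>\<^bsub>B\<^esub> Y = sm a (talg_act u Y)"
proof -
  let ?c = "\<lambda>a1 u a2 v. tensor_lift R AH (\<lambda>u1 u2. sharp R M (a1 \<otimes>\<^bsub>S\<^esub> poisson_act R M br u1 a2) (u2 \<otimes>\<^bsub>T\<^esub> v)) (talg_comult R M u)"
  note AHm = AH.tensor_module
  have mult: "X \<otimes>\<^bsub>B\<^esub> Y = tensor_lift R AH (\<lambda>a1 u. tensor_lift R AH (?c a1 u) Y) X" for X
    by (simp add: sym_smash_def smash_def Let_def)
  have inner: "tensor_lift R AH (?c a1 u) Y = sm a1 (talg_act u Y)" if au: "a1 \<in> carrier S" "u \<in> carrier T" for a1 u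
  proof -
    have lin: "(\<lambda>Y. sm a1 (talg_act u Y)) \<in> linear_maps R AH AH"
      by (rule linear_maps_compose[OF talg_act_lin[OF au(2)] sm_lin[OF au(1)]])
    have "bilinear_map R S T AH (\<lambda>a2 v. sm a1 (talg_act u (sharp R M a2 v)))"
      by (intro bilinear_mapI linear_maps_compose[OF _ lin] bilinear_mapD[OF AH.pure_tensor_bilinear])
    then have c: "bilinear_map R S T AH (?c a1 u)"
      by (rule AH.bilinear_map_cong) (rule smash_sweedler[OF au])
    show ?thesis
      by (rule AH.tensor_linear_eq[OF AH.tensor_lift(1)[OF AHm c] lin _ Y])
        (simp add: AH.tensor_lift(2)[OF AHm c] smash_sweedler[OF au])
  qed
  have "bilinear_map R S T AH (\<lambda>a1 u. tensor_lift R AH (?c a1 u) Y)"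
    by (rule AH.bilinear_map_cong[OF smash_mult_bilinear[OF Y]]) (rule inner)
  note * = AH.tensor_lift[OF AHm this]
  show "(\<lambda>X. X \<otimes>\<^bsub>B\<^esub> Y) \<in> linear_maps R AH AH" unfolding mult using *(1) by simp
  show "\<lbrakk>a \<in> carrier S; u \<in> carrier T\<rbrakk> \<Longrightarrow> sharp R M a u \<otimes>\<^bsub>B\<^esub> Y = sm a (talg_act u Y)"
    unfolding mult by (simp add: *(2) inner)
qed

lemma B_closed: "X \<in> carrier AH \<Longrightarrow> Y \<in> carrier AH \<Longrightarrow> X \<otimes>\<^bsub>B\<^esub> Y \<in> carrier AH"
  using linear_mapsD(1)[OF B_mult(1)] .

lemma B_mult_right_linear:
  assumes X: "X \<in> carrier AH"
  shows "(\<lambda>Y. X \<otimes>\<^bsub>B\<^esub> Y) \<in> linear_maps R AH AH"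
  using X
proof (induction X rule: AH.tensor_induct)
  case (pure a u)
  show ?case
    by (rule linear_maps_cong[OF linear_maps_compose[OF talg_act_lin[OF pure(2)] sm_lin[OF pure(1)]] AH.tensor_module])
      (simp add: B_mult(2) pure)
next
  case (add X X')
  show ?case
    by (rule linear_maps_cong[OF linear_maps_add[OF add(3,4) AH.tensor_module] AH.tensor_module])
      (simp add: linear_mapsD(2)[OF B_mult(1)] add(1,2))
qed

text \<open>The commutation relation \<open>x b = {x, b} + b x\<close> in the smash product, which expresses that
  \<open>{x, -}\<close> is a derivation of \<open>Sym(M)\<close>. It is what makes the smash product associative: right
  multiplication by \<open>Z\<close> then commutes with \<open>gen_act x\<close>, besides commuting with the action of \<open>Sym(M)\<close>,
  hence with all left multiplications.\<close>

lemma gen_act_sm: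
  assumes x: "x \<in> carrier M" and b: "b \<in> carrier S" and s: "s \<in> carrier AH"
  shows "gen_act x (sm b s) = sm (br (j x) b) s \<oplus>\<^bsub>AH\<^esub> sm b (gen_act x s)"
proof (rule AH.tensor_linear_eq[OF linear_maps_compose[OF sm_lin[OF b] gen_act_lin[OF x]]
      linear_maps_add[OF sm_lin linear_maps_compose[OF gen_act_lin[OF x] sm_lin[OF b]] AH.tensor_module] _ s])
  show "br (j x) b \<in> carrier S" using x b by simp
  fix c v assume c: "c \<in> carrier S" and v: "v \<in> carrier T"
  note pl = AH.pure_closed AH.pure_add_left
  show "gen_act x (sm b (sharp R M c v)) = sm (br (j x) b) (sharp R M c v) \<oplus>\<^bsub>AH\<^esub> sm b (gen_act x (sharp R M c v))"
    using x b c v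
    by (simp add: sm_pure gen_act_pure pl br_mult_right sm_add_right AH.T.M.a_ac)
qed

lemma sm_B_mult:
  assumes a: "a \<in> carrier S" and Y: "Y \<in> carrier AH" and Z: "Z \<in> carrier AH"
  shows "sm a Y \<otimes>\<^bsub>B\<^esub> Z = sm a (Y \<otimes>\<^bsub>B\<^esub> Z)"
  by (rule AH.tensor_linear_eq[OF linear_maps_compose[OF sm_lin[OF a] B_mult(1)[OF Z]]
        linear_maps_compose[OF B_mult(1)[OF Z] sm_lin[OF a]] _ Y])
    (simp add: a Z sm_pure B_mult(2) sm_mult)

lemma gen_act_B_mult:
  assumes x: "x \<in> carrier M" and Y: "Y \<in> carrier AH" and Z: "Z \<in> carrier AH"
  shows "gen_act x Y \<otimes>\<^bsub>B\<^esub> Z = gen_act x (Y \<otimes>\<^bsub>B\<^esub> Z)"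
proof (rule AH.tensor_linear_eq[OF linear_maps_compose[OF gen_act_lin[OF x] B_mult(1)[OF Z]]
        linear_maps_compose[OF B_mult(1)[OF Z] gen_act_lin[OF x]] _ Y])
  fix b v assume b: "b \<in> carrier S" and v: "v \<in> carrier T"
  have "gen_act x (sharp R M b v) \<otimes>\<^bsub>B\<^esub> Z = sm (br (j x) b) (talg_act v Z) \<oplus>\<^bsub>AH\<^esub> sm b (gen_act x (talg_act v Z))"
    using x b v Z by (simp add: gen_act_pure linear_mapsD(2)[OF B_mult(1)] AH.pure_closed B_mult(2) talg_act_mult)
  also have "\<dots> = gen_act x (sharp R M b v \<otimes>\<^bsub>B\<^esub> Z)"
    using x b v Z by (simp add: B_mult(2) gen_act_sm)
  finally show "gen_act x (sharp R M b v) \<otimes>\<^bsub>B\<^esub> Z = gen_act x (sharp R M b v \<otimes>\<^bsub>B\<^esub> Z)" .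
qed

lemma talg_act_B_mult:
  assumes u: "u \<in> carrier T" and Y: "Y \<in> carrier AH" and Z: "Z \<in> carrier AH"
  shows "talg_act u Y \<otimes>\<^bsub>B\<^esub> Z = talg_act u (Y \<otimes>\<^bsub>B\<^esub> Z)"
  by (rule talg_linear_eq[OF linear_maps_compose[OF bilinear_mapD(2)[OF talg_act_bilinear Y] B_mult(1)[OF Z]]
        bilinear_mapD(2)[OF talg_act_bilinear B_closed[OF Y Z]] _ _ u])
    (simp_all add: Y Z talg_act_one B_closed talg_act_mult gen_act_B_mult)

lemma talg_act_unit: "u \<in> carrier T \<Longrightarrow> talg_act u (sharp R M \<one>\<^bsub>S\<^esub> \<one>\<^bsub>T\<^esub>) = sharp R M \<one>\<^bsub>S\<^esub> u"
proof (rule talg_linear_eq[OF bilinear_mapD(2)[OF talg_act_bilinear] bilinear_mapD(1)[OF AH.pure_tensor_bilinear]])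
  show c: "sharp R M \<one>\<^bsub>S\<^esub> \<one>\<^bsub>T\<^esub> \<in> carrier AH" by (simp add: AH.pure_closed)
  show "talg_act \<one>\<^bsub>T\<^esub> (sharp R M \<one>\<^bsub>S\<^esub> \<one>\<^bsub>T\<^esub>) = sharp R M \<one>\<^bsub>S\<^esub> \<one>\<^bsub>T\<^esub>" by (simp add: talg_act_one c)
  fix x t assume x: "x \<in> carrier M" and t: "t \<in> carrier T" and IH: "talg_act t (sharp R M \<one>\<^bsub>S\<^esub> \<one>\<^bsub>T\<^esub>) = sharp R M \<one>\<^bsub>S\<^esub> t"
  have "sharp R M \<zero>\<^bsub>S\<^esub> t = \<zero>\<^bsub>AH\<^esub>"
    by (rule linear_maps_zero[OF bilinear_mapD(2)[OF AH.pure_tensor_bilinear t] S.module_axioms AH.tensor_module])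
  then show "talg_act (i x \<otimes>\<^bsub>T\<^esub> t) (sharp R M \<one>\<^bsub>S\<^esub> \<one>\<^bsub>T\<^esub>) = sharp R M \<one>\<^bsub>S\<^esub> (i x \<otimes>\<^bsub>T\<^esub> t)"
    using x t c by (simp add: talg_act_mult IH gen_act_pure br_one_right AH.pure_closed)
qed simp_all

lemma B_assoc_algebra: "assoc_algebra R B"
proof -
  interpret B: module R B by (rule B_module)
  have one: "sharp R M \<one>\<^bsub>S\<^esub> \<one>\<^bsub>T\<^esub> \<in> carrier AH" by (simp add: AH.pure_closed)
  have assoc: "(X \<otimes>\<^bsub>B\<^esub> Y) \<otimes>\<^bsub>B\<^esub> Z = X \<otimes>\<^bsub>B\<^esub> (Y \<otimes>\<^bsub>B\<^esub> Z)"
    if X: "X \<in> carrier AH" and Y: "Y \<in> carrier AH" and Z: "Z \<in> carrier AH" for X Y Z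
    by (rule AH.tensor_linear_eq[OF linear_maps_compose[OF B_mult(1)[OF Y] B_mult(1)[OF Z]] B_mult(1)[OF B_closed[OF Y Z]] _ X])
      (simp add: B_mult(2) Y Z B_closed sm_B_mult talg_act_B_mult)
  have l_one: "sharp R M \<one>\<^bsub>S\<^esub> \<one>\<^bsub>T\<^esub> \<otimes>\<^bsub>B\<^esub> X = X" if "X \<in> carrier AH" for X
    using that by (simp add: B_mult(2) talg_act_one sm_one)
  have r_one: "X \<otimes>\<^bsub>B\<^esub> sharp R M \<one>\<^bsub>S\<^esub> \<one>\<^bsub>T\<^esub> = X" if X: "X \<in> carrier AH" for X
    by (rule AH.tensor_linear_eq[OF B_mult(1)[OF one] _ _ X, where g = "\<lambda>X. X"])
      (simp_all add: linear_maps_def B_mult(2) one talg_act_unit sm_pure)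
  have "ring B"
  proof (rule ringI)
    show "abelian_group B" by (rule B.abelian_group_axioms)
    show "monoid B" by (rule monoidI) (simp_all add: B_closed assoc l_one r_one one)
  qed (simp_all add: linear_mapsD[OF B_mult(1)] linear_mapsD[OF B_mult_right_linear])
  then show ?thesis
    by (simp add: assoc_algebra_def assoc_algebra_axioms_def B_module linear_mapsD[OF B_mult(1)] linear_mapsD[OF B_mult_right_linear])
qed

end

section \<open>The Poisson enveloping algebra\<close>

context poisson_sym
begin

sublocale B: assoc_algebra R B by (rule B_assoc_algebra)

lemma sm_eq_mult: "\<lbrakk>a \<in> carrier S; s \<in> carrier AH\<rbrakk> \<Longrightarrow> sharp R M a \<one>\<^bsub>T\<^esub> \<otimes>\<^bsub>B\<^esub> s = sm a s"
  by (simp add: B_mult(2) talg_act_one)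

lemma gen_act_eq_mult: "\<lbrakk>x \<in> carrier M; s \<in> carrier AH\<rbrakk> \<Longrightarrow> sharp R M \<one>\<^bsub>S\<^esub> (i x) \<otimes>\<^bsub>B\<^esub> s = gen_act x s"
  using talg_act_mult[of x "\<one>\<^bsub>T\<^esub>" s] by (simp add: B_mult(2) talg_act_one sm_one)

lemma iota_linear: "(\<lambda>a. sharp R M a \<one>\<^bsub>T\<^esub>) \<in> linear_maps R S AH"
  by (rule bilinear_mapD(2)[OF AH.pure_tensor_bilinear]) simp

lemma iota_hom: "(\<lambda>a. sharp R M a \<one>\<^bsub>T\<^esub>) \<in> algebra_hom R S B"
  by (rule algebra_homI) (simp_all add: iota_linear sm_eq_mult sm_pure AH.pure_closed)

sublocale psi: sym_derivation R M AH sm "\<lambda>x. sharp R M \<one>\<^bsub>S\<^esub> (i x)"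
proof (intro sym_derivation.intro sym_derivation_axioms.intro tensor_algebra_axioms AH.tensor_module
    sm_bilinear sym_comm sm_one sm_mult)
  show "(\<lambda>x. sharp R M \<one>\<^bsub>S\<^esub> (i x)) \<in> linear_maps R M AH"
    by (rule linear_maps_compose[OF incl_linear bilinear_mapD(1)[OF AH.pure_tensor_bilinear]]) simp
qed

text \<open>A derivation satisfies \<open>\<psi>(1) = \<psi>(1) + \<psi>(1)\<close>, so it vanishes at \<open>1\<close> and is determined by its
  values on \<open>M\<close>.\<close>

lemma is_psi_unique:
  assumes f: "is_psi R M br f" and g: "is_psi R M br g" and a: "a \<in> carrier S"
  shows "f a = g a"
proof -
  have lin: "h \<in> linear_maps R S AH"
    and leib: "\<And>a b. \<lbrakk>a \<in> carrier S; b \<in> carrier S\<rbrakk> \<Longrightarrow> h (a \<otimes>\<^bsub>S\<^esub> b) = sm a (h b) \<oplus>\<^bsub>AH\<^esub> sm b (h a)"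
    and inc: "\<And>x. x \<in> carrier M \<Longrightarrow> h (j x) = sharp R M \<one>\<^bsub>S\<^esub> (i x)"
    if "is_psi R M br h" for h
    using that by (simp_all add: is_psi_def Let_def)
  have one: "h \<one>\<^bsub>S\<^esub> = \<zero>\<^bsub>AH\<^esub>" if "is_psi R M br h" for h
  proof -
    have c: "h \<one>\<^bsub>S\<^esub> \<in> carrier AH" using linear_mapsD(1)[OF lin[OF that]] by simp
    then have "h \<one>\<^bsub>S\<^esub> \<oplus>\<^bsub>AH\<^esub> h \<one>\<^bsub>S\<^esub> = h \<one>\<^bsub>S\<^esub>"
      using leib[OF that, of "\<one>\<^bsub>S\<^esub>" "\<one>\<^bsub>S\<^esub>"] by (simp add: sm_one)
    then show ?thesis using c by (simp add: AH.T.M.add.r_cancel_one)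
  qed
  show ?thesis using a
    by (induction a rule: sym_induct)
      (simp_all add: one f g leib[OF f] leib[OF g] inc[OF f] inc[OF g] linear_mapsD(2,3)[OF lin[OF f]] linear_mapsD(2,3)[OF lin[OF g]])
qed

lemma psi_eq: "psi R M br = restrict psi.derivation (carrier S)"
  unfolding psi_def
proof (rule the_equality)
  have "is_psi R M br (restrict psi.derivation (carrier S))"
    unfolding is_psi_def Let_def
    using linear_maps_cong[OF psi.derivation_linear S.module_axioms, of "restrict psi.derivation (carrier S)"]
    by (simp add: psi.derivation_leibniz psi.derivation_incl)
  then show *: "restrict psi.derivation (carrier S) \<in> extensional (carrier S) \<and>
      is_psi R M br (restrict psi.derivation (carrier S))" by simp
  show "f = restrict psi.derivation (carrier S)" if "f \<in> extensional (carrier S) \<and> is_psi R M br f" for f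
    using that * is_psi_unique by (intro extensionalityI[of _ "carrier S"]) blast+
qed

abbreviation "\<psi> \<equiv> psi R M br"

lemma psi_linear: "\<psi> \<in> linear_maps R S AH"
  by (rule linear_maps_cong[OF psi.derivation_linear S.module_axioms]) (simp add: psi_eq)

lemmas psi_closed [simp] = linear_mapsD(1)[OF psi_linear]

lemma psi_leibniz: "\<lbrakk>a \<in> carrier S; b \<in> carrier S\<rbrakk> \<Longrightarrow> \<psi> (a \<otimes>\<^bsub>S\<^esub> b) = sm a (\<psi> b) \<oplus>\<^bsub>AH\<^esub> sm b (\<psi> a)"
  by (simp add: psi_eq psi.derivation_leibniz)

lemma psi_incl: "x \<in> carrier M \<Longrightarrow> \<psi> (j x) = sharp R M \<one>\<^bsub>S\<^esub> (i x)"
  by (simp add: psi_eq psi.derivation_incl)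

lemma psi_one: "\<psi> \<one>\<^bsub>S\<^esub> = \<zero>\<^bsub>AH\<^esub>"
  by (simp add: psi_eq psi.derivation_one)

definition "J_rels = {sharp R M \<one>\<^bsub>S\<^esub> (i x \<otimes>\<^bsub>T\<^esub> i y \<ominus>\<^bsub>T\<^esub> i y \<otimes>\<^bsub>T\<^esub> i x) \<ominus>\<^bsub>B\<^esub> \<psi> (br (j x) (j y)) | x y.
          x \<in> carrier M \<and> y \<in> carrier M}"

lemma J_eq: "J_ideal R M br = genideal B J_rels"
  by (simp add: J_ideal_def J_rels_def Let_def)

lemma J_rels_closed: "J_rels \<subseteq> carrier B"
proof -
  have "sharp R M \<one>\<^bsub>S\<^esub> (i x \<otimes>\<^bsub>T\<^esub> i y \<ominus>\<^bsub>T\<^esub> i y \<otimes>\<^bsub>T\<^esub> i x) \<ominus>\<^bsub>B\<^esub> \<psi> (br (j x) (j y)) \<in> carrier B"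
    if "x \<in> carrier M" "y \<in> carrier M" for x y
    using that by (intro abelian_group.minus_closed[OF module.axioms(2)[OF B_module]]) (simp_all add: AH.pure_closed T.M.minus_closed)
  then show ?thesis unfolding J_rels_def by blast
qed

sublocale J: ideal_quotient R B "J_ideal R M br"
  unfolding J_eq
  by (intro ideal_quotient.intro ideal_quotient_axioms.intro B.assoc_algebra_axioms
      B.genideal_ideal J_rels_closed)

abbreviation "U \<equiv> quot_alg (sym_smash R M br) (J_ideal R M br)"
abbreviation "\<pi> \<equiv> J_proj R M br"

lemma pi_hom: "\<pi> \<in> algebra_hom R B U"
  unfolding J_proj_def[abs_def] by (rule J.proj_algebra_hom)

lemma pi_surj: "X \<in> carrier U \<Longrightarrow> \<exists>s\<in>carrier AH. X = \<pi> s"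
  by (auto simp: quot_alg_simps(1) J_proj_def)

end

section \<open>Checking the identities on generators\<close>

text \<open>The common setting for the two maps into the quotient and for maps into a test algebra:
  \<open>\<beta>\<close> is a derivation along \<open>\<alpha>\<close>, while nothing is said about brackets.\<close>

locale hom_derivation_pair = poisson_sym R M br + V: assoc_algebra R V
  for R :: "('r, 'k) ring_scheme" (structure) and M :: "('r, 'm, 'l) module_scheme"
    and br :: "('m list \<Rightarrow> 'r) set set \<Rightarrow> ('m list \<Rightarrow> 'r) set set \<Rightarrow> ('m list \<Rightarrow> 'r) set set"
    and V :: "('r, 'v, 'n) module_scheme" +
  fixes \<alpha> \<beta> :: "('m list \<Rightarrow> 'r) set set \<Rightarrow> 'v"
  assumes \<alpha>_hom: "\<alpha> \<in> algebra_hom R S V"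
    and \<beta>_linear: "\<beta> \<in> linear_maps R S V"
    and \<beta>_mult: "\<lbrakk>a \<in> carrier S; b \<in> carrier S\<rbrakk> \<Longrightarrow> \<beta> (a \<otimes>\<^bsub>S\<^esub> b) = \<alpha> a \<otimes>\<^bsub>V\<^esub> \<beta> b \<oplus>\<^bsub>V\<^esub> \<alpha> b \<otimes>\<^bsub>V\<^esub> \<beta> a"
begin

lemmas \<alpha>_lin = linear_mapsD[OF algebra_homD(1)[OF \<alpha>_hom]]
lemmas \<alpha>_mult = algebra_homD(2)[OF \<alpha>_hom]
lemmas \<alpha>_one = algebra_homD(3)[OF \<alpha>_hom]
lemmas \<beta>_lin = linear_mapsD[OF \<beta>_linear]
lemmas [simp] = \<alpha>_lin(1) \<beta>_lin(1)
lemmas Vmod = V.module_axioms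

lemma zeros: "\<alpha> \<zero>\<^bsub>S\<^esub> = \<zero>\<^bsub>V\<^esub>" "\<beta> \<zero>\<^bsub>S\<^esub> = \<zero>\<^bsub>V\<^esub>"
  by (rule linear_maps_zero[OF algebra_homD(1)[OF \<alpha>_hom] S.module_axioms V.module_axioms],
      rule linear_maps_zero[OF \<beta>_linear S.module_axioms V.module_axioms])

lemma \<beta>_one: "\<beta> \<one>\<^bsub>S\<^esub> = \<zero>\<^bsub>V\<^esub>"
proof -
  have "\<beta> \<one>\<^bsub>S\<^esub> \<oplus>\<^bsub>V\<^esub> \<beta> \<one>\<^bsub>S\<^esub> = \<beta> \<one>\<^bsub>S\<^esub>"
    using \<beta>_mult[of "\<one>\<^bsub>S\<^esub>" "\<one>\<^bsub>S\<^esub>"] by (simp add: algebra_homD(3)[OF \<alpha>_hom])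
  then show ?thesis by (simp add: V.M.add.r_cancel_one)
qed

lemma \<alpha>_anti:
  assumes "a \<in> carrier S" "b \<in> carrier S"
  shows "\<alpha> (br a b) = \<ominus>\<^bsub>V\<^esub> \<alpha> (br b a)"
proof -
  have "\<alpha> (br a b) \<oplus>\<^bsub>V\<^esub> \<alpha> (br b a) = \<alpha> (br a b \<oplus>\<^bsub>S\<^esub> br b a)" using assms by (simp add: \<alpha>_lin(2))
  also have "br a b \<oplus>\<^bsub>S\<^esub> br b a = \<zero>\<^bsub>S\<^esub>" using assms br_anti[of a b] by (simp add: S.M.l_neg)
  finally have "\<alpha> (br a b) \<oplus>\<^bsub>V\<^esub> \<alpha> (br b a) = \<zero>\<^bsub>V\<^esub>" by (simp add: zeros)
  then show ?thesis using assms by (simp add: V.M.minus_equality)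
qed

end

text \<open>For a derivation \<open>\<beta>\<close> along \<open>\<alpha>\<close>, both identities for brackets compare expressions that obey
  the same product rule in each argument of \<open>\<beta>\<close>, and therefore follow from the instances in which \<open>\<beta>\<close>
  is applied to elements of \<open>M\<close>. The identity for \<open>\<alpha>\<close> is used in the form
  \<open>\<beta>(b)\<alpha>(a) = \<alpha>({b, a}) + \<alpha>(a)\<beta>(b)\<close>, which agrees with the defining one by antisymmetry of the
  bracket.\<close>

locale enveloping_on_generators = hom_derivation_pair +
  assumes \<beta>_\<alpha>_gen: "\<lbrakk>x \<in> carrier M; a \<in> carrier S\<rbrakk> \<Longrightarrow>
      \<beta> (j x) \<otimes>\<^bsub>V\<^esub> \<alpha> a = \<alpha> (br (j x) a) \<oplus>\<^bsub>V\<^esub> \<alpha> a \<otimes>\<^bsub>V\<^esub> \<beta> (j x)"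
    and \<beta>_\<beta>_gen: "\<lbrakk>x \<in> carrier M; y \<in> carrier M\<rbrakk> \<Longrightarrow>
      \<beta> (j x) \<otimes>\<^bsub>V\<^esub> \<beta> (j y) = \<beta> (br (j x) (j y)) \<oplus>\<^bsub>V\<^esub> \<beta> (j y) \<otimes>\<^bsub>V\<^esub> \<beta> (j x)"
begin

lemma br_one_left: "a \<in> carrier S \<Longrightarrow> br \<one>\<^bsub>S\<^esub> a = \<zero>\<^bsub>S\<^esub>"
  using br_anti[of "\<one>\<^bsub>S\<^esub>" a] by (simp add: br_one_right)

lemma \<alpha>_comm: "\<lbrakk>a \<in> carrier S; b \<in> carrier S\<rbrakk> \<Longrightarrow> \<alpha> a \<otimes>\<^bsub>V\<^esub> \<alpha> b = \<alpha> b \<otimes>\<^bsub>V\<^esub> \<alpha> a"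
  by (metis \<alpha>_mult sym_comm)

lemma \<beta>_\<alpha>:
  assumes b: "b \<in> carrier S" and a: "a \<in> carrier S"
  shows "\<beta> b \<otimes>\<^bsub>V\<^esub> \<alpha> a = \<alpha> (br b a) \<oplus>\<^bsub>V\<^esub> \<alpha> a \<otimes>\<^bsub>V\<^esub> \<beta> b"
  using b
proof (induction b rule: sym_induct)
  case one
  show ?case using a by (simp add: \<beta>_one br_one_left zeros)
next
  case (mult x b)
  have comm: "\<alpha> (j x) \<otimes>\<^bsub>V\<^esub> \<alpha> a = \<alpha> a \<otimes>\<^bsub>V\<^esub> \<alpha> (j x)" "\<alpha> b \<otimes>\<^bsub>V\<^esub> \<alpha> a = \<alpha> a \<otimes>\<^bsub>V\<^esub> \<alpha> b"
    using mult(1,2) a by (simp_all add: \<alpha>_comm)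
  have "\<beta> (j x \<otimes>\<^bsub>S\<^esub> b) \<otimes>\<^bsub>V\<^esub> \<alpha> a
      = \<alpha> (j x) \<otimes>\<^bsub>V\<^esub> (\<beta> b \<otimes>\<^bsub>V\<^esub> \<alpha> a) \<oplus>\<^bsub>V\<^esub> \<alpha> b \<otimes>\<^bsub>V\<^esub> (\<beta> (j x) \<otimes>\<^bsub>V\<^esub> \<alpha> a)"
    using mult a by (simp add: \<beta>_mult V.l_distr V.m_assoc)
  also have "\<dots> = (\<alpha> (j x) \<otimes>\<^bsub>V\<^esub> \<alpha> (br b a) \<oplus>\<^bsub>V\<^esub> \<alpha> b \<otimes>\<^bsub>V\<^esub> \<alpha> (br (j x) a)) \<oplus>\<^bsub>V\<^esub>
      ((\<alpha> (j x) \<otimes>\<^bsub>V\<^esub> \<alpha> a) \<otimes>\<^bsub>V\<^esub> \<beta> b \<oplus>\<^bsub>V\<^esub> (\<alpha> b \<otimes>\<^bsub>V\<^esub> \<alpha> a) \<otimes>\<^bsub>V\<^esub> \<beta> (j x))"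
    unfolding mult(3) \<beta>_\<alpha>_gen[OF mult(1) a]
    using mult(1,2) a by (simp add: V.r_distr V.m_assoc V.M.a_ac)
  also have "\<dots> = \<alpha> (br (j x \<otimes>\<^bsub>S\<^esub> b) a) \<oplus>\<^bsub>V\<^esub> \<alpha> a \<otimes>\<^bsub>V\<^esub> \<beta> (j x \<otimes>\<^bsub>S\<^esub> b)"
    unfolding comm using mult(1,2) a
    by (simp add: P.leibniz \<alpha>_lin(2) \<alpha>_mult \<beta>_mult V.r_distr V.m_assoc)
  finally show ?case .
next
  case (add b c)
  then show ?case using a
    by (simp add: \<beta>_lin(2) \<alpha>_lin(2) br_add_left V.l_distr V.r_distr V.M.a_ac)
next
  case (smult r b)
  then show ?case using a
    by (simp add: \<beta>_lin(3) \<alpha>_lin(3) br_smult_left V.smult_mult_left V.smult_mult_right V.smult_r_distr)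
qed

lemma eq_diffI: "\<lbrakk>p \<in> carrier V; q \<in> carrier V; r = p \<oplus>\<^bsub>V\<^esub> q\<rbrakk> \<Longrightarrow> p = r \<ominus>\<^bsub>V\<^esub> q"
  by (simp add: a_minus_def V.M.a_assoc V.M.r_neg)

definition "brackets_agree a b \<longleftrightarrow> \<beta> a \<otimes>\<^bsub>V\<^esub> \<beta> b = \<beta> (br a b) \<oplus>\<^bsub>V\<^esub> \<beta> b \<otimes>\<^bsub>V\<^esub> \<beta> a"

lemma brackets_agree_sym:
  assumes a: "a \<in> carrier S" and b: "b \<in> carrier S" and agree: "brackets_agree a b"
  shows "brackets_agree b a"
proof -
  have "\<beta> (br b a) \<oplus>\<^bsub>V\<^esub> \<beta> (br a b) = \<beta> (br b a \<oplus>\<^bsub>S\<^esub> br a b)" using a b by (simp add: \<beta>_lin(2))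
  also have "br b a \<oplus>\<^bsub>S\<^esub> br a b = \<zero>\<^bsub>S\<^esub>" using a b br_anti[of b a] by (simp add: S.M.l_neg)
  finally have "\<beta> (br b a) \<oplus>\<^bsub>V\<^esub> \<beta> (br a b) = \<zero>\<^bsub>V\<^esub>" by (simp add: zeros)
  then have "\<beta> (br b a) \<oplus>\<^bsub>V\<^esub> (\<beta> (br a b) \<oplus>\<^bsub>V\<^esub> \<beta> b \<otimes>\<^bsub>V\<^esub> \<beta> a) = \<beta> b \<otimes>\<^bsub>V\<^esub> \<beta> a"
    using a b by (simp add: V.M.a_assoc[symmetric])
  then show ?thesis using agree unfolding brackets_agree_def by simp
qed

lemma brackets_agree_mult:
  assumes a: "a \<in> carrier S" and b: "b \<in> carrier S" and c: "c \<in> carrier S"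
    and ab: "brackets_agree a b" and ac: "brackets_agree a c"
  shows "brackets_agree a (b \<otimes>\<^bsub>S\<^esub> c)"
proof -
  note [simp] = a b c
  have "\<beta> a \<otimes>\<^bsub>V\<^esub> \<beta> (b \<otimes>\<^bsub>S\<^esub> c) = (\<beta> a \<otimes>\<^bsub>V\<^esub> \<alpha> b) \<otimes>\<^bsub>V\<^esub> \<beta> c \<oplus>\<^bsub>V\<^esub> (\<beta> a \<otimes>\<^bsub>V\<^esub> \<alpha> c) \<otimes>\<^bsub>V\<^esub> \<beta> b"
    by (simp add: \<beta>_mult V.r_distr V.m_assoc)
  also have "\<dots> = (\<alpha> (br a b) \<otimes>\<^bsub>V\<^esub> \<beta> c \<oplus>\<^bsub>V\<^esub> \<alpha> (br a c) \<otimes>\<^bsub>V\<^esub> \<beta> b) \<oplus>\<^bsub>V\<^esub>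
      (\<alpha> b \<otimes>\<^bsub>V\<^esub> (\<beta> a \<otimes>\<^bsub>V\<^esub> \<beta> c) \<oplus>\<^bsub>V\<^esub> \<alpha> c \<otimes>\<^bsub>V\<^esub> (\<beta> a \<otimes>\<^bsub>V\<^esub> \<beta> b))"
    by (simp add: \<beta>_\<alpha> V.l_distr V.m_assoc V.M.a_ac)
  also have "\<dots> = (\<alpha> (br a b) \<otimes>\<^bsub>V\<^esub> \<beta> c \<oplus>\<^bsub>V\<^esub> \<alpha> (br a c) \<otimes>\<^bsub>V\<^esub> \<beta> b) \<oplus>\<^bsub>V\<^esub>
      ((\<alpha> b \<otimes>\<^bsub>V\<^esub> \<beta> (br a c) \<oplus>\<^bsub>V\<^esub> \<alpha> c \<otimes>\<^bsub>V\<^esub> \<beta> (br a b)) \<oplus>\<^bsub>V\<^esub>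
       (\<alpha> b \<otimes>\<^bsub>V\<^esub> \<beta> c \<oplus>\<^bsub>V\<^esub> \<alpha> c \<otimes>\<^bsub>V\<^esub> \<beta> b) \<otimes>\<^bsub>V\<^esub> \<beta> a)"
    using ab ac unfolding brackets_agree_def by (simp add: V.l_distr V.r_distr V.m_assoc V.M.a_ac)
  also have "\<dots> = \<beta> (br a (b \<otimes>\<^bsub>S\<^esub> c)) \<oplus>\<^bsub>V\<^esub> \<beta> (b \<otimes>\<^bsub>S\<^esub> c) \<otimes>\<^bsub>V\<^esub> \<beta> a"
    by (simp add: br_mult_right \<beta>_lin(2) \<beta>_mult V.M.a_ac)
  finally show ?thesis unfolding brackets_agree_def .
qed

text \<open>By symmetry this induction in the second argument is used twice: first to get from \<open>M \<times> M\<close> to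
  \<open>M \<times> Sym(M)\<close>, then from \<open>Sym(M) \<times> M\<close> to \<open>Sym(M) \<times> Sym(M)\<close>.\<close>

lemma brackets_agree_from_gen:
  assumes a: "a \<in> carrier S" and gen: "\<And>x. x \<in> carrier M \<Longrightarrow> brackets_agree a (j x)" and b: "b \<in> carrier S"
  shows "brackets_agree a b"
  using b
proof (induction b rule: sym_induct)
  case one
  show ?case unfolding brackets_agree_def using a by (simp add: \<beta>_one br_one_right zeros)
next
  case (mult x b)
  then show ?case using brackets_agree_mult[OF a _ mult(2) gen[OF mult(1)] mult(3)] by simp
next
  case (add b c)
  then show ?case using a unfolding brackets_agree_def
    by (simp add: \<beta>_lin(2) br_add_right V.l_distr V.r_distr V.M.a_ac)
next
  case (smult r b)
  then show ?case using a unfolding brackets_agree_def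
    by (simp add: \<beta>_lin(3) br_smult_right V.smult_mult_left V.smult_mult_right V.smult_r_distr)
qed

lemma brackets_agree_all:
  assumes a: "a \<in> carrier S" and b: "b \<in> carrier S"
  shows "brackets_agree a b"
proof (rule brackets_agree_from_gen[OF a _ b])
  fix x assume x: "x \<in> carrier M"
  have "brackets_agree (j x) (j y)" if "y \<in> carrier M" for y
    unfolding brackets_agree_def by (rule \<beta>_\<beta>_gen[OF x that])
  then have "brackets_agree (j x) a" by (rule brackets_agree_from_gen[OF sym_incl_closed[OF x] _ a])
  then show "brackets_agree a (j x)" by (rule brackets_agree_sym[OF sym_incl_closed[OF x] a])
qed

lemma poisson_triple: "poisson_triple R S br V \<alpha> \<beta>"
  unfolding poisson_triple_def
proof (intro conjI ballI V.assoc_algebra_axioms \<alpha>_hom \<beta>_linear)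
  fix a b assume ab: "a \<in> carrier S" "b \<in> carrier S"
  then show "\<beta> (a \<otimes>\<^bsub>S\<^esub> b) = \<alpha> a \<otimes>\<^bsub>V\<^esub> \<beta> b \<oplus>\<^bsub>V\<^esub> \<alpha> b \<otimes>\<^bsub>V\<^esub> \<beta> a" by (rule \<beta>_mult)
  show "\<beta> (br a b) = \<beta> a \<otimes>\<^bsub>V\<^esub> \<beta> b \<ominus>\<^bsub>V\<^esub> \<beta> b \<otimes>\<^bsub>V\<^esub> \<beta> a"
    using brackets_agree_all[OF ab] ab by (intro eq_diffI) (auto simp: brackets_agree_def)
  have "\<alpha> (br a b) \<oplus>\<^bsub>V\<^esub> \<alpha> (br b a) = \<zero>\<^bsub>V\<^esub>"
    using ab by (simp add: \<alpha>_anti[of a b] V.M.l_neg)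
  then have "\<alpha> a \<otimes>\<^bsub>V\<^esub> \<beta> b = \<alpha> (br a b) \<oplus>\<^bsub>V\<^esub> \<beta> b \<otimes>\<^bsub>V\<^esub> \<alpha> a"
    using ab \<beta>_\<alpha>[of b a] by (simp add: V.M.a_assoc[symmetric])
  then show "\<alpha> (br a b) = \<alpha> a \<otimes>\<^bsub>V\<^esub> \<beta> b \<ominus>\<^bsub>V\<^esub> \<beta> b \<otimes>\<^bsub>V\<^esub> \<alpha> a"
    using ab by (intro eq_diffI) auto
qed

end

context poisson_sym
begin

text \<open>In the quotient, the first identity on generators is the commutation relation of the smash
  product, and the second one is the relation that \<open>J\<close> imposes.\<close>

lemma quotient_triple:
  "poisson_triple R S br U (\<lambda>a. \<pi> (sharp R M a \<one>\<^bsub>T\<^esub>)) (\<lambda>a. \<pi> (\<psi> a))"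
proof -
  interpret Um: assoc_algebra R U by (rule J.quot_assoc_algebra)
  note pl = algebra_homD(1)[OF pi_hom, simplified]
  note pm = algebra_homD(2)[OF pi_hom, simplified]
  note iota = AH.pure_closed T.one_closed S.one_closed
  interpret enveloping_on_generators R M br U "\<lambda>a. \<pi> (sharp R M a \<one>\<^bsub>T\<^esub>)" "\<lambda>a. \<pi> (\<psi> a)"
  proof (intro enveloping_on_generators.intro hom_derivation_pair.intro
      hom_derivation_pair_axioms.intro enveloping_on_generators_axioms.intro poisson_sym_axioms Um.assoc_algebra_axioms)
    show "(\<lambda>a. \<pi> (sharp R M a \<one>\<^bsub>T\<^esub>)) \<in> algebra_hom R S U"
      using algebra_homD[OF iota_hom] algebra_homD(3)[OF pi_hom]
      by (intro algebra_homI linear_maps_compose[OF iota_linear pl]) (simp_all add: pm iota)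
    show "(\<lambda>a. \<pi> (\<psi> a)) \<in> linear_maps R S U"
      by (rule linear_maps_compose[OF psi_linear pl])
    show "\<pi> (\<psi> (a \<otimes>\<^bsub>S\<^esub> b)) = \<pi> (sharp R M a \<one>\<^bsub>T\<^esub>) \<otimes>\<^bsub>U\<^esub> \<pi> (\<psi> b) \<oplus>\<^bsub>U\<^esub> \<pi> (sharp R M b \<one>\<^bsub>T\<^esub>) \<otimes>\<^bsub>U\<^esub> \<pi> (\<psi> a)"
      if "a \<in> carrier S" "b \<in> carrier S" for a b
      using that by (simp add: psi_leibniz linear_mapsD(2)[OF pl] pm[symmetric] sm_eq_mult iota)
    show "\<pi> (\<psi> (j x)) \<otimes>\<^bsub>U\<^esub> \<pi> (sharp R M a \<one>\<^bsub>T\<^esub>)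
        = \<pi> (sharp R M (br (j x) a) \<one>\<^bsub>T\<^esub>) \<oplus>\<^bsub>U\<^esub> \<pi> (sharp R M a \<one>\<^bsub>T\<^esub>) \<otimes>\<^bsub>U\<^esub> \<pi> (\<psi> (j x))"
      if "x \<in> carrier M" "a \<in> carrier S" for x a
      using that
      by (simp add: psi_incl linear_mapsD(2)[OF pl, symmetric] pm[symmetric] sm_eq_mult gen_act_eq_mult gen_act_pure sm_pure iota B_closed)
    show "\<pi> (\<psi> (j x)) \<otimes>\<^bsub>U\<^esub> \<pi> (\<psi> (j y))
        = \<pi> (\<psi> (br (j x) (j y))) \<oplus>\<^bsub>U\<^esub> \<pi> (\<psi> (j y)) \<otimes>\<^bsub>U\<^esub> \<pi> (\<psi> (j x))"
      if xy: "x \<in> carrier M" "y \<in> carrier M" for x y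
    proof -
      let ?u = "i x \<otimes>\<^bsub>T\<^esub> i y" and ?v = "i y \<otimes>\<^bsub>T\<^esub> i x" and ?p = "\<psi> (br (j x) (j y))"
      note sharp_lin = bilinear_mapD(1)[OF AH.pure_tensor_bilinear S.one_closed]
      have prod: "sharp R M \<one>\<^bsub>S\<^esub> (i x) \<otimes>\<^bsub>B\<^esub> sharp R M \<one>\<^bsub>S\<^esub> (i y) = sharp R M \<one>\<^bsub>S\<^esub> (i x \<otimes>\<^bsub>T\<^esub> i y)"
        if "x \<in> carrier M" "y \<in> carrier M" for x y
        using that linear_maps_zero[OF bilinear_mapD(2)[OF AH.pure_tensor_bilinear, of "i y"] S.module_axioms AH.tensor_module]
        by (simp add: gen_act_eq_mult gen_act_pure br_one_right iota)
      have c: "sharp R M \<one>\<^bsub>S\<^esub> ?u \<in> carrier AH" "sharp R M \<one>\<^bsub>S\<^esub> ?v \<in> carrier AH" "?p \<in> carrier AH"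
        using xy by (simp_all add: AH.pure_closed)
      have "sharp R M \<one>\<^bsub>S\<^esub> (?u \<ominus>\<^bsub>T\<^esub> ?v) \<ominus>\<^bsub>B\<^esub> ?p \<in> J_ideal R M br"
        using xy genideal_superset[of J_rels B] unfolding J_eq J_rels_def by blast
      then have "\<pi> (sharp R M \<one>\<^bsub>S\<^esub> (?u \<ominus>\<^bsub>T\<^esub> ?v)) = \<pi> ?p"
        unfolding J_proj_def using xy
        by (intro J.proj_cong) (simp_all add: AH.pure_closed T.M.minus_closed)
      moreover have "sharp R M \<one>\<^bsub>S\<^esub> (?u \<ominus>\<^bsub>T\<^esub> ?v) = sharp R M \<one>\<^bsub>S\<^esub> ?u \<ominus>\<^bsub>AH\<^esub> sharp R M \<one>\<^bsub>S\<^esub> ?v"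
        using xy by (intro linear_maps_minus[OF sharp_lin T.module_axioms AH.tensor_module]) auto
      ultimately have "\<pi> ?p = \<pi> (sharp R M \<one>\<^bsub>S\<^esub> ?u) \<ominus>\<^bsub>U\<^esub> \<pi> (sharp R M \<one>\<^bsub>S\<^esub> ?v)"
        using linear_maps_minus[OF pl AH.tensor_module Um.module_axioms c(1,2)] by simp
      then have "\<pi> ?p \<oplus>\<^bsub>U\<^esub> \<pi> (sharp R M \<one>\<^bsub>S\<^esub> ?v) = \<pi> (sharp R M \<one>\<^bsub>S\<^esub> ?u)"
        using linear_mapsD(1)[OF pl] c by (simp add: a_minus_def Um.M.a_assoc Um.M.l_neg)
      then show ?thesis using xy by (simp add: psi_incl pm[symmetric] prod iota)
    qed
  qed
  show ?thesis by (rule poisson_triple)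
qed

end

section \<open>Morphisms to a test algebra\<close>

locale poisson_target = poisson_sym R M br
  for R :: "('r, 'k) ring_scheme" (structure) and M :: "('r, 'm, 'l) module_scheme"
    and br :: "('m list \<Rightarrow> 'r) set set \<Rightarrow> ('m list \<Rightarrow> 'r) set set \<Rightarrow> ('m list \<Rightarrow> 'r) set set" +
  fixes V :: "('r, 'v, 'n) module_scheme" and \<alpha> \<beta> :: "('m list \<Rightarrow> 'r) set set \<Rightarrow> 'v"
  assumes triple: "poisson_triple R S br V \<alpha> \<beta>"
begin

sublocale hom_derivation_pair R M br V \<alpha> \<beta>
  using triple
  by (intro hom_derivation_pair.intro hom_derivation_pair_axioms.intro poisson_sym_axioms)
    (simp_all add: poisson_triple_def)

lemma \<beta>_br: "\<lbrakk>a \<in> carrier S; b \<in> carrier S\<rbrakk> \<Longrightarrow> \<beta> (br a b) = \<beta> a \<otimes>\<^bsub>V\<^esub> \<beta> b \<ominus>\<^bsub>V\<^esub> \<beta> b \<otimes>\<^bsub>V\<^esub> \<beta> a"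
  and \<alpha>_br: "\<lbrakk>a \<in> carrier S; b \<in> carrier S\<rbrakk> \<Longrightarrow> \<alpha> (br a b) = \<alpha> a \<otimes>\<^bsub>V\<^esub> \<beta> b \<ominus>\<^bsub>V\<^esub> \<beta> b \<otimes>\<^bsub>V\<^esub> \<alpha> a"
  using triple by (simp_all add: poisson_triple_def)

lemma \<beta>_\<alpha>:
  assumes "a \<in> carrier S" "b \<in> carrier S"
  shows "\<beta> a \<otimes>\<^bsub>V\<^esub> \<alpha> b = \<alpha> (br a b) \<oplus>\<^bsub>V\<^esub> \<alpha> b \<otimes>\<^bsub>V\<^esub> \<beta> a"
proof -
  have "\<alpha> (br a b) = \<ominus>\<^bsub>V\<^esub> \<alpha> (br b a)" using assms by (rule \<alpha>_anti)
  also have "\<dots> = \<beta> a \<otimes>\<^bsub>V\<^esub> \<alpha> b \<oplus>\<^bsub>V\<^esub> \<ominus>\<^bsub>V\<^esub> (\<alpha> b \<otimes>\<^bsub>V\<^esub> \<beta> a)"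
    using assms by (simp add: \<alpha>_br[of b a] a_minus_def V.M.minus_add V.M.a_comm)
  finally show ?thesis using assms by (simp add: V.M.a_assoc V.M.l_neg)
qed

sublocale rec: talg_action R M V "\<lambda>x z. \<beta> (j x) \<otimes>\<^bsub>V\<^esub> z"
proof (intro talg_action.intro talg_action_axioms.intro tensor_algebra_axioms Vmod)
  note b = V.bilinear_mult and lin = linear_maps_compose[OF sym_incl_linear \<beta>_linear]
  show "bilinear_map R M V V (\<lambda>x z. \<beta> (j x) \<otimes>\<^bsub>V\<^esub> z)"
    using linear_maps_compose[OF lin bilinear_mapD(2)[OF b]] bilinear_mapD(1)[OF b linear_mapsD(1)[OF lin]]
    by (rule_tac bilinear_mapI) auto
qed

text \<open>The algebra morphism \<open>T(M) \<rightarrow> V\<close> that extends \<open>\<beta>\<close> on \<open>M\<close>, and the map \<open>a # u \<mapsto> \<alpha>(a) \<theta>(u)\<close> on the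
  smash product.\<close>

definition "\<theta> = talg_rec R V (\<lambda>x z. \<beta> (j x) \<otimes>\<^bsub>V\<^esub> z) \<one>\<^bsub>V\<^esub>"

lemma \<theta>_linear: "\<theta> \<in> linear_maps R T V"
  and \<theta>_one: "\<theta> \<one>\<^bsub>T\<^esub> = \<one>\<^bsub>V\<^esub>"
  and \<theta>_mult: "\<lbrakk>x \<in> carrier M; t \<in> carrier T\<rbrakk> \<Longrightarrow> \<theta> (i x \<otimes>\<^bsub>T\<^esub> t) = \<beta> (j x) \<otimes>\<^bsub>V\<^esub> \<theta> t"
  unfolding \<theta>_def by (simp_all add: rec.rec_linear rec.rec_one rec.rec_mult)

lemmas \<theta>_closed [simp] = linear_mapsD(1)[OF \<theta>_linear]

lemma \<theta>_incl: "x \<in> carrier M \<Longrightarrow> \<theta> (i x) = \<beta> (j x)"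
  using \<theta>_mult[of x "\<one>\<^bsub>T\<^esub>"] by (simp add: \<theta>_one)

definition "smash_lift = tensor_lift R V (\<lambda>a u. \<alpha> a \<otimes>\<^bsub>V\<^esub> \<theta> u)"

lemma smash_lift_linear: "smash_lift \<in> linear_maps R AH V"
  and smash_lift_pure: "\<lbrakk>a \<in> carrier S; u \<in> carrier T\<rbrakk> \<Longrightarrow> smash_lift (sharp R M a u) = \<alpha> a \<otimes>\<^bsub>V\<^esub> \<theta> u"
proof -
  note b = V.bilinear_mult
  have "bilinear_map R S T V (\<lambda>a u. \<alpha> a \<otimes>\<^bsub>V\<^esub> \<theta> u)"
    by (intro bilinear_mapI linear_maps_compose[OF \<theta>_linear bilinear_mapD(1)[OF b]]
        linear_maps_compose[OF algebra_homD(1)[OF \<alpha>_hom] bilinear_mapD(2)[OF b]]) simp_all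
  note * = AH.tensor_lift[OF Vmod this]
  show "smash_lift \<in> linear_maps R AH V" unfolding smash_lift_def by (rule *(1))
  show "\<lbrakk>a \<in> carrier S; u \<in> carrier T\<rbrakk> \<Longrightarrow> smash_lift (sharp R M a u) = \<alpha> a \<otimes>\<^bsub>V\<^esub> \<theta> u"
    unfolding smash_lift_def by (rule *(2))
qed

lemmas smash_lift_closed [simp] = linear_mapsD(1)[OF smash_lift_linear]

lemma V_mult_linear: "v \<in> carrier V \<Longrightarrow> (\<lambda>w. v \<otimes>\<^bsub>V\<^esub> w) \<in> linear_maps R V V"
  "v \<in> carrier V \<Longrightarrow> (\<lambda>w. w \<otimes>\<^bsub>V\<^esub> v) \<in> linear_maps R V V"
  using bilinear_mapD[OF V.bilinear_mult] by auto

lemma smash_lift_sm: "\<lbrakk>a \<in> carrier S; s \<in> carrier AH\<rbrakk> \<Longrightarrow> smash_lift (sm a s) = \<alpha> a \<otimes>\<^bsub>V\<^esub> smash_lift s"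
  by (rule AH.tensor_linear_eq[OF linear_maps_compose[OF sm_lin smash_lift_linear] linear_maps_compose[OF smash_lift_linear V_mult_linear(1)]])
    (simp_all add: sm_pure smash_lift_pure \<alpha>_mult V.m_assoc)

text \<open>The commutation relation between \<open>x\<close> and \<open>b\<close> in the smash product is mapped to the one between
  \<open>\<beta>(x)\<close> and \<open>\<alpha>(b)\<close>. Multiplicativity of \<open>smash_lift\<close> follows, since left multiplications in the smash
  product are composed of \<open>gen_act x\<close> and the action of \<open>Sym(M)\<close>.\<close>

lemma smash_lift_gen_act: "\<lbrakk>x \<in> carrier M; s \<in> carrier AH\<rbrakk> \<Longrightarrow> smash_lift (gen_act x s) = \<beta> (j x) \<otimes>\<^bsub>V\<^esub> smash_lift s"
proof (rule AH.tensor_linear_eq[OF linear_maps_compose[OF gen_act_lin smash_lift_linear] linear_maps_compose[OF smash_lift_linear V_mult_linear(1)]])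
  fix b v assume x: "x \<in> carrier M" and b: "b \<in> carrier S" and v: "v \<in> carrier T"
  have "smash_lift (gen_act x (sharp R M b v)) = (\<alpha> (br (j x) b) \<oplus>\<^bsub>V\<^esub> \<alpha> b \<otimes>\<^bsub>V\<^esub> \<beta> (j x)) \<otimes>\<^bsub>V\<^esub> \<theta> v"
    using x b v by (simp add: gen_act_pure linear_mapsD(2)[OF smash_lift_linear] AH.pure_closed smash_lift_pure \<theta>_mult V.l_distr V.m_assoc)
  also have "\<dots> = \<beta> (j x) \<otimes>\<^bsub>V\<^esub> smash_lift (sharp R M b v)"
    unfolding \<beta>_\<alpha>[OF sym_incl_closed[OF x] b, symmetric] using x b v by (simp add: smash_lift_pure V.m_assoc)
  finally show "smash_lift (gen_act x (sharp R M b v)) = \<beta> (j x) \<otimes>\<^bsub>V\<^esub> smash_lift (sharp R M b v)" .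
qed simp_all

lemma smash_lift_talg_act:
  assumes "u \<in> carrier T" and s: "s \<in> carrier AH"
  shows "smash_lift (talg_act u s) = \<theta> u \<otimes>\<^bsub>V\<^esub> smash_lift s"
  by (rule talg_linear_eq[OF linear_maps_compose[OF bilinear_mapD(2)[OF talg_act_bilinear s] smash_lift_linear]
        linear_maps_compose[OF \<theta>_linear V_mult_linear(2)[OF smash_lift_closed[OF s]]] _ _ assms(1)])
    (simp_all add: s talg_act_one talg_act_mult smash_lift_gen_act \<theta>_one \<theta>_mult V.m_assoc)

lemma smash_lift_hom: "smash_lift \<in> algebra_hom R B V"
proof (rule algebra_homI)
  show "smash_lift (X \<otimes>\<^bsub>B\<^esub> Y) = smash_lift X \<otimes>\<^bsub>V\<^esub> smash_lift Y" if X: "X \<in> carrier B" and Y: "Y \<in> carrier B" for X Y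
  proof (rule AH.tensor_linear_eq[OF linear_maps_compose[OF B_mult(1) smash_lift_linear]
        linear_maps_compose[OF smash_lift_linear V_mult_linear(2)]])
    show "X \<in> carrier AH" "Y \<in> carrier AH" "smash_lift Y \<in> carrier V" using X Y by simp_all
    fix a u assume "a \<in> carrier S" "u \<in> carrier T"
    then show "smash_lift (sharp R M a u \<otimes>\<^bsub>B\<^esub> Y) = smash_lift (sharp R M a u) \<otimes>\<^bsub>V\<^esub> smash_lift Y"
      using Y by (simp add: B_mult(2) smash_lift_sm smash_lift_talg_act smash_lift_pure V.m_assoc)
  qed
qed (simp_all add: smash_lift_linear smash_lift_pure \<alpha>_one \<theta>_one)

text \<open>Both sides are derivations along \<open>\<alpha>\<close> with the same values on \<open>M\<close>. This is what turns the
  generators of \<open>J\<close> into the Lie identity for \<open>\<beta>\<close>.\<close>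

lemma smash_lift_psi: "a \<in> carrier S \<Longrightarrow> smash_lift (\<psi> a) = \<beta> a"
proof (induction a rule: sym_induct)
  case one
  show ?case by (simp add: psi_one \<beta>_one linear_maps_zero[OF smash_lift_linear AH.tensor_module Vmod])
next
  case (mult x a)
  then show ?case
    by (simp add: psi_leibniz psi_incl linear_mapsD(2)[OF smash_lift_linear] smash_lift_sm smash_lift_pure AH.pure_closed \<alpha>_one \<theta>_incl \<beta>_mult)
next
  case (add a b)
  then show ?case by (simp add: linear_mapsD(2)[OF psi_linear] linear_mapsD(2)[OF smash_lift_linear] \<beta>_lin(2))
next
  case (smult r a)
  then show ?case by (simp add: linear_mapsD(3)[OF psi_linear] linear_mapsD(3)[OF smash_lift_linear] \<beta>_lin(3))
qed

lemma smash_lift_null: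
  assumes "s \<in> J_ideal R M br"
  shows "smash_lift s = \<zero>\<^bsub>V\<^esub>"
proof -
  let ?K = "{s \<in> carrier B. smash_lift s = \<zero>\<^bsub>V\<^esub>}"
  note gB = algebra_homD[OF smash_lift_hom]
  have K: "submodule ?K R B"
    by (rule linear_kernel_submodule[OF gB(1) B_module Vmod])
  have "ideal ?K B"
  proof (rule idealI)
    show "ring B" by (rule B.ring_axioms)
    show "subgroup ?K (add_monoid B)" using K by (simp add: submodule_def)
    show "t \<otimes>\<^bsub>B\<^esub> s \<in> ?K" "s \<otimes>\<^bsub>B\<^esub> t \<in> ?K" if "s \<in> ?K" "t \<in> carrier B" for s t
      using that B_closed by (simp_all add: gB(2))
  qed
  moreover have "J_rels \<subseteq> ?K"
  proof
    fix s assume "s \<in> J_rels"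
    then obtain x y where s: "s = sharp R M \<one>\<^bsub>S\<^esub> (i x \<otimes>\<^bsub>T\<^esub> i y \<ominus>\<^bsub>T\<^esub> i y \<otimes>\<^bsub>T\<^esub> i x) \<ominus>\<^bsub>B\<^esub> \<psi> (br (j x) (j y))"
      and xy: "x \<in> carrier M" "y \<in> carrier M" unfolding J_rels_def by blast
    let ?t = "i x \<otimes>\<^bsub>T\<^esub> i y \<ominus>\<^bsub>T\<^esub> i y \<otimes>\<^bsub>T\<^esub> i x"
    have t: "?t \<in> carrier T" using xy by (simp add: T.M.minus_closed)
    have "\<theta> ?t = \<theta> (i x \<otimes>\<^bsub>T\<^esub> i y) \<ominus>\<^bsub>V\<^esub> \<theta> (i y \<otimes>\<^bsub>T\<^esub> i x)"
      using xy by (intro linear_maps_minus[OF \<theta>_linear T.module_axioms Vmod]) auto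
    also have "\<dots> = \<beta> (br (j x) (j y))"
      using xy by (simp add: \<theta>_mult \<theta>_incl \<beta>_br)
    finally have "smash_lift (sharp R M \<one>\<^bsub>S\<^esub> ?t) = smash_lift (\<psi> (br (j x) (j y)))"
      using xy t by (simp add: smash_lift_pure smash_lift_psi \<alpha>_one)
    moreover have "smash_lift s = smash_lift (sharp R M \<one>\<^bsub>S\<^esub> ?t) \<ominus>\<^bsub>V\<^esub> smash_lift (\<psi> (br (j x) (j y)))"
      unfolding s using xy t by (intro linear_maps_minus[OF gB(1) B_module Vmod]) (simp_all add: AH.pure_closed)
    ultimately have "smash_lift s = \<zero>\<^bsub>V\<^esub>"
      using xy t by (simp add: V.M.minus_eq_zero_iff)
    then show "s \<in> ?K" using \<open>s \<in> J_rels\<close> J_rels_closed by auto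
  qed
  ultimately have "J_ideal R M br \<subseteq> ?K" unfolding J_eq by (rule genideal_minimal)
  then show ?thesis using assms by auto
qed

text \<open>Existence: \<open>smash_lift\<close> kills \<open>J\<close> and descends. Uniqueness: \<open>U\<close> is generated as an algebra by
  the images of \<open>\<alpha>\<close> and \<open>\<beta>\<close>, because \<open>a # u = (a # 1)(1 # u)\<close> and \<open>1 # xt = \<psi>(x)(1 # t)\<close>.\<close>

lemma universal:
  "\<exists>!\<gamma>. \<gamma> \<in> extensional (carrier U) \<and> \<gamma> \<in> algebra_hom R U V \<and>
    (\<forall>a\<in>carrier S. \<gamma> (\<pi> (sharp R M a \<one>\<^bsub>T\<^esub>)) = \<alpha> a \<and> \<gamma> (\<pi> (\<psi> a)) = \<beta> a)"
proof -
  interpret Um: assoc_algebra R U by (rule J.quot_assoc_algebra)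
  note pl = algebra_homD(1)[OF pi_hom, simplified]
  note pm = algebra_homD(2)[OF pi_hom, simplified]
  note p1 = algebra_homD(3)[OF pi_hom, simplified]
  note pc = linear_mapsD(1)[OF pl]
  note gB = algebra_homD(1)[OF smash_lift_hom]
  note pure = AH.pure_closed S.one_closed T.one_closed
  define \<gamma> where "\<gamma> = restrict (\<lambda>X. smash_lift (SOME s. s \<in> X)) (carrier U)"
  have \<gamma>_proj: "\<gamma> (\<pi> s) = smash_lift s" if "s \<in> carrier AH" for s
    using J.quot_lift(2)[OF gB Vmod smash_lift_null] pc[OF that] that by (simp add: \<gamma>_def J_proj_def)
  have \<gamma>_lin: "\<gamma> \<in> linear_maps R U V"
    by (rule linear_maps_cong[OF J.quot_lift(1)[OF gB Vmod smash_lift_null] Um.module_axioms]) (simp_all add: \<gamma>_def)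
  have \<gamma>_hom: "\<gamma> \<in> algebra_hom R U V"
  proof (rule algebra_homI[OF \<gamma>_lin])
    show "\<gamma> (X \<otimes>\<^bsub>U\<^esub> Y) = \<gamma> X \<otimes>\<^bsub>V\<^esub> \<gamma> Y" if XY: "X \<in> carrier U" "Y \<in> carrier U" for X Y
    proof -
      obtain s t where st: "s \<in> carrier AH" "X = \<pi> s" "t \<in> carrier AH" "Y = \<pi> t"
        using pi_surj[OF XY(1)] pi_surj[OF XY(2)] by blast
      then show ?thesis
        using algebra_homD(2)[OF smash_lift_hom] by (simp add: pm[symmetric] \<gamma>_proj B_closed)
    qed
    show "\<gamma> \<one>\<^bsub>U\<^esub> = \<one>\<^bsub>V\<^esub>"
      using algebra_homD(3)[OF smash_lift_hom] by (simp add: p1[symmetric] \<gamma>_proj pure)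
  qed
  have \<gamma>_vals: "\<gamma> (\<pi> (sharp R M a \<one>\<^bsub>T\<^esub>)) = \<alpha> a \<and> \<gamma> (\<pi> (\<psi> a)) = \<beta> a" if "a \<in> carrier S" for a
    using that by (simp add: \<gamma>_proj pure smash_lift_pure \<theta>_one smash_lift_psi)
  have unique: "\<gamma>1 = \<gamma>2"
    if 1: "\<gamma>1 \<in> extensional (carrier U)" "\<gamma>1 \<in> algebra_hom R U V"
      "\<And>a. a \<in> carrier S \<Longrightarrow> \<gamma>1 (\<pi> (sharp R M a \<one>\<^bsub>T\<^esub>)) = \<alpha> a \<and> \<gamma>1 (\<pi> (\<psi> a)) = \<beta> a"
    and 2: "\<gamma>2 \<in> extensional (carrier U)" "\<gamma>2 \<in> algebra_hom R U V"
      "\<And>a. a \<in> carrier S \<Longrightarrow> \<gamma>2 (\<pi> (sharp R M a \<one>\<^bsub>T\<^esub>)) = \<alpha> a \<and> \<gamma>2 (\<pi> (\<psi> a)) = \<beta> a"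
    for \<gamma>1 \<gamma>2
  proof (rule extensionalityI[OF 1(1) 2(1)])
    fix X assume "X \<in> carrier U"
    then obtain s where s: "s \<in> carrier AH" "X = \<pi> s" using pi_surj by blast
    have eq: "\<delta> (\<pi> s) = smash_lift s"
      if \<delta>: "\<delta> \<in> algebra_hom R U V"
        and vals: "\<And>a. a \<in> carrier S \<Longrightarrow> \<delta> (\<pi> (sharp R M a \<one>\<^bsub>T\<^esub>)) = \<alpha> a \<and> \<delta> (\<pi> (\<psi> a)) = \<beta> a" for \<delta>
    proof (rule AH.tensor_linear_eq[OF linear_maps_compose[OF pl algebra_homD(1)[OF \<delta>]] smash_lift_linear _ s(1)])
      have dm: "\<delta> (\<pi> (s \<otimes>\<^bsub>B\<^esub> t)) = \<delta> (\<pi> s) \<otimes>\<^bsub>V\<^esub> \<delta> (\<pi> t)" if "s \<in> carrier AH" "t \<in> carrier AH" for s t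
        using that by (simp add: pm algebra_homD(2)[OF \<delta>] pc)
      fix a u assume a: "a \<in> carrier S" and u: "u \<in> carrier T"
      have "\<delta> (\<pi> (sharp R M \<one>\<^bsub>S\<^esub> u)) = \<theta> u"
      proof (rule talg_linear_eq[OF linear_maps_compose[OF bilinear_mapD(1)[OF AH.pure_tensor_bilinear S.one_closed]
              linear_maps_compose[OF pl algebra_homD(1)[OF \<delta>]]] \<theta>_linear _ _ u])
        show "\<delta> (\<pi> (sharp R M \<one>\<^bsub>S\<^esub> \<one>\<^bsub>T\<^esub>)) = \<theta> \<one>\<^bsub>T\<^esub>"
          by (simp add: p1 algebra_homD(3)[OF \<delta>] \<theta>_one)
        fix x t assume x: "x \<in> carrier M" and t: "t \<in> carrier T" and IH: "\<delta> (\<pi> (sharp R M \<one>\<^bsub>S\<^esub> t)) = \<theta> t"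
        have "sharp R M \<one>\<^bsub>S\<^esub> (i x \<otimes>\<^bsub>T\<^esub> t) = \<psi> (j x) \<otimes>\<^bsub>B\<^esub> sharp R M \<one>\<^bsub>S\<^esub> t"
          using x t linear_maps_zero[OF bilinear_mapD(2)[OF AH.pure_tensor_bilinear t] S.module_axioms AH.tensor_module]
          by (simp add: psi_incl gen_act_eq_mult gen_act_pure br_one_right pure)
        then show "\<delta> (\<pi> (sharp R M \<one>\<^bsub>S\<^esub> (i x \<otimes>\<^bsub>T\<^esub> t))) = \<theta> (i x \<otimes>\<^bsub>T\<^esub> t)"
          using x t vals[OF sym_incl_closed[OF x]] by (simp add: dm IH \<theta>_mult pure)
      qed
      moreover have "sharp R M a u = sharp R M a \<one>\<^bsub>T\<^esub> \<otimes>\<^bsub>B\<^esub> sharp R M \<one>\<^bsub>S\<^esub> u"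
        using a u by (simp add: sm_eq_mult sm_pure pure)
      ultimately have "\<delta> (\<pi> (sharp R M a u)) = \<alpha> a \<otimes>\<^bsub>V\<^esub> \<theta> u"
        using a u vals[OF a] by (simp add: dm pure)
      then show "\<delta> (\<pi> (sharp R M a u)) = smash_lift (sharp R M a u)"
        using a u by (simp add: smash_lift_pure)
    qed
    show "\<gamma>1 X = \<gamma>2 X"
      unfolding s(2) using eq[OF 1(2,3)] eq[OF 2(2,3)] by simp
  qed
  show ?thesis
    using \<gamma>_hom \<gamma>_vals unique by (intro ex1I[of _ \<gamma>]) (auto simp: \<gamma>_def)
qed

end

theorem theorem2p14:
  fixes R :: "('r, 'k) ring_scheme"
    and M :: "('r, 'm, 'l) module_scheme"
    and br :: "('m list \<Rightarrow> 'r) set set \<Rightarrow> ('m list \<Rightarrow> 'r) set set \<Rightarrow> ('m list \<Rightarrow> 'r) set set"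
  assumes "module R M"
    and "poisson_algebra R (sym_alg R M) br"
  shows "poisson_enveloping_algebra TYPE('v) R (sym_alg R M) br
    (quot_alg (sym_smash R M br) (J_ideal R M br))
    (\<lambda>a. J_proj R M br (sharp R M a \<one>\<^bsub>talg R M\<^esub>))
    (\<lambda>a. J_proj R M br (psi R M br a))"
proof -
  interpret poisson_sym R M br
    using assms by (intro poisson_sym.intro tensor_algebra.intro)
  show ?thesis
    unfolding poisson_enveloping_algebra_def
  proof (intro conjI allI impI quotient_triple)
    fix V :: "('r, 'v) module" and \<alpha> \<beta>
    assume "poisson_triple R (sym_alg R M) br V \<alpha> \<beta>"
    then interpret poisson_target R M br V \<alpha> \<beta>
      by (intro poisson_target.intro poisson_target_axioms.intro poisson_sym_axioms)
    show "\<exists>!\<gamma>. \<gamma> \<in> extensional (carrier U) \<and> \<gamma> \<in> algebra_hom R U V \<and>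
        (\<forall>a\<in>carrier S. \<gamma> (\<pi> (sharp R M a \<one>\<^bsub>T\<^esub>)) = \<alpha> a \<and> \<gamma> (\<pi> (\<psi> a)) = \<beta> a)"
      by (rule universal)
  qed
qed

end
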